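(* For all integers $n,k$, the mappings $\Phi'$ and $\Psi'$ induce successive bijections between (a) well-labelled positive paths of size $n$ with $k$ horizontal steps, (b) marked labelled binary trees with $n$ leaves, $k$ of which are quasi-single leaves, and (c) matchings on $[2n]$ having $k$ pairs $(i,j)$ with $i\in\{1,\ldots,n\}$ and $j\in\{n+1,\ldots,2n-1\}$.
   Context: A well-labelled path of size $n$ is a pair $(\mathbf{p},\sigma)$ where $\mathbf{p}=p_1\ldots p_{n-1}$ is a word on $\{-1,0,+1\}$ and $\sigma$ is a permutation of $[n]$ such that $p_i=-1$ implies $\sigma_i<\sigma_{i+1}$ and $p_i=1$ implies $\sigma_i>\sigma_{i+1}$. It is Motzkin if $\sum_{i=1}^j p_i\ge 0$ for $j\le n-2$ and $\sum_{i=1}^{n-1}p_i=-1$; positive if $\sum_{i=1}^j p_i\ge0$ for all $j\le n-1$. A horizontal step is a letter $0$ in $\mathbf{p}$. For a set $I$ of $m$ integers, $\lambda_I$ is the order-preserving bijection $[m]\to I$. A labelled binary tree of size $n$ is a rooted tree with $n$ leaves carrying distinct labels in $[n]$, each internal vertex having exactly two unordered children; a marked one has one marked vertex (internal or leaf). $\lambda(\tau)$ replaces each leaf label $i$ by $\lambda(i)$. A leaf of a marked tree is quasi-single if it is not marked and its sibling is either marked or internal. A matching on $[2n]$ is a fixed-point-free involution. $\Phi$ (Motzkin paths of size $n\ge2$ to labelled binary trees): (i) the size-2 path maps to the size-2 tree; (ii) if $n>2$, $p_1=0$: with $\mathbf{p}'=p_2\ldots p_{n-1}$, $\sigma'_i=\lambda^{-1}_{[n]\setminus\{\sigma_1\}}(\sigma_{i+1})$,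 the image is a root with a leaf labelled $\sigma_1$ and subtree $\lambda_{[n]\setminus\{\sigma_1\}}(\Phi(\mathbf{p}',\sigma'))$; (iii) if $n>2$, $p_1=1$: $k$ least with $\sum_{i=1}^kp_i=0$, $I'=\{\sigma_1..\sigma_k\}$, $I''=\{\sigma_{k+1}..\sigma_n\}$, $p'_i=-p_{k-i}$, $p''_i=p_{k+i}$, $\sigma'_i=\lambda^{-1}_{I'}(\sigma_{k+1-i})$, $\sigma''_i=\lambda^{-1}_{I''}(\sigma_{k+i})$; the image is a root with subtrees $\lambda_{I'}(\Phi(\mathbf{p}',\sigma'))$, $\lambda_{I''}(\Phi(\mathbf{p}'',\sigma''))$. $\Phi'$ (positive paths to marked trees): (i) size-1 path maps to a single marked leaf; (ii) if $n>1$, $p_1=0$: unmarked root, unmarked leaf $\sigma_1$, marked subtree $\lambda_{[n]\setminus\{\sigma_1\}}(\Phi'(\mathbf{p}',\sigma'))$; (iii) if $n>1$, $p_1=1$: $k\le n$ greatest with $\sum_{i=1}^{j-1}p_i\ge1$ for $j=2..k-1$ and $\sum_{i=1}^{k-1}p_i=1$, pieces defined by the same formulas; if $k=n$ the image is $\Phi(\mathbf{p}',\sigma')$ with root marked, otherwise an unmarked root with unmarked subtree $\lambda_{I'}(\Phi(\mathbf{p}',\sigma'))$ and marked subtree $\lambda_{I''}(\Phi'(\mathbf{p}'',\sigma''))$. $\Psi$ (Chen's bijection, labelled binary trees with $n$ leaves to matchings on $[2n-2]$): label the $n-2$ internal non-root vertices: repeatedly, among unlabelled non-root vertices both of whose children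 are labelled, take the one having the child with least label and give it the least unused label in $\{n+1,\ldots,2n-2\}$; then $\pi(i)=j$ whenever $i,j$ are labels of siblings. $\Psi'$ (marked trees with $n$ leaves to matchings on $[2n]$): let $\pi=\Psi(\tau)$ for the unmarked tree $\tau$; if the marked vertex is the root, $\pi'$ agrees with $\pi$ on $[2n-2]$ and $\pi'(2n-1)=2n$; otherwise, with $k$ the label of the marked vertex and $l$ that of its sibling, $\pi'(i)=\pi(i)$ for $i\ne k,l$, $\pi'(k)=2n$, $\pi'(l)=2n-1$. *)

theory Defs
  imports Main
begin

text \<open>A well-labelled path of size n is a pair (p, sigma): p is a word of length n-1
on {-1,0,1} (a list of integers), sigma a permutation of [n] = {1..n} given as the list
sigma_1 ... sigma_n.  List positions are 0-based in Isabelle, so p!i is p_(i+1).\<close>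

definition well_labelled :: "nat \<Rightarrow> int list \<Rightarrow> nat list \<Rightarrow> bool" where
  "well_labelled n p \<sigma> \<longleftrightarrow>
     length \<sigma> = n \<and> length p = n - 1 \<and> distinct \<sigma> \<and> set \<sigma> = {1..n} \<and>
     set p \<subseteq> {-1, 0, 1} \<and>
     (\<forall>i < n - 1. (p ! i = -1 \<longrightarrow> \<sigma> ! i < \<sigma> ! (i+1)) \<and>
                  (p ! i = 1 \<longrightarrow> \<sigma> ! i > \<sigma> ! (i+1)))"

definition positive_path :: "int list \<Rightarrow> bool" where
  "positive_path p \<longleftrightarrow> (\<forall>j \<le> length p. sum_list (take j p) \<ge> 0)"

definition hsteps :: "int list \<Rightarrow> nat" where
  "hsteps p = length (filter (\<lambda>x. x = 0) p)"

definition pos_paths :: "nat \<Rightarrow> nat \<Rightarrow> (int list \<times> nat list) set" where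
  "pos_paths n k = {(p, \<sigma>). well_labelled n p \<sigma> \<and> positive_path p \<and> hsteps p = k}"

text \<open>Binary trees with unordered children are represented by canonical ordered
representatives: in every internal node the left child carries the smaller minimal
leaf label.  A marked vertex is represented by the subtree rooted at it (vertices are
determined by their subtrees since leaf labels are distinct).\<close>

datatype btree = Lf nat | Nd btree btree

fun leaves :: "btree \<Rightarrow> nat list" where
  "leaves (Lf i) = [i]"
| "leaves (Nd a b) = leaves a @ leaves b"

definition minleaf :: "btree \<Rightarrow> nat" where
  "minleaf t = Min (set (leaves t))"

fun subtrees :: "btree \<Rightarrow> btree set" where
  "subtrees (Lf i) = {Lf i}"
| "subtrees (Nd a b) = insert (Nd a b) (subtrees a \<union> subtrees b)"

fun canonical :: "btree \<Rightarrow> bool" where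
  "canonical (Lf i) = True"
| "canonical (Nd a b) = (canonical a \<and> canonical b \<and> minleaf a < minleaf b)"

fun canon :: "btree \<Rightarrow> btree" where
  "canon (Lf i) = Lf i"
| "canon (Nd a b) = (let a' = canon a; b' = canon b in
                      if minleaf a' \<le> minleaf b' then Nd a' b' else Nd b' a')"

fun relabel :: "(nat \<Rightarrow> nat) \<Rightarrow> btree \<Rightarrow> btree" where
  "relabel f (Lf i) = Lf (f i)"
| "relabel f (Nd a b) = Nd (relabel f a) (relabel f b)"

definition is_node :: "btree \<Rightarrow> bool" where
  "is_node t \<longleftrightarrow> (\<exists>a b. t = Nd a b)"

definition qs_leaves :: "btree \<times> btree \<Rightarrow> nat set" where
  "qs_leaves tv = (case tv of (t, v) \<Rightarrow>
     {i. Lf i \<noteq> v \<and> (\<exists>a b. Nd a b \<in> subtrees t \<and>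
          ((a = Lf i \<and> (b = v \<or> is_node b)) \<or> (b = Lf i \<and> (a = v \<or> is_node a))))})"

definition marked_trees :: "nat \<Rightarrow> nat \<Rightarrow> (btree \<times> btree) set" where
  "marked_trees n k = {(t, v). canonical t \<and> distinct (leaves t) \<and> set (leaves t) = {1..n}
       \<and> v \<in> subtrees t \<and> card (qs_leaves (t, v)) = k}"

definition matchings :: "nat \<Rightarrow> nat \<Rightarrow> (nat \<Rightarrow> nat) set" where
  "matchings n k = {\<pi>. (\<forall>i. i \<notin> {1..2*n} \<longrightarrow> \<pi> i = i) \<and>
       (\<forall>i\<in>{1..2*n}. \<pi> i \<noteq> i \<and> \<pi> (\<pi> i) = i) \<and>
       card {i\<in>{1..n}. \<pi> i \<in> {n+1..2*n-1}} = k}"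

definition lam :: "nat set \<Rightarrow> nat \<Rightarrow> nat" where
  "lam I i = sorted_list_of_set I ! (i - 1)"

definition lam_inv :: "nat set \<Rightarrow> nat \<Rightarrow> nat" where
  "lam_inv I x = card {y\<in>I. y < x} + 1"

text \<open>Phi, computed with a fuel argument (the size suffices on valid inputs,
since all recursive calls are on strictly smaller paths).\<close>
primrec phi_aux :: "nat \<Rightarrow> int list \<Rightarrow> nat list \<Rightarrow> btree" where
  "phi_aux 0 p \<sigma> = Lf 0"
| "phi_aux (Suc f) p \<sigma> =
    (if length \<sigma> \<le> 2 then Nd (Lf (\<sigma> ! 0)) (Lf (\<sigma> ! 1))
     else if hd p = 0 then
       (let I = {1..length \<sigma>} - {hd \<sigma>} in
        Nd (Lf (hd \<sigma>)) (relabel (lam I) (phi_aux f (tl p) (map (lam_inv I) (tl \<sigma>)))))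
     else
       (let k = (LEAST k. 0 < k \<and> sum_list (take k p) = 0);
            I1 = set (take k \<sigma>); I2 = set (drop k \<sigma>) in
        Nd (relabel (lam I1) (phi_aux f (map uminus (rev (take (k - 1) p)))
                                        (map (lam_inv I1) (rev (take k \<sigma>)))))
           (relabel (lam I2) (phi_aux f (drop k p) (map (lam_inv I2) (drop k \<sigma>))))))"

definition Phi :: "int list \<Rightarrow> nat list \<Rightarrow> btree" where
  "Phi p \<sigma> = phi_aux (length \<sigma>) p \<sigma>"

primrec phim_aux :: "nat \<Rightarrow> int list \<Rightarrow> nat list \<Rightarrow> btree \<times> btree" where
  "phim_aux 0 p \<sigma> = (Lf 0, Lf 0)"
| "phim_aux (Suc f) p \<sigma> =
    (if length \<sigma> \<le> 1 then (Lf (hd \<sigma>), Lf (hd \<sigma>))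
     else if hd p = 0 then
       (let I = {1..length \<sigma>} - {hd \<sigma>};
            tv = phim_aux f (tl p) (map (lam_inv I) (tl \<sigma>)) in
        (Nd (Lf (hd \<sigma>)) (relabel (lam I) (fst tv)), relabel (lam I) (snd tv)))
     else
       (let n = length \<sigma>;
            k = (GREATEST k. k \<le> n \<and> 1 \<le> k \<and>
                   (\<forall>j\<in>{2..k-1}. sum_list (take (j - 1) p) \<ge> 1) \<and>
                   sum_list (take (k - 1) p) = 1);
            I1 = set (take k \<sigma>); I2 = set (drop k \<sigma>);
            p1 = map uminus (rev (take (k - 1) p));
            s1 = map (lam_inv I1) (rev (take k \<sigma>));
            p2 = drop k p;
            s2 = map (lam_inv I2) (drop k \<sigma>) in
        if k = n then (Phi p1 s1, Phi p1 s1)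
        else (let tv = phim_aux f p2 s2 in
              (Nd (relabel (lam I1) (Phi p1 s1)) (relabel (lam I2) (fst tv)),
               relabel (lam I2) (snd tv)))))"

definition Phi' :: "int list \<times> nat list \<Rightarrow> btree \<times> btree" where
  "Phi' = (\<lambda>(p, \<sigma>). let tv = phim_aux (length \<sigma>) p \<sigma> in (canon (fst tv), canon (snd tv)))"

definition chen_cands :: "btree \<Rightarrow> (btree \<Rightarrow> nat option) \<Rightarrow> btree set" where
  "chen_cands t L = {v \<in> subtrees t. v \<noteq> t \<and> L v = None \<and>
      (case v of Lf _ \<Rightarrow> False | Nd a b \<Rightarrow> L a \<noteq> None \<and> L b \<noteq> None)}"

definition chen_key :: "(btree \<Rightarrow> nat option) \<Rightarrow> btree \<Rightarrow> nat" where
  "chen_key L v = (case v of Lf _ \<Rightarrow> 0 | Nd a b \<Rightarrow> min (the (L a)) (the (L b)))"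

definition chen_step :: "btree \<Rightarrow> (btree \<Rightarrow> nat option) \<times> nat \<Rightarrow> (btree \<Rightarrow> nat option) \<times> nat" where
  "chen_step t = (\<lambda>(L, m). let C = chen_cands t L in
      if C = {} then (L, m)
      else let v = (SOME v. v \<in> C \<and> (\<forall>w\<in>C. chen_key L v \<le> chen_key L w)) in
           (L(v := Some m), Suc m))"

definition nleaves :: "btree \<Rightarrow> nat" where
  "nleaves t = length (leaves t)"

text \<open>Labels of the vertices: leaves keep their labels, the n-2 internal non-root
vertices receive n+1, ..., 2n-2 in Chen's order.\<close>
definition chen_labels :: "btree \<Rightarrow> btree \<Rightarrow> nat option" where
  "chen_labels t = fst ((chen_step t ^^ (nleaves t - 2))
       (\<lambda>v. case v of Lf i \<Rightarrow> Some i | Nd _ _ \<Rightarrow> None, nleaves t + 1))"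

definition sib_lab :: "btree \<Rightarrow> nat \<Rightarrow> nat \<Rightarrow> bool" where
  "sib_lab t i j \<longleftrightarrow> (\<exists>a b. Nd a b \<in> subtrees t \<and>
       ((chen_labels t a = Some i \<and> chen_labels t b = Some j) \<or>
        (chen_labels t a = Some j \<and> chen_labels t b = Some i)))"

definition Psi :: "btree \<Rightarrow> nat \<Rightarrow> nat" where
  "Psi t i = (if \<exists>j. sib_lab t i j then (THE j. sib_lab t i j) else i)"

definition sibling :: "btree \<Rightarrow> btree \<Rightarrow> btree" where
  "sibling t v = (THE s. Nd v s \<in> subtrees t \<or> Nd s v \<in> subtrees t)"

definition Psi' :: "btree \<times> btree \<Rightarrow> nat \<Rightarrow> nat" where
  "Psi' = (\<lambda>(t, v) i. let n = nleaves t; \<pi> = Psi t in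
     if v = t then (if i = 2*n - 1 then 2*n else if i = 2*n then 2*n - 1 else \<pi> i)
     else (let k = the (chen_labels t v); l = the (chen_labels t (sibling t v)) in
           if i = k then 2*n else if i = l then 2*n - 1
           else if i = 2*n then k else if i = 2*n - 1 then l else \<pi> i))"

end

theory Submission
  imports Defs
begin

text \<open>
  Both decompositions of paths are reversible. A step \<open>p\<^sub>k = \<plusminus>1\<close> joining two pieces is forced by the
  labels at its ends, so an unordered pair of subtrees can be glued back to a path in exactly one way:
  for \<open>\<Phi>\<close> the piece with the smaller first label comes first, for \<open>\<Phi>'\<close> the unmarked piece comes first and
  the sign of the step is read off the labels. Horizontal steps correspond to splitting off a leaf.

  For Chen's bijection, the sibling pairs of labels determine the order in which the internal vertices were
  labelled: vertex \<open>m\<close> always takes, among the unused pairs with both labels below \<open>m\<close>, the one with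
  the least minimum. By the pigeonhole principle such a pair exists for every matching, so the process can be
  run on any matching and rebuilds a tree. The mark is encoded by the partner of \<open>2n\<close>.
\<close>

section \<open>Canonical representatives\<close>

text \<open>What shapes the proof is that \<open>Phi\<close> and \<open>Phi'\<close> build ordered
  trees with renormalised labels, while an unordered tree is a canonical form. Paths are therefore
  related to trees by rules on arbitrary distinct labels, and trees are compared only after
  \<open>canon\<close>. Reading a piece backwards with negated steps turns a stretch that stays at
  height at least 1 and ends at height 1 into a Motzkin path and keeps the label inequalities valid;
  this is why both decompositions cut off a Motzkin path. The statistics agree for a local reason:
  splitting off a leaf creates one quasi-single leaf and one horizontal step, and no other rule
  creates either. On the side of matchings, labels above \<open>n\<close> belong to internal
  vertices, so a leaf with internal sibling has a partner above \<open>n\<close>; the sibling of the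
  mark is moved to \<open>2*n-1\<close> and counts, a marked leaf is moved to \<open>2*n\<close> and
  does not. This is the origin of the asymmetric range \<open>{n+1..2*n-1}\<close>.\<close>

lemma leaves_nonempty [simp]: "leaves t \<noteq> []"
  by (induction t) auto

lemma set_leaves_canon [simp]: "set (leaves (canon t)) = set (leaves t)"
  by (induction t) (auto simp: Let_def)

lemma minleaf_canon [simp]: "minleaf (canon t) = minleaf t"
  by (simp add: minleaf_def)

lemma distinct_leaves_canon [simp]: "distinct (leaves (canon t)) = distinct (leaves t)"
  by (induction t) (auto simp: Let_def)

lemma minleaf_in_leaves: "minleaf t \<in> set (leaves t)"
  unfolding minleaf_def by (rule Min_in) auto

lemma minleaf_neq: "set (leaves a) \<inter> set (leaves b) = {} \<Longrightarrow> minleaf a \<noteq> minleaf b"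
  using minleaf_in_leaves[of a] minleaf_in_leaves[of b] by auto

text \<open>Disjoint leaf sets have different minima, so the test \<open>\<le>\<close> in
  \<open>canon\<close> never meets a tie.\<close>

lemma canonical_canon: "distinct (leaves t) \<Longrightarrow> canonical (canon t)"
proof (induction t)
  case (Nd a b)
  then show ?case using minleaf_neq[of a b] by (auto simp: Let_def)
qed simp

lemma canon_canonical: "canonical t \<Longrightarrow> canon t = t"
  by (induction t) (auto simp: Let_def)

lemma canon_Nd_cong: "canon a = canon a' \<Longrightarrow> canon b = canon b' \<Longrightarrow> canon (Nd a b) = canon (Nd a' b')"
  by simp

lemma canon_Nd_swap:
  "set (leaves a) \<inter> set (leaves b) = {} \<Longrightarrow> canon (Nd a b) = canon (Nd b a)"
  using minleaf_neq[of a b] by (auto simp: Let_def)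

lemma canon_Nd_eqD:
  "canon (Nd a b) = canon (Nd c d) \<Longrightarrow>
     canon a = canon c \<and> canon b = canon d \<or> canon a = canon d \<and> canon b = canon c"
  by (auto simp: Let_def split: if_splits)

lemma canon_eq_Lf [simp]: "canon t = Lf i \<longleftrightarrow> t = Lf i" "Lf i = canon t \<longleftrightarrow> t = Lf i"
  by (cases t; auto simp: Let_def)+

lemma is_node_simps [simp]: "is_node (Nd a b)" "\<not> is_node (Lf i)"
  by (auto simp: is_node_def)

lemma is_node_canon [simp]: "is_node (canon t) = is_node t"
  by (cases t) (auto simp: Let_def)

lemma subtrees_canon: "subtrees (canon t) = canon ` subtrees t"
  by (induction t) (auto simp: Let_def)

lemma subtrees_refl [simp]: "t \<in> subtrees t"
  by (cases t) auto

lemma subtrees_leaves: "v \<in> subtrees t \<Longrightarrow> set (leaves v) \<subseteq> set (leaves t)"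
  by (induction t) auto

lemma subtrees_distinct: "v \<in> subtrees t \<Longrightarrow> distinct (leaves t) \<Longrightarrow> distinct (leaves v)"
  by (induction t) auto

lemma subtrees_trans: "v \<in> subtrees w \<Longrightarrow> w \<in> subtrees t \<Longrightarrow> v \<in> subtrees t"
  by (induction t) auto

lemma subtrees_size: "v \<in> subtrees t \<Longrightarrow> v \<noteq> t \<Longrightarrow> size v < size t"
proof (induction t)
  case (Nd a b)
  then show ?case by (cases "v = a"; cases "v = b") auto
qed auto

lemma subtrees_children:
  assumes "Nd a b \<in> subtrees t" shows "a \<in> subtrees t" "b \<in> subtrees t"
  using assms by (auto elim!: subtrees_trans[rotated])

lemma subtrees_disjoint:
  assumes "set (leaves a) \<inter> set (leaves b) = {}" "v \<in> subtrees a"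
  shows "v \<notin> subtrees b"
proof
  assume "v \<in> subtrees b"
  then have "set (leaves v) \<subseteq> set (leaves a) \<inter> set (leaves b)"
    using assms subtrees_leaves by blast
  then show False using assms by simp
qed

lemma subtrees_leaves_eq:
  assumes "distinct (leaves t)" "v \<in> subtrees t" "set (leaves v) = set (leaves t)"
  shows "v = t"
proof (cases t)
  case (Nd a b)
  have "set (leaves a) \<inter> set (leaves b) = {}" using assms(1) Nd by auto
  then have "\<not> set (leaves t) \<subseteq> set (leaves a)" "\<not> set (leaves t) \<subseteq> set (leaves b)"
    using Nd leaves_nonempty by (auto simp del: leaves_nonempty) (metis disjoint_iff leaves_nonempty list.set_sel(1) subsetD)+
  then show ?thesis using assms Nd subtrees_leaves by auto
qed (use assms in auto)

text \<open>Distinct vertices either have disjoint leaf sets or one has strictly fewer leaves below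
  the other. Since \<open>canon\<close> keeps leaf sets, it is injective on the vertices of one
  tree, as marks encoded by subtrees require.\<close>

lemma subtrees_eq_if_leaves_eq:
  assumes "distinct (leaves t)" "v \<in> subtrees t" "w \<in> subtrees t"
    "set (leaves v) = set (leaves w)"
  shows "v = w"
  using assms
proof (induction t)
  case (Nd a b)
  have disj: "set (leaves a) \<inter> set (leaves b) = {}" using Nd.prems(1) by auto
  have top: "x = Nd a b" if "x \<in> subtrees (Nd a b)" "set (leaves x) = set (leaves (Nd a b))" for x
    using subtrees_leaves_eq[OF Nd.prems(1)] that by blast
  have cross: "\<not> (x \<in> subtrees a \<and> y \<in> subtrees b \<and> set (leaves x) = set (leaves y))" for x y
    using disj subtrees_leaves[of x a] subtrees_leaves[of y b] leaves_nonempty[of x]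
    by (metis inf.absorb_iff2 inf.idem inf_mono set_empty subset_empty)
  show ?case
  proof (cases "v = Nd a b \<or> w = Nd a b")
    case True
    then show ?thesis using top Nd.prems by metis
  next
    case False
    then show ?thesis using Nd.prems Nd.IH cross[of v w] cross[of w v] by auto
  qed
qed auto

lemma canon_inj_subtrees:
  "distinct (leaves t) \<Longrightarrow> v \<in> subtrees t \<Longrightarrow> w \<in> subtrees t \<Longrightarrow> canon v = canon w \<Longrightarrow> v = w"
  by (metis set_leaves_canon subtrees_eq_if_leaves_eq)

lemma Lf_in_subtrees [simp]: "Lf i \<in> subtrees t \<longleftrightarrow> i \<in> set (leaves t)"
  by (induction t) auto

section \<open>Quasi-single leaves\<close>

text \<open>The part of \<open>qs_leaves\<close> that does not depend on a mark; it is the quantity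
  that matches the horizontal steps of Motzkin paths.\<close>

definition single_leaves :: "btree \<Rightarrow> nat set" where
  "single_leaves t = {i. \<exists>a b. Nd a b \<in> subtrees t \<and>
     (a = Lf i \<and> is_node b \<or> b = Lf i \<and> is_node a)}"

lemma single_leaves_subset: "single_leaves t \<subseteq> set (leaves t)"
proof
  fix i assume "i \<in> single_leaves t"
  then have "Lf i \<in> subtrees t" unfolding single_leaves_def by (auto dest: subtrees_children)
  then show "i \<in> set (leaves t)" by simp
qed

lemma qs_leaves_subset: "qs_leaves (t, v) \<subseteq> set (leaves t)"
proof
  fix i assume "i \<in> qs_leaves (t, v)"
  then have "Lf i \<in> subtrees t" unfolding qs_leaves_def by (auto dest: subtrees_children)
  then show "i \<in> set (leaves t)" by simp
qed

lemma single_leaves_Nd: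
  "single_leaves (Nd a b) = single_leaves a \<union> single_leaves b \<union>
     {i. a = Lf i \<and> is_node b \<or> b = Lf i \<and> is_node a}"
  unfolding single_leaves_def by auto

lemma single_leaves_Lf [simp]: "single_leaves (Lf i) = {}"
  unfolding single_leaves_def by auto

lemma qs_leaves_unmarked:
  assumes "v \<notin> subtrees t" shows "qs_leaves (t, v) = single_leaves t"
  using assms unfolding qs_leaves_def single_leaves_def
  by (auto dest: subtrees_children)

text \<open>The root is nobody's child, so marking it neither makes a sibling quasi-single nor
  disqualifies a leaf that has a sibling.\<close>

lemma qs_leaves_root: "qs_leaves (t, t) = single_leaves t"
proof -
  have "Nd a t \<notin> subtrees t" "Nd t a \<notin> subtrees t" for a
    using subtrees_size[of "Nd a t" t] subtrees_size[of "Nd t a" t] by (cases t; force)+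
  moreover have "t \<noteq> Lf i" if "Nd a b \<in> subtrees t" for i a b using that by (cases t) auto
  ultimately show ?thesis unfolding qs_leaves_def single_leaves_def by auto
qed

lemma qs_leaves_Nd:
  assumes "distinct (leaves (Nd a b))" "v \<in> subtrees b"
  shows "qs_leaves (Nd a b, v) = single_leaves a \<union> qs_leaves (b, v) \<union> {i. a = Lf i}"
proof -
  have va: "v \<notin> subtrees a" using assms subtrees_disjoint[of b a v] by auto
  \<comment> \<open>The child with the mark is the mark or contains it properly, so a leaf
    \<open>a\<close> beside it is quasi-single either way.\<close>
  have sub: "v = b \<or> is_node b" using assms(2) by (cases b) auto
  have "qs_leaves (Nd a b, v) = qs_leaves (a, v) \<union> qs_leaves (b, v) \<union> {i. a = Lf i}"
    using va sub unfolding qs_leaves_def by auto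
  then show ?thesis using qs_leaves_unmarked[OF va] by simp
qed

text \<open>The condition is symmetric in the two children, so the swaps made by
  \<open>canon\<close> do not affect it; comparison with the mark survives because
  \<open>canon\<close> is injective on the vertices of \<open>t\<close>.\<close>

lemma qs_leaves_canon:
  assumes d: "distinct (leaves t)" and v: "v \<in> subtrees t"
  shows "qs_leaves (canon t, canon v) = qs_leaves (t, v)"
proof -
  have 1: "(\<exists>c d. Nd c d \<in> subtrees (canon t) \<and> (P c d \<or> P d c)) \<longleftrightarrow>
     (\<exists>a b. Nd a b \<in> subtrees t \<and> (P (canon a) (canon b) \<or> P (canon b) (canon a)))" for P
  proof
    assume "\<exists>c d. Nd c d \<in> subtrees (canon t) \<and> (P c d \<or> P d c)"
    then obtain c d where cd: "Nd c d \<in> canon ` subtrees t" "P c d \<or> P d c"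
      by (auto simp: subtrees_canon)
    then obtain x where x: "x \<in> subtrees t" "Nd c d = canon x" by auto
    then obtain a b where ab: "x = Nd a b" by (cases x) auto
    show "\<exists>a b. Nd a b \<in> subtrees t \<and> (P (canon a) (canon b) \<or> P (canon b) (canon a))"
      using x ab cd(2) by (intro exI[of _ a] exI[of _ b]) (auto simp: Let_def split: if_splits)
  next
    assume "\<exists>a b. Nd a b \<in> subtrees t \<and> (P (canon a) (canon b) \<or> P (canon b) (canon a))"
    then obtain a b where ab: "Nd a b \<in> subtrees t" "P (canon a) (canon b) \<or> P (canon b) (canon a)"
      by auto
    have "canon (Nd a b) \<in> subtrees (canon t)" using ab unfolding subtrees_canon by blast
    then show "\<exists>c d. Nd c d \<in> subtrees (canon t) \<and> (P c d \<or> P d c)"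
      using ab(2) by (auto simp: Let_def split: if_splits)
  qed
  have 2: "qs_leaves (t, v) = {i. Lf i \<noteq> v \<and> (\<exists>a b. Nd a b \<in> subtrees t \<and>
     ((\<lambda>a b. a = Lf i \<and> (b = v \<or> is_node b)) a b \<or> (\<lambda>a b. a = Lf i \<and> (b = v \<or> is_node b)) b a))}" for t v
    unfolding qs_leaves_def by simp
  have 3: "(canon a = canon v) = (a = v)" "(canon b = canon v) = (b = v)"
    if "Nd a b \<in> subtrees t" for a b
    using canon_inj_subtrees[OF d _ v] subtrees_children[OF that] by auto
  have 4: "(Nd a b \<in> subtrees t \<and>
       (canon a = Lf i \<and> (canon b = canon v \<or> is_node (canon b)) \<or>
        canon b = Lf i \<and> (canon a = canon v \<or> is_node (canon a)))) =
     (Nd a b \<in> subtrees t \<and>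
       (a = Lf i \<and> (b = v \<or> is_node b) \<or> b = Lf i \<and> (a = v \<or> is_node a)))" for a b i
    by (rule conj_cong) (simp_all add: 3)
  show ?thesis
    unfolding 2[of "canon t" "canon v"] 2[of t v] 1
    unfolding 4 by auto
qed

section \<open>Paths\<close>

abbreviation neg_rev :: "int list \<Rightarrow> int list" where
  "neg_rev p \<equiv> map uminus (rev p)"

text \<open>With \<open>length p = n - 1\<close>, the strict bound \<open>j < length p\<close> is
  the range \<open>j \<le> n - 2\<close>.\<close>

definition motzkin :: "int list \<Rightarrow> bool" where
  "motzkin p \<longleftrightarrow> set p \<subseteq> {-1,0,1} \<and> (\<forall>j<length p. sum_list (take j p) \<ge> 0) \<and> sum_list p = -1"

definition positive :: "int list \<Rightarrow> bool" where
  "positive p \<longleftrightarrow> set p \<subseteq> {-1,0,1} \<and> positive_path p"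

text \<open>The inequalities of \<open>well_labelled\<close> in recursive form, suited to gluing;
  the last equation makes every mismatch of lengths fail.\<close>

fun labels_ok :: "int list \<Rightarrow> nat list \<Rightarrow> bool" where
  "labels_ok [] [a] = True"
| "labels_ok (e # p) (a # b # s) = ((e = -1 \<longrightarrow> a < b) \<and> (e = 1 \<longrightarrow> a > b) \<and> labels_ok p (b # s))"
| "labels_ok _ _ = False"

section \<open>Label inequalities of glued and reversed paths\<close>

lemma labels_ok_length: "labels_ok p s \<Longrightarrow> length s = Suc (length p)"
  by (induction p s rule: labels_ok.induct) auto

lemma labels_ok_iff:
  "labels_ok p s \<longleftrightarrow> length s = Suc (length p) \<and>
    (\<forall>i<length p. (p ! i = -1 \<longrightarrow> s ! i < s ! (i+1)) \<and> (p ! i = 1 \<longrightarrow> s ! i > s ! (i+1)))"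
proof (induction p s rule: labels_ok.induct)
  case (2 e p a b s)
  then show ?case by (auto simp: All_less_Suc2)
next
  case ("3_2" p) then show ?case by auto
next
  case "3_3" then show ?case by auto
qed auto

lemma well_labelled_iff:
  "n \<ge> 1 \<Longrightarrow> well_labelled n p \<sigma> \<longleftrightarrow>
    labels_ok p \<sigma> \<and> distinct \<sigma> \<and> set \<sigma> = {1..n} \<and> set p \<subseteq> {-1,0,1}"
  unfolding well_labelled_def labels_ok_iff
  using distinct_card[of \<sigma>] by auto

lemma labels_ok_append:
  "length s1 = Suc (length p1) \<Longrightarrow> s2 \<noteq> [] \<Longrightarrow>
   labels_ok (p1 @ e # p2) (s1 @ s2) \<longleftrightarrow>
     labels_ok p1 s1 \<and> labels_ok p2 s2 \<and> (e = -1 \<longrightarrow> last s1 < hd s2) \<and> (e = 1 \<longrightarrow> last s1 > hd s2)"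
proof (induction p1 s1 rule: labels_ok.induct)
  case (1 a)
  then show ?case by (cases s2) auto
qed auto

text \<open>Reversal exchanges the two ends of each step and negation exchanges rise and fall, so
  every inequality is kept.\<close>

lemma labels_ok_neg_rev: "labels_ok (neg_rev p) (rev s) \<longleftrightarrow> labels_ok p s"
proof (induction p s rule: labels_ok.induct)
  case (2 e p a b s)
  show ?case
  proof (cases "length s = length p")
    case True
    then show ?thesis
      using labels_ok_append[of "rev (b # s)" "neg_rev p" "[a]" "-e" "[]"] 2
      by (auto simp: minus_equation_iff[of e] eq_commute[of "-1" e])
  next
    case False
    then show ?thesis by (auto dest!: labels_ok_length)
  qed
qed (auto dest!: labels_ok_length)

section \<open>Heights of reversed paths\<close>

lemma take_neg_rev_sum:
  "j \<le> length p \<Longrightarrow> sum_list (take j (neg_rev p)) = sum_list (take (length p - j) p) - sum_list p"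
proof -
  assume "j \<le> length p"
  have s: "sum_list (map uminus q) = - sum_list q" for q :: "int list" by (induction q) auto
  have "sum_list p = sum_list (take (length p - j) p) + sum_list (drop (length p - j) p)"
    by (metis append_take_drop_id sum_list_append)
  then show ?thesis using s by (simp add: take_map take_rev)
qed

lemma sum_neg_rev: "sum_list (neg_rev p) = - sum_list p"
  using take_neg_rev_sum[of "length p" p] by simp

lemma neg_rev_neg_rev [simp]: "neg_rev (neg_rev p) = p"
  by (simp add: rev_map comp_def)

lemma set_neg_rev: "set (neg_rev p) \<subseteq> {-1,0,1} \<longleftrightarrow> set p \<subseteq> {-1,0,1}"
proof -
  have "- x \<in> {-1,0,1} \<longleftrightarrow> x \<in> {-1,0,1}" for x :: int by auto
  then show ?thesis unfolding set_map set_rev by blast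
qed

text \<open>When \<open>q\<close> has total 1, a prefix of \<open>neg_rev q\<close> has height
  \<open>h - 1\<close>, where \<open>h\<close> is the height of \<open>q\<close> at the
  complementary index; so the bound 0 on one side is the bound 1 on the other.\<close>

lemma motzkin_neg_rev:
  "motzkin (neg_rev q) \<longleftrightarrow> set q \<subseteq> {-1,0,1} \<and> (\<forall>j\<in>{1..length q}. sum_list (take j q) \<ge> 1) \<and> sum_list q = 1"
proof -
  have "(\<forall>j<length q. sum_list (take j (neg_rev q)) \<ge> 0) \<longleftrightarrow> (\<forall>j\<in>{1..length q}. sum_list (take j q) \<ge> 1)"
    if "sum_list q = 1"
  proof
    assume a: "\<forall>j<length q. sum_list (take j (neg_rev q)) \<ge> 0"
    show "\<forall>j\<in>{1..length q}. sum_list (take j q) \<ge> 1"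
    proof
      fix j assume j: "j \<in> {1..length q}"
      then have "0 \<le> sum_list (take (length q - j) (neg_rev q))" using a by auto
      then show "1 \<le> sum_list (take j q)" using take_neg_rev_sum[of "length q - j" q] j that by auto
    qed
  next
    assume a: "\<forall>j\<in>{1..length q}. sum_list (take j q) \<ge> 1"
    show "\<forall>j<length q. sum_list (take j (neg_rev q)) \<ge> 0"
    proof (intro allI impI)
      fix j assume "j < length q"
      then show "sum_list (take j (neg_rev q)) \<ge> 0"
        using a[rule_format, of "length q - j"] take_neg_rev_sum[of j q] that
        by (auto simp: Suc_le_eq)
    qed
  qed
  then show ?thesis unfolding motzkin_def set_neg_rev sum_neg_rev by (auto simp: neg_equal_iff_equal)
qed

lemma motzkin_neg_revD:
  assumes "motzkin p"
  shows "set (neg_rev p) \<subseteq> {-1,0,1}" "sum_list (neg_rev p) = 1" "p \<noteq> []"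
    "\<And>j. 1 \<le> j \<Longrightarrow> j \<le> length p \<Longrightarrow> sum_list (take j (neg_rev p)) \<ge> 1"
proof -
  have "motzkin (neg_rev (neg_rev p))" using assms by simp
  note * = this[unfolded motzkin_neg_rev]
  show "set (neg_rev p) \<subseteq> {-1,0,1}" "sum_list (neg_rev p) = 1" using * by blast+
  show "p \<noteq> []" using assms by (auto simp: motzkin_def)
  fix j assume "1 \<le> j" "j \<le> length p"
  then show "sum_list (take j (neg_rev p)) \<ge> 1" using * by auto
qed

section \<open>Decomposition of paths at first passages\<close>

lemma sum_take_Suc: "j < length p \<Longrightarrow> sum_list (take (Suc j) p) = sum_list (take j p) + (p ! j :: int)"
  by (simp add: take_Suc_conv_app_nth)

lemma sum_take_drop: "sum_list (take j (drop k p)) = sum_list (take (k + j) p) - (sum_list (take k p) :: int)"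
  by (simp add: take_add)

text \<open>Steps go down by at most 1, so a path cannot jump over a level: the first index from
  \<open>a\<close> on with height at most \<open>c\<close> has height exactly \<open>c\<close> and
  is reached by a step \<open>-1\<close>.\<close>

lemma first_passage:
  fixes p :: "int list"
  assumes "set p \<subseteq> {-1,0,1}" "a \<le> m" "m \<le> length p"
    "sum_list (take m p) \<le> c" "c < sum_list (take a p)"
  obtains j where "a \<le> j" "j < m" "sum_list (take (Suc j) p) = c" "sum_list (take j p) = c + 1"
    "p ! j = -1" "\<And>i. a \<le> i \<Longrightarrow> i \<le> j \<Longrightarrow> c < sum_list (take i p)"
proof -
  define l where "l = (LEAST l. a \<le> l \<and> sum_list (take l p) \<le> c)"
  have l: "a \<le> l" "sum_list (take l p) \<le> c" and lm: "l \<le> m"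
    using LeastI[of "\<lambda>l. a \<le> l \<and> sum_list (take l p) \<le> c" m]
      Least_le[of "\<lambda>l. a \<le> l \<and> sum_list (take l p) \<le> c" m] assms by (auto simp: l_def)
  have less: "c < sum_list (take i p)" if "a \<le> i" "i < l" for i
    using not_less_Least[of i "\<lambda>l. a \<le> l \<and> sum_list (take l p) \<le> c"] that by (auto simp: l_def)
  have "l \<noteq> a" using l assms by auto
  then obtain j where j: "l = Suc j" "a \<le> j" using l by (cases l) auto
  have jl: "j < length p" using j lm assms by auto
  have "p ! j \<ge> -1" using assms(1) nth_mem[OF jl] by auto
  moreover have "c < sum_list (take j p)" using less[of j] j by auto
  moreover have "sum_list (take j p) + p ! j \<le> c" using l j sum_take_Suc[OF jl] by simp
  ultimately have "p ! j = -1" "sum_list (take j p) = c + 1" by auto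
  then show thesis using that[of j] j lm less sum_take_Suc[OF jl] by auto
qed

lemma motzkin_cases:
  assumes "motzkin p"
  obtains "p = [-1]" | p' where "p = 0 # p'" "motzkin p'"
  | p1 p2 where "p = neg_rev p1 @ -1 # p2" "motzkin p1" "motzkin p2"
proof -
  have p: "set p \<subseteq> {-1,0,1}" "\<And>j. j < length p \<Longrightarrow> sum_list (take j p) \<ge> 0" "sum_list p = -1"
    using assms by (auto simp: motzkin_def)
  then obtain x p' where xp: "p = x # p'" by (cases p) auto
  then consider "x = -1" | "x = 0" | "x = 1" using p by auto
  then show thesis
  proof cases
    case 1
    have "p' = []" using p(2)[of 1] 1 xp by (cases p') auto
    then show ?thesis using that 1 xp by simp
  next
    case 2
    have "motzkin p'"
      unfolding motzkin_def
    proof (intro conjI allI impI)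
      fix j assume "j < length p'"
      then show "0 \<le> sum_list (take j p')" using p(2)[of "Suc j"] 2 xp by auto
    qed (use p xp 2 in auto)
    then show ?thesis using that 2 xp by simp
  next
    case 3
    \<comment> \<open>First return to 0. The step that makes it starts at height 1, so the stretch
      before it is a reversed Motzkin path.\<close>
    obtain j where j: "1 \<le> j" "j < length p" "sum_list (take (Suc j) p) = 0" "sum_list (take j p) = 0 + 1"
      "p ! j = -1" "\<And>i. 1 \<le> i \<Longrightarrow> i \<le> j \<Longrightarrow> 0 < sum_list (take i p)"
      using first_passage[of p 1 "length p" 0] p 3 xp by (auto simp: Suc_le_eq)
    have eq: "p = neg_rev (neg_rev (take j p)) @ -1 # drop (Suc j) p"
      using j(2,5) by (simp only: neg_rev_neg_rev) (metis id_take_nth_drop)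
    have "motzkin (neg_rev (take j p))"
      unfolding motzkin_neg_rev using j p(1) by (force dest: in_set_takeD)
    moreover have "motzkin (drop (Suc j) p)"
      unfolding motzkin_def
    proof (intro conjI allI impI)
      fix i assume "i < length (drop (Suc j) p)"
      then show "0 \<le> sum_list (take i (drop (Suc j) p))"
        unfolding sum_take_drop using p(2)[of "Suc j + i"] j(3) by auto
    next
      show "sum_list (drop (Suc j) p) = -1"
        using p(3) j(3) by (metis add_0 append_take_drop_id sum_list_append)
    qed (use p(1) in \<open>auto dest: in_set_dropD\<close>)
    ultimately show ?thesis using that(3) eq by blast
  qed
qed

text \<open>After an initial step 1, the cut is at the last visit to height 1 during the initial
  stretch that stays at height at least 1. The step after it cannot be 0, which would be a later
  visit.\<close>

lemma positive_cases:
  assumes "positive p"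
  obtains "p = []" | p' where "p = 0 # p'" "positive p'"
  | p1 where "p = neg_rev p1" "motzkin p1"
  | p1 e p2 where "p = neg_rev p1 @ e # p2" "motzkin p1" "positive p2" "e = -1 \<or> e = 1"
proof -
  have p: "set p \<subseteq> {-1,0,1}" "\<And>j. j \<le> length p \<Longrightarrow> sum_list (take j p) \<ge> 0"
    using assms by (auto simp: positive_def positive_path_def)
  consider "p = []" | x p' where "p = x # p'" by (cases p) auto
  then show thesis
  proof cases
    case (2 x p')
    have x: "x = 0 \<or> x = 1" using p(1) p(2)[of 1] 2 by auto
    \<comment> \<open>A suffix is positive once its starting height is minimal among the remaining
      heights.\<close>
    have drop: "positive (drop k p)" if "\<And>j. k \<le> j \<Longrightarrow> j \<le> length p \<Longrightarrow> sum_list (take k p) \<le> sum_list (take j p)" "k \<le> length p" for k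
      unfolding positive_def positive_path_def sum_take_drop using p(1) that by (auto dest: in_set_dropD)
    show ?thesis
    proof (cases "x = 0")
      case True
      then show ?thesis using drop[of 1] p(2) 2 that(2)[of p'] by auto
    next
      case False
      then have x1: "x = 1" using x by simp
      \<comment> \<open>\<open>k\<close> counts steps here, whereas the \<open>k\<close> in
        \<open>phim_aux\<close> counts labels and is larger by one.\<close>
      define P where "P k \<longleftrightarrow> k \<le> length p \<and> (\<forall>j\<in>{1..k}. sum_list (take j p) \<ge> 1) \<and> sum_list (take k p) = 1" for k
      define k where "k = Greatest P"
      have "P 1" unfolding P_def using 2 x1 by auto
      moreover have bd: "\<forall>k'. P k' \<longrightarrow> k' \<le> length p" by (simp add: P_def)
      ultimately have Pk: "P k" and max: "\<And>k'. P k' \<Longrightarrow> k' \<le> k"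
        unfolding k_def using GreatestI_nat[of P 1 "length p"] Greatest_le_nat[of P _ "length p"] bd
        by blast+
      have k1: "1 \<le> k" using max[OF \<open>P 1\<close>] .
      have mz: "motzkin (neg_rev (take k p))"
        unfolding motzkin_neg_rev using Pk p(1) by (force simp: P_def dest: in_set_takeD)
      show ?thesis
      proof (cases "k = length p")
        case True
        then show ?thesis using that(3)[of "neg_rev p"] mz by simp
      next
        case False
        then have kl: "k < length p" using Pk by (simp add: P_def)
        define e where "e = p ! k"
        have S: "sum_list (take (Suc k) p) = 1 + e" using sum_take_Suc[OF kl] Pk by (simp add: e_def P_def)
        have eq: "p = neg_rev (neg_rev (take k p)) @ e # drop (Suc k) p"
          using kl unfolding neg_rev_neg_rev e_def by (metis id_take_nth_drop)
        have ein: "e \<in> {-1,0,1}" using p(1) nth_mem[OF kl] by (auto simp: e_def)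
        have "e \<noteq> 0"
        proof
          assume "e = 0"
          then have "P (Suc k)" using Pk S kl unfolding P_def by (auto simp: atLeastAtMostSuc_conv)
          then show False using max by fastforce
        qed
        then have e: "e = -1 \<or> e = 1" using ein by auto
        have "positive (drop (Suc k) p)"
        proof (rule drop)
          fix m assume m: "Suc k \<le> m" "m \<le> length p"
          show "sum_list (take (Suc k) p) \<le> sum_list (take m p)"
          proof (cases "e = -1")
            case True
            then show ?thesis using S p(2)[OF m(2)] by simp
          next
            case False
            show ?thesis
            proof (rule ccontr)
              \<comment> \<open>After \<open>e = 1\<close> the path is at height 2; falling below
                that would bring it back to height 1 without having left the stretch, against the
                maximality of \<open>k\<close>.\<close>
              assume "\<not> ?thesis"
              then have "sum_list (take m p) \<le> 1" "1 < sum_list (take (Suc k) p)" using S e False by auto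
              then obtain j where j: "Suc k \<le> j" "j < m" "sum_list (take (Suc j) p) = 1"
                "\<And>i. Suc k \<le> i \<Longrightarrow> i \<le> j \<Longrightarrow> 1 < sum_list (take i p)"
                using first_passage[of p "Suc k" m 1] p(1) m by metis
              have "P (Suc j)" unfolding P_def
              proof (intro conjI ballI)
                fix i assume i: "i \<in> {1..Suc j}"
                show "1 \<le> sum_list (take i p)"
                  using Pk j(3) j(4)[of i] i unfolding P_def
                  by (cases "i \<le> k"; cases "i = Suc j") auto
              qed (use j m in auto)
              then show False using max[of "Suc j"] j by auto
            qed
          qed
        qed (use kl in auto)
        then show ?thesis using that(4)[OF eq mz _ e] by blast
      qed
    qed
  qed (use that in auto)
qed

section \<open>Motzkin paths and trees\<close>

text \<open>The graph of \<open>\<Phi>\<close> on paths with arbitrary distinct labels: since the comparisons are invariant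
  under order-preserving relabelling, the renormalisations by \<open>\<lambda>\<^sub>I\<close> disappear.\<close>

inductive motzkin_tree :: "int list \<Rightarrow> nat list \<Rightarrow> btree \<Rightarrow> bool" where
  base: "a < b \<Longrightarrow> motzkin_tree [-1] [a, b] (Nd (Lf a) (Lf b))"
| flat: "motzkin_tree p s t \<Longrightarrow> a \<notin> set s \<Longrightarrow> motzkin_tree (0 # p) (a # s) (Nd (Lf a) t)"
| split: "motzkin_tree p1 s1 t1 \<Longrightarrow> motzkin_tree p2 s2 t2 \<Longrightarrow> set s1 \<inter> set s2 = {} \<Longrightarrow>
    hd s1 < hd s2 \<Longrightarrow> motzkin_tree (neg_rev p1 @ -1 # p2) (rev s1 @ s2) (Nd t1 t2)"

text \<open>The first piece ends at height 1 and the joining step adds \<open>e\<close>, so the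
  second piece starts at height \<open>1 + e\<close>.\<close>

lemma sum_take_split:
  assumes "motzkin p1"
  shows "sum_list (take j (neg_rev p1 @ e # p2)) =
    (if j \<le> length p1 then sum_list (take j (neg_rev p1))
     else 1 + e + sum_list (take (j - Suc (length p1)) p2))"
proof (cases "j \<le> length p1")
  case False
  then have "j - length p1 = Suc (j - Suc (length p1))" by simp
  then show ?thesis using False motzkin_neg_revD(2)[OF assms] by simp
qed simp

lemma sum_take_neg_rev_nonneg:
  "motzkin p \<Longrightarrow> j \<le> length p \<Longrightarrow> sum_list (take j (neg_rev p)) \<ge> 0"
  using motzkin_neg_revD(4)[of p j] by (cases "j = 0") auto

lemma motzkin_split:
  assumes "motzkin p1" "motzkin p2"
  shows "motzkin (neg_rev p1 @ -1 # p2)"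
  unfolding motzkin_def
proof (intro conjI allI impI)
  show "set (neg_rev p1 @ -1 # p2) \<subseteq> {-1,0,1}"
    using motzkin_neg_revD(1)[OF assms(1)] assms(2) by (auto simp: motzkin_def)
  show "sum_list (neg_rev p1 @ -1 # p2) = -1"
    using motzkin_neg_revD(2)[OF assms(1)] assms(2) by (simp add: motzkin_def)
  fix j assume "j < length (neg_rev p1 @ -1 # p2)"
  then show "0 \<le> sum_list (take j (neg_rev p1 @ -1 # p2))"
    unfolding sum_take_split[OF assms(1)]
    using sum_take_neg_rev_nonneg[OF assms(1)] assms(2) by (auto simp: motzkin_def)
qed

lemma positive_split:
  assumes "motzkin p1" "positive p2" "e = -1 \<or> e = 1"
  shows "positive (neg_rev p1 @ e # p2)"
  unfolding positive_def positive_path_def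
proof (intro conjI allI impI)
  show "set (neg_rev p1 @ e # p2) \<subseteq> {-1,0,1}"
    using motzkin_neg_revD(1)[OF assms(1)] assms(2,3) by (auto simp: positive_def)
  fix j assume "j \<le> length (neg_rev p1 @ e # p2)"
  then show "0 \<le> sum_list (take j (neg_rev p1 @ e # p2))"
    unfolding sum_take_split[OF assms(1)]
    using sum_take_neg_rev_nonneg[OF assms(1)] assms(2,3)
    by (fastforce simp: positive_def positive_path_def)
qed

lemma positive_neg_rev: "motzkin p \<Longrightarrow> positive (neg_rev p)"
  unfolding positive_def positive_path_def
  using motzkin_neg_revD(1) sum_take_neg_rev_nonneg by simp

lemma motzkin_Cons_0: "motzkin p \<Longrightarrow> motzkin (0 # p)"
  unfolding motzkin_def by (auto simp: take_Cons split: nat.splits)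

lemma positive_Cons_0: "positive p \<Longrightarrow> positive (0 # p)"
  unfolding positive_def positive_path_def by (auto simp: take_Cons split: nat.splits)

lemma hsteps_simps [simp]:
  "hsteps [] = 0" "hsteps (x # p) = (if x = 0 then 1 else 0) + hsteps p"
  "hsteps (p @ q) = hsteps p + hsteps q"
  by (auto simp: hsteps_def)

lemma hsteps_neg_rev [simp]: "hsteps (neg_rev p) = hsteps p"
  by (simp add: hsteps_def filter_map rev_filter[symmetric] comp_def)

lemma card_single_leaves_disjoint:
  assumes "distinct (leaves (Nd a b))"
  shows "card (single_leaves a \<union> single_leaves b) = card (single_leaves a) + card (single_leaves b)"
  using assms single_leaves_subset[of a] single_leaves_subset[of b]
  by (intro card_Un_disjoint) (auto intro: finite_subset)

text \<open>Only \<open>flat\<close> creates a single leaf, and it adds one horizontal step: in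
  \<open>split\<close> both children are internal, in \<open>base\<close> both are leaves.\<close>

lemma motzkin_tree_path:
  assumes "motzkin_tree p s t"
  shows "motzkin p \<and> labels_ok p s \<and> distinct s \<and> set s = set (leaves t) \<and>
    distinct (leaves t) \<and> is_node t \<and> hsteps p = card (single_leaves t) \<and> s \<noteq> [] \<and> length s \<ge> 2"
  using assms
proof (induction rule: motzkin_tree.induct)
  case (base a b)
  then show ?case by (simp add: motzkin_def single_leaves_Nd)
next
  case (flat p s t a)
  have "labels_ok (0 # p) (a # s)" using flat by (cases s) auto
  moreover have "single_leaves (Nd (Lf a) t) = insert a (single_leaves t)"
    using flat by (auto simp: single_leaves_Nd)
  moreover have "a \<notin> single_leaves t" "finite (single_leaves t)"
    using flat single_leaves_subset[of t] by (auto intro: finite_subset)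
  ultimately show ?case using flat motzkin_Cons_0 by auto
next
  case (split p1 s1 t1 p2 s2 t2)
  \<comment> \<open>\<open>last (rev s1)\<close> is \<open>hd s1\<close>, so the side condition of
    \<open>split\<close> is exactly what the joining step \<open>-1\<close> demands.\<close>
  have "labels_ok (neg_rev p1 @ -1 # p2) (rev s1 @ s2)"
    using split labels_ok_length[of p1 s1]
    by (subst labels_ok_append) (auto simp: labels_ok_neg_rev last_rev)
  moreover have "single_leaves (Nd t1 t2) = single_leaves t1 \<union> single_leaves t2"
    using split by (auto simp: single_leaves_Nd)
  moreover have "distinct (leaves (Nd t1 t2))" using split by auto
  ultimately show ?case
    using split motzkin_split card_single_leaves_disjoint[of t1 t2] by auto
qed

lemma motzkin_tree_exists:
  "motzkin p \<Longrightarrow> labels_ok p s \<Longrightarrow> distinct s \<Longrightarrow> \<exists>t. motzkin_tree p s t"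
proof (induction "length p" arbitrary: p s rule: less_induct)
  case less
  note len = labels_ok_length[OF less.prems(2)]
  show ?case
  proof (rule motzkin_cases[OF less.prems(1)])
    assume "p = [-1]"
    moreover from this obtain a b where "s = [a, b]" using len by (auto simp: length_Suc_conv)
    ultimately show ?thesis using less.prems(2) motzkin_tree.base by auto
  next
    fix p' assume p: "p = 0 # p'" "motzkin p'"
    obtain a b s' where s: "s = a # b # s'" using len p by (auto simp: length_Suc_conv)
    then obtain t where "motzkin_tree p' (b # s') t" using less.hyps[of p' "b # s'"] less.prems p by auto
    moreover have "a \<notin> set (b # s')" using less.prems(3) s by auto
    ultimately show ?thesis unfolding p(1) s using motzkin_tree.flat by blast
  next
    fix p1 p2 assume p: "p = neg_rev p1 @ -1 # p2" "motzkin p1" "motzkin p2"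
    define s1 s2 where "s1 = rev (take (Suc (length p1)) s)" and "s2 = drop (Suc (length p1)) s"
    have s: "s = rev s1 @ s2" by (simp add: s1_def s2_def)
    have len12: "length s1 = Suc (length p1)" "length s2 = Suc (length p2)"
      using len p by (auto simp: s1_def s2_def)
    have ok: "labels_ok (neg_rev p1) (rev s1)" "labels_ok p2 s2" "hd s1 < hd s2"
      using less.prems(2) len12 labels_ok_append[of "rev s1" "neg_rev p1" s2 "-1" p2]
      unfolding p s by (cases s2; auto simp: last_rev)+
    then obtain t1 t2 where "motzkin_tree p1 s1 t1" "motzkin_tree p2 s2 t2"
      using less.hyps[of p1 s1] less.hyps[of p2 s2] p less.prems(3) s by (auto simp: labels_ok_neg_rev)
    moreover have "set s1 \<inter> set s2 = {}" using less.prems(3) s by auto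
    ultimately show ?thesis unfolding p(1) s using motzkin_tree.split ok(3) by blast
  qed
qed

text \<open>The order of the two pieces in a splitting step is forced by comparing the first labels of
  their paths, so every unordered tree is reached exactly once.\<close>

lemma motzkin_tree_reach:
  "is_node t \<Longrightarrow> distinct (leaves t) \<Longrightarrow> \<exists>p s t'. motzkin_tree p s t' \<and> canon t' = canon t"
proof (induction t)
  case (Nd a b)
  have disj: "set (leaves a) \<inter> set (leaves b) = {}" and da: "distinct (leaves a)" and db: "distinct (leaves b)"
    using Nd.prems by auto
  have leaf_node: "\<exists>p s t'. motzkin_tree p s t' \<and> canon t' = canon (Nd (Lf i) c)"
    if "motzkin_tree p s c'" "canon c' = canon c" "i \<notin> set (leaves c)" for p s i c c'
  proof -
    have "set s = set (leaves c)" using motzkin_tree_path[OF that(1)] that(2) by (metis set_leaves_canon)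
    then have "motzkin_tree (0 # p) (i # s) (Nd (Lf i) c')" using motzkin_tree.flat that by simp
    then show ?thesis using canon_Nd_cong[of "Lf i" "Lf i"] that(2) by blast
  qed
  have node_node: "\<exists>p s t'. motzkin_tree p s t' \<and> canon t' = canon (Nd c d)"
    if "motzkin_tree p1 s1 c'" "canon c' = canon c" "motzkin_tree p2 s2 d'" "canon d' = canon d"
      "set (leaves c) \<inter> set (leaves d) = {}" "hd s1 < hd s2" for p1 s1 c' c p2 s2 d' d
  proof -
    have "set s1 = set (leaves c)" "set s2 = set (leaves d)"
      using motzkin_tree_path[OF that(1)] motzkin_tree_path[OF that(3)] that(2,4)
      by (metis set_leaves_canon)+
    then show ?thesis using motzkin_tree.split[OF that(1,3)] canon_Nd_cong[OF that(2,4)] that(5,6) by blast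
  qed
  have swap: "canon (Nd a b) = canon (Nd b a)" using canon_Nd_swap[OF disj] .
  show ?case
  proof (cases "is_node a"; cases "is_node b")
    assume "is_node a" "is_node b"
    then obtain p1 s1 a' p2 s2 b' where *: "motzkin_tree p1 s1 a'" "canon a' = canon a"
      "motzkin_tree p2 s2 b'" "canon b' = canon b"
      using Nd.IH da db by blast
    have "set s1 = set (leaves a)" "set s2 = set (leaves b)" "s1 \<noteq> []" "s2 \<noteq> []"
      using motzkin_tree_path[OF *(1)] motzkin_tree_path[OF *(3)] *(2,4)
      by (metis set_leaves_canon)+
    then have "hd s1 \<noteq> hd s2" using disj by (metis IntI empty_iff list.set_sel(1))
    then consider "hd s1 < hd s2" | "hd s2 < hd s1" by linarith
    then show ?thesis
    proof cases
      case 1 then show ?thesis using node_node * disj by blast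
    next
      case 2
      have "set (leaves b) \<inter> set (leaves a) = {}" using disj by blast
      then show ?thesis unfolding swap using node_node[OF *(3,4,1,2)] 2 by blast
    qed
  next
    assume "is_node a" "\<not> is_node b"
    then obtain i where "b = Lf i" by (cases b) auto
    then show ?thesis unfolding swap using leaf_node Nd.IH(1) \<open>is_node a\<close> da disj by fastforce
  next
    assume "\<not> is_node a" "is_node b"
    then obtain i where "a = Lf i" by (cases a) auto
    then show ?thesis using leaf_node Nd.IH(2) \<open>is_node b\<close> db disj by fastforce
  next
    assume "\<not> is_node a" "\<not> is_node b"
    then obtain i j where ij: "a = Lf i" "b = Lf j" by (cases a; cases b) auto
    then consider "i < j" | "j < i" using disj by fastforce
    then show ?thesis
    proof cases
      case 1 then show ?thesis using motzkin_tree.base ij by blast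
    next
      case 2 then show ?thesis unfolding swap using motzkin_tree.base ij by blast
    qed
  qed
qed simp

lemma motzkin_tree_is_node: "motzkin_tree p s t \<Longrightarrow> is_node t"
  using motzkin_tree_path by blast

lemma motzkin_tree_not_Lf [simp]: "\<not> motzkin_tree p s (Lf i)"
  using motzkin_tree_is_node by force

text \<open>Which children are leaves tells which rule was used, and the canonical form determines
  the children up to order; only \<open>split\<close> leaves the order to be decided.\<close>

lemma motzkin_tree_unique:
  "motzkin_tree p s t \<Longrightarrow> motzkin_tree p' s' t' \<Longrightarrow> canon t = canon t' \<Longrightarrow> p = p' \<and> s = s'"
proof (induction arbitrary: p' s' t' rule: motzkin_tree.induct)
  case (base a b)
  note ab = base
  show ?case using ab(2)
  proof (cases rule: motzkin_tree.cases)
    case (base c d)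
    then show ?thesis using canon_Nd_eqD[OF ab(3)[unfolded base(3)]] ab(1) by auto
  next
    case (flat p s t c)
    then show ?thesis using canon_Nd_eqD[OF ab(3)[unfolded flat(3)]] by auto
  next
    case (split p1 s1 t1 p2 s2 t2)
    then show ?thesis using canon_Nd_eqD[OF ab(3)[unfolded split(3)]] by auto
  qed
next
  case (flat p s t a)
  show ?case using flat.prems(1)
  proof (cases rule: motzkin_tree.cases)
    case (base c d)
    then show ?thesis using flat.hyps(1) canon_Nd_eqD[OF flat.prems(2)[unfolded base(3)]] by auto
  next
    case f: (flat p2 s2 t2 c)
    have "canon t = canon t2" "a = c"
      using flat.hyps(1) f(4) canon_Nd_eqD[OF flat.prems(2)[unfolded f(3)]] by auto
    then show ?thesis using flat.IH[OF f(4)] f by simp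
  next
    case (split p1 s1 t1 p2 s2 t2)
    then show ?thesis using canon_Nd_eqD[OF flat.prems(2)[unfolded split(3)]] by auto
  qed
next
  case (split p1 s1 t1 p2 s2 t2)
  show ?case using split.prems(1)
  proof (cases rule: motzkin_tree.cases)
    case (base c d)
    then show ?thesis using split.hyps(1,2) canon_Nd_eqD[OF split.prems(2)[unfolded base(3)]] by auto
  next
    case (flat p s t c)
    then show ?thesis using split.hyps(1,2) canon_Nd_eqD[OF split.prems(2)[unfolded flat(3)]] by auto
  next
    case s: (split q1 r1 u1 q2 r2 u2)
    from canon_Nd_eqD[OF split.prems(2)[unfolded s(3)]] show ?thesis
    proof (elim disjE conjE)
      assume "canon t1 = canon u1" "canon t2 = canon u2"
      then show ?thesis using split.IH(1)[OF s(4)] split.IH(2)[OF s(5)] s(1,2) by simp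
    next
      \<comment> \<open>The crossed pairing would give both \<open>hd s1 < hd s2\<close> and the
        reverse inequality.\<close>
      assume "canon t1 = canon u2" "canon t2 = canon u1"
      then show ?thesis using split.IH(1)[OF s(5)] split.IH(2)[OF s(4)] s(7) split.hyps(4) by simp
    qed
  qed
qed

section \<open>Computing \<open>Phi\<close>\<close>

text \<open>In a strictly increasing list the entries smaller than \<open>x\<close> are exactly
  those before it, so their number is the zero-based position of \<open>x\<close>. This makes
  \<open>lam\<close> undo \<open>lam_inv\<close>.\<close>

lemma sorted_list_of_set_nth_card:
  assumes "finite (I :: nat set)" "x \<in> I"
  shows "sorted_list_of_set I ! card {y\<in>I. y < x} = x"
proof -
  define xs where "xs = sorted_list_of_set I"
  have xs: "set xs = I" "sorted_wrt (<) xs" "distinct xs" using assms by (auto simp: xs_def)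
  then obtain i where i: "i < length xs" "xs ! i = x" using assms(2) by (metis in_set_conv_nth)
  have "{y\<in>I. y < x} = (!) xs ` {..<i}"
  proof (intro equalityI subsetI)
    fix y assume "y \<in> {y\<in>I. y < x}"
    then obtain j where j: "j < length xs" "xs ! j = y" "xs ! j < xs ! i"
      using xs i by (auto simp: in_set_conv_nth)
    then have "j < i" using sorted_wrt_nth_less[OF xs(2), of i j] i by (metis linorder_neqE_nat order_less_asym)
    then show "y \<in> (!) xs ` {..<i}" using j by auto
  next
    fix y assume "y \<in> (!) xs ` {..<i}"
    then obtain j where j: "j < i" "y = xs ! j" by auto
    then show "y \<in> {y\<in>I. y < x}"
      using i xs(1) sorted_wrt_nth_less[OF xs(2), of j i] nth_mem[of j xs] by auto
  qed
  moreover have "inj_on ((!) xs) {..<i}" using xs(3) i by (auto simp: inj_on_def nth_eq_iff_index_eq)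
  ultimately have "card {y\<in>I. y < x} = i" by (simp add: card_image)
  then show ?thesis using i xs_def by simp
qed

lemma lam_lam_inv: "finite I \<Longrightarrow> x \<in> I \<Longrightarrow> lam I (lam_inv I x) = x"
  by (simp add: lam_def lam_inv_def sorted_list_of_set_nth_card)

lemma lam_inv_strict_mono: "finite I \<Longrightarrow> strict_mono_on I (lam_inv I)"
  unfolding lam_inv_def
  by (rule strict_mono_onI) (auto intro!: psubset_card_mono)

lemma lam_inv_image:
  assumes "finite I" shows "lam_inv I ` I = {1..card I}"
proof (rule card_subset_eq)
  show "lam_inv I ` I \<subseteq> {1..card I}"
  proof (clarsimp simp: lam_inv_def)
    fix x assume "x \<in> I"
    then have "{y\<in>I. y < x} \<subset> I" by auto
    then show "Suc (card {y\<in>I. y < x}) \<le> card I" using assms by (simp add: psubset_card_mono Suc_leI)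
  qed
  show "card (lam_inv I ` I) = card {1..card I}"
    using strict_mono_on_imp_inj_on[OF lam_inv_strict_mono[OF assms]] by (simp add: card_image)
qed simp

lemma relabel_lam_lam_inv:
  "finite I \<Longrightarrow> set (leaves t) \<subseteq> I \<Longrightarrow> relabel (lam I) (relabel (lam_inv I) t) = t"
  by (induction t) (auto simp: lam_lam_inv)

lemma hd_map_less:
  fixes g :: "nat \<Rightarrow> nat"
  shows "strict_mono_on A g \<Longrightarrow> set s \<subseteq> A \<Longrightarrow> set s' \<subseteq> A \<Longrightarrow> s \<noteq> [] \<Longrightarrow> s' \<noteq> [] \<Longrightarrow>
    hd (map g s) < hd (map g s') \<longleftrightarrow> hd s < hd s'"
  using strict_mono_on_less[of A g "hd s" "hd s'"] by (auto simp: hd_map subset_iff)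

text \<open>The rules only test equality and order of labels. Applied to \<open>lam_inv\<close>,
  this says that a renormalised path belongs to the renormalised tree.\<close>

lemma motzkin_tree_relabel:
  "motzkin_tree p s t \<Longrightarrow> strict_mono_on (set s) g \<Longrightarrow> motzkin_tree p (map g s) (relabel g t)"
proof (induction rule: motzkin_tree.induct)
  case (base a b)
  then show ?case by (auto intro!: motzkin_tree.base simp: strict_mono_on_less)
next
  case (flat p s t a)
  have "g a \<notin> set (map g s)"
    using strict_mono_on_imp_inj_on[OF flat.prems] flat.hyps(2) by (auto simp: inj_on_def)
  then show ?case using flat by (auto intro!: motzkin_tree.flat intro: monotone_on_subset)
next
  case (split p1 s1 t1 p2 s2 t2)
  have inj: "inj_on g (set s1 \<union> set s2)"
    using strict_mono_on_imp_inj_on[OF split.prems] by simp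
  have "set (map g s1) \<inter> set (map g s2) = {}"
    using inj split.hyps(3) by (fastforce simp: inj_on_def)
  moreover have "hd (map g s1) < hd (map g s2)"
    using split.hyps motzkin_tree_path hd_map_less[OF split.prems, of s1 s2] by auto
  moreover have "motzkin_tree p1 (map g s1) (relabel g t1)" "motzkin_tree p2 (map g s2) (relabel g t2)"
    using split.IH split.prems by (auto intro: monotone_on_subset)
  ultimately show ?case using motzkin_tree.split by (fastforce simp: rev_map)
qed

text \<open>Up to the joining step every non-empty prefix has height at least 1, so the first zero
  comes right after that step; its index is also the number of labels of the first piece.\<close>

lemma least_split:
  assumes "motzkin p1"
  shows "(LEAST k. 0 < k \<and> sum_list (take k (neg_rev p1 @ -1 # p2)) = 0) = Suc (length p1)"
proof (rule Least_equality)
  fix y assume y: "0 < y \<and> sum_list (take y (neg_rev p1 @ -1 # p2)) = 0"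
  show "Suc (length p1) \<le> y"
  proof (rule ccontr)
    assume "\<not> Suc (length p1) \<le> y"
    then show False
      using y motzkin_neg_revD(4)[OF assms, of y] sum_take_split[OF assms, of y "-1" p2] by auto
  qed
qed (use sum_take_split[OF assms, of "Suc (length p1)" "-1" p2] in simp)

lemma hd_neg_rev_append:
  assumes "motzkin p" shows "hd (neg_rev p @ q) \<noteq> 0"
proof -
  have "hd (neg_rev p) = sum_list (take 1 (neg_rev p))"
    using motzkin_neg_revD(3)[OF assms] by (cases "neg_rev p") auto
  moreover have "1 \<le> length p" using motzkin_neg_revD(3)[OF assms] by (cases p) auto
  ultimately show ?thesis
    using motzkin_neg_revD(3)[OF assms] motzkin_neg_revD(4)[OF assms, of 1] by simp
qed

lemma normalised:
  assumes "distinct s"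
  shows "set (map (lam_inv (set s)) s) = {1..length (map (lam_inv (set s)) s)}"
  using lam_inv_image[of "set s"] distinct_card[OF assms] by simp

text \<open>The assumption on \<open>set s\<close> enters at a horizontal step, where the definition
  takes the complement of the first label in \<open>{1..length s}\<close>. Every piece is shorter
  than \<open>s\<close>, so the fuel lasts.\<close>

lemma phi_aux_eq:
  "motzkin_tree p s t \<Longrightarrow> set s = {1..length s} \<Longrightarrow> length s \<le> f \<Longrightarrow> phi_aux f p s = t"
proof (induction f arbitrary: p s t)
  case 0
  then show ?case using motzkin_tree_path[of p s t] by simp
next
  case (Suc f)
  \<comment> \<open>\<open>lam\<close> undoes \<open>lam_inv\<close> on the leaves, so
    renormalising, recursing and relabelling yields the tree with the original labels.\<close>
  have rec: "relabel (lam (set s)) (phi_aux f p (map (lam_inv (set s)) s)) = t"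
    if "motzkin_tree p s t" "length s \<le> f" for p s t
  proof -
    note path = motzkin_tree_path[OF that(1)]
    have "motzkin_tree p (map (lam_inv (set s)) s) (relabel (lam_inv (set s)) t)"
      using motzkin_tree_relabel[OF that(1)] lam_inv_strict_mono[of "set s"] by simp
    then have "phi_aux f p (map (lam_inv (set s)) s) = relabel (lam_inv (set s)) t"
      using Suc.IH normalised[of s] path that(2) by simp
    then show ?thesis using relabel_lam_lam_inv[of "set s" t] path by simp
  qed
  from Suc.prems(1) show ?case
  proof (cases rule: motzkin_tree.cases)
    case (flat q r u a)
    have "{1..length s} - {hd s} = set r" using Suc.prems(2) flat by auto
    then show ?thesis using rec[OF flat(4)] Suc.prems(3) flat motzkin_tree_path[OF flat(4)] by (simp add: Let_def)
  next
    case (split p1 s1 t1 p2 s2 t2)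
    note path1 = motzkin_tree_path[OF split(4)] and path2 = motzkin_tree_path[OF split(5)]
    have len: "length s1 = Suc (length p1)" "length s2 \<ge> 1" "length s1 \<ge> 1"
      using path1 path2 labels_ok_length by auto
    have k: "(LEAST k. 0 < k \<and> sum_list (take k p) = 0) = length s1"
      unfolding split(1) len(1) using least_split path1 by blast
    have hd: "hd p \<noteq> 0" unfolding split(1) using hd_neg_rev_append path1 by blast
    have "phi_aux (Suc f) p s = Nd (relabel (lam (set s1)) (phi_aux f p1 (map (lam_inv (set s1)) s1)))
      (relabel (lam (set s2)) (phi_aux f p2 (map (lam_inv (set s2)) s2)))"
      using hd path1 path2 k split(1,2) len(1) by (simp add: Let_def rev_map comp_def)
    also have "\<dots> = t" using rec[OF split(4)] rec[OF split(5)] Suc.prems(3) len split(2,3) by simp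
    finally show ?thesis .
  qed simp
qed

lemma Phi_eq: "motzkin_tree p s t \<Longrightarrow> set s = {1..length s} \<Longrightarrow> Phi p s = t"
  unfolding Phi_def using phi_aux_eq by simp

section \<open>Positive paths and marked trees\<close>

text \<open>Here the mark decides which piece comes first, so \<open>split\<close> does not restrict
  the order of \<open>hd s1\<close> and \<open>hd s2\<close>; the sign of the joining step records
  it instead. The rule \<open>root\<close> is the case \<open>k = n\<close> of
  \<open>Phi'\<close>.\<close>

inductive marked_tree :: "int list \<Rightarrow> nat list \<Rightarrow> btree \<Rightarrow> btree \<Rightarrow> bool" where
  base: "marked_tree [] [a] (Lf a) (Lf a)"
| flat: "marked_tree p s t v \<Longrightarrow> a \<notin> set s \<Longrightarrow> marked_tree (0 # p) (a # s) (Nd (Lf a) t) v"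
| root: "motzkin_tree p s t \<Longrightarrow> marked_tree (neg_rev p) (rev s) t t"
| split: "motzkin_tree p1 s1 t1 \<Longrightarrow> marked_tree p2 s2 t2 v \<Longrightarrow> set s1 \<inter> set s2 = {} \<Longrightarrow>
    marked_tree (neg_rev p1 @ (if hd s1 < hd s2 then -1 else 1) # p2) (rev s1 @ s2) (Nd t1 t2) v"

text \<open>As for Motzkin paths, only \<open>flat\<close> adds a quasi-single leaf: the sibling of
  the new leaf is the mark or contains it.\<close>

lemma marked_tree_path:
  assumes "marked_tree p s t v"
  shows "positive p \<and> labels_ok p s \<and> distinct s \<and> set s = set (leaves t) \<and>
    distinct (leaves t) \<and> v \<in> subtrees t \<and> hsteps p = card (qs_leaves (t, v)) \<and> s \<noteq> []"
  using assms
proof (induction rule: marked_tree.induct)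
  case (base a)
  then show ?case by (simp add: positive_def positive_path_def qs_leaves_root)
next
  case (flat p s t v a)
  have "labels_ok (0 # p) (a # s)" using flat by (cases s) auto
  moreover have "qs_leaves (Nd (Lf a) t, v) = insert a (qs_leaves (t, v))"
    using flat qs_leaves_Nd[of "Lf a" t v] by auto
  moreover have "a \<notin> qs_leaves (t, v)" "finite (qs_leaves (t, v))"
    using flat qs_leaves_subset[of t v] by (auto intro: finite_subset)
  ultimately show ?case using flat positive_Cons_0 by auto
next
  case (root p s t)
  then show ?case using motzkin_tree_path[OF root] positive_neg_rev
    by (auto simp: labels_ok_neg_rev qs_leaves_root)
next
  case (split p1 s1 t1 p2 s2 t2 v)
  note path = motzkin_tree_path[OF split(1)]
  let ?e = "if hd s1 < hd s2 then -1 else 1"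
  have "hd s1 \<noteq> hd s2" using split path by (metis IntI empty_iff list.set_sel(1))
  then have "labels_ok (neg_rev p1 @ ?e # p2) (rev s1 @ s2)"
    using split path labels_ok_length[of p1 s1]
    by (subst labels_ok_append) (auto simp: labels_ok_neg_rev last_rev)
  moreover have d: "distinct (leaves (Nd t1 t2))" using split path by auto
  moreover have "qs_leaves (Nd t1 t2, v) = single_leaves t1 \<union> qs_leaves (t2, v)"
    using path qs_leaves_Nd[OF d] split.IH by auto
  moreover have "card (single_leaves t1 \<union> qs_leaves (t2, v)) = card (single_leaves t1) + card (qs_leaves (t2, v))"
    using d single_leaves_subset[of t1] qs_leaves_subset[of t2 v]
    by (intro card_Un_disjoint) (auto intro: finite_subset)
  moreover have "positive (neg_rev p1 @ ?e # p2)"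
    using positive_split path split.IH by auto
  ultimately show ?case
    using split path by (auto split: if_splits)
qed

lemma marked_tree_exists:
  "positive p \<Longrightarrow> labels_ok p s \<Longrightarrow> distinct s \<Longrightarrow> \<exists>t v. marked_tree p s t v"
proof (induction "length p" arbitrary: p s rule: less_induct)
  case less
  note len = labels_ok_length[OF less.prems(2)]
  show ?case
  proof (rule positive_cases[OF less.prems(1)])
    assume "p = []"
    moreover from this obtain a where "s = [a]" using len by (auto simp: length_Suc_conv)
    ultimately show ?thesis using marked_tree.base by auto
  next
    fix p' assume p: "p = 0 # p'" "positive p'"
    obtain a b s' where s: "s = a # b # s'" using len p by (auto simp: length_Suc_conv)
    then obtain t v where "marked_tree p' (b # s') t v" using less.hyps[of p' "b # s'"] less.prems p by auto
    moreover have "a \<notin> set (b # s')" using less.prems(3) s by auto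
    ultimately show ?thesis unfolding p(1) s using marked_tree.flat by blast
  next
    fix p1 assume p: "p = neg_rev p1" "motzkin p1"
    then have "labels_ok (neg_rev p1) (rev (rev s))" using less.prems by simp
    then have "labels_ok p1 (rev s)" by (simp only: labels_ok_neg_rev)
    then obtain t where "motzkin_tree p1 (rev s) t" using motzkin_tree_exists p less.prems by fastforce
    then show ?thesis using marked_tree.root[of p1 "rev s" t] p by auto
  next
    fix p1 e p2 assume p: "p = neg_rev p1 @ e # p2" "motzkin p1" "positive p2" "e = -1 \<or> e = 1"
    define s1 s2 where "s1 = rev (take (Suc (length p1)) s)" and "s2 = drop (Suc (length p1)) s"
    have s: "s = rev s1 @ s2" by (simp add: s1_def s2_def)
    have len12: "length s1 = Suc (length p1)" "length s2 = Suc (length p2)"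
      using len p by (auto simp: s1_def s2_def)
    have ok: "labels_ok (neg_rev p1) (rev s1)" "labels_ok p2 s2" "e = -1 \<Longrightarrow> hd s1 < hd s2" "e = 1 \<Longrightarrow> hd s1 > hd s2"
      using less.prems(2) len12 labels_ok_append[of "rev s1" "neg_rev p1" s2 e p2]
      unfolding p s by (cases s2; auto simp: last_rev)+
    \<comment> \<open>Either sign of \<open>e\<close> forces its own strict inequality, so the
      labels give \<open>e\<close> back.\<close>
    have e: "e = (if hd s1 < hd s2 then -1 else 1)" using ok p(4) by auto
    obtain t1 where t1: "motzkin_tree p1 s1 t1"
      using motzkin_tree_exists[of p1 s1] ok p less.prems(3) s by (auto simp: labels_ok_neg_rev)
    obtain t2 v where "marked_tree p2 s2 t2 v"
      using less.hyps[of p2 s2] ok p less.prems(3) s by auto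
    moreover have "set s1 \<inter> set s2 = {}" using less.prems(3) s by auto
    ultimately show ?thesis unfolding p(1) s e using marked_tree.split[OF t1, of p2 s2 t2 v] by blast
  qed
qed

text \<open>Children are unordered, so the child without the mark can be put first: if it is a leaf,
  \<open>flat\<close> applies, otherwise \<open>split\<close> with a Motzkin path that reaches
  it.\<close>

lemma marked_tree_reach:
  "distinct (leaves t) \<Longrightarrow> v \<in> subtrees t \<Longrightarrow>
    \<exists>p s t' v'. marked_tree p s t' v' \<and> canon t' = canon t \<and> canon v' = canon v"
proof (induction t)
  case (Lf i)
  then show ?case using marked_tree.base by fastforce
next
  case (Nd a b)
  have disj: "set (leaves a) \<inter> set (leaves b) = {}" and da: "distinct (leaves a)" and db: "distinct (leaves b)"
    using Nd.prems by auto
  have comb: "\<exists>p s t' v'. marked_tree p s t' v' \<and> canon t' = canon (Nd c d) \<and> canon v' = canon v"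
    if "marked_tree p s d' v'" "canon d' = canon d" "canon v' = canon v" "distinct (leaves c)"
      "set (leaves c) \<inter> set (leaves d) = {}" for p s c d d' v'
  proof -
    note dc = that(4)
    have s: "set s = set (leaves d)"
      using marked_tree_path[OF that(1)] that(2) by (metis set_leaves_canon)
    show ?thesis
    proof (cases c)
      case (Lf i)
      then have "marked_tree (0 # p) (i # s) (Nd (Lf i) d') v'" using marked_tree.flat that s by simp
      then show ?thesis using canon_Nd_cong[of "Lf i" "Lf i"] that(2,3) Lf by blast
    next
      case c: (Nd c1 c2)
      then obtain p1 s1 c' where c': "motzkin_tree p1 s1 c'" "canon c' = canon c"
        using motzkin_tree_reach dc by (metis is_node_simps(1))
      have "set s1 = set (leaves c)"
        using motzkin_tree_path[OF c'(1)] c'(2) by (metis set_leaves_canon)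
      then show ?thesis using marked_tree.split[OF c'(1) that(1)] s canon_Nd_cong[OF c'(2) that(2)] that(3,5)
        by blast
    qed
  qed
  consider "v = Nd a b" | "v \<in> subtrees a" | "v \<in> subtrees b" using Nd.prems by auto
  then show ?case
  proof cases
    case 1
    then show ?thesis using motzkin_tree_reach[of "Nd a b"] Nd.prems(1) marked_tree.root by (metis is_node_simps(1))
  next
    case 2
    have "set (leaves b) \<inter> set (leaves a) = {}" using disj by blast
    then show ?thesis unfolding canon_Nd_swap[OF disj] using Nd.IH(1)[OF da 2] comb db by blast
  next
    case 3
    then show ?thesis using Nd.IH(2)[OF db 3] comb da disj by blast
  qed
qed

lemma marked_subtree_canon:
  "marked_tree p s t v \<Longrightarrow> canon v \<in> subtrees (canon t)"
  using marked_tree_path subtrees_canon by blast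

lemma canon_size [simp]: "size (canon t) = size t"
  by (induction t) (auto simp: Let_def)

lemma marked_canon_size: "marked_tree p s t v \<Longrightarrow> size v \<le> size t"
  using marked_tree_path subtrees_size by (metis less_le order_refl)

text \<open>The mark breaks the symmetry between the children: \<open>canon v\<close> lies below
  only one of them, which excludes the crossed pairing. The rule \<open>root\<close> is told apart
  by size, since its mark is the whole tree.\<close>

lemma marked_tree_unique:
  "marked_tree p s t v \<Longrightarrow> marked_tree p' s' t' v' \<Longrightarrow> canon t = canon t' \<Longrightarrow> canon v = canon v' \<Longrightarrow>
    p = p' \<and> s = s'"
proof (induction arbitrary: p' s' t' v' rule: marked_tree.induct)
  case (base a)
  then have "t' = Lf a" by simp
  then show ?case using base.prems(1) by (auto elim: marked_tree.cases)
next
  case (flat p s t v a)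
  have vt: "canon v \<in> subtrees (canon t)" using marked_subtree_canon[OF flat(1)] .
  have va: "canon v \<notin> subtrees (canon (Lf a))"
    using subtrees_disjoint[of "canon t" "Lf a" "canon v"] vt flat(2) marked_tree_path[OF flat(1)] by simp
  show ?case using flat.prems(1)
  proof (cases rule: marked_tree.cases)
    case base
    then show ?thesis using flat.prems(2) by (simp del: canon.simps(2))
  next
    case f: (flat q r u b)
    have "canon v \<in> subtrees (canon u)" using marked_subtree_canon[OF f(4)] flat.prems(3) by simp
    then have "a = b" "canon t = canon u"
      using va canon_Nd_eqD[OF flat.prems(2)[unfolded f(3)]] by auto
    then show ?thesis using flat.IH[OF f(4)] flat.prems(3) f by simp
  next
    case (root q r)
    then have "size t' = size v" using flat.prems(3) canon_size by metis
    moreover have "size t' = size (Nd (Lf a) t)" using flat.prems(2) canon_size by metis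
    ultimately show ?thesis using marked_canon_size[OF flat(1)] by simp
  next
    case (split p1 s1 t1 p2 s2 t2)
    have "canon v \<in> subtrees (canon t2)" using marked_subtree_canon[OF split(5)] flat.prems(3) by simp
    then show ?thesis using va split(4) canon_Nd_eqD[OF flat.prems(2)[unfolded split(3)]] by auto
  qed
next
  case (root p s t)
  show ?case using root.prems(1)
  proof (cases rule: marked_tree.cases)
    case base
    then show ?thesis using root by simp
  next
    case (flat q r u b)
    have "size t = size v'" using root.prems(3) canon_size by metis
    moreover have "size t = size (Nd (Lf b) u)" using root.prems(2) canon_size flat(3) by metis
    ultimately show ?thesis using marked_canon_size[OF flat(4)] by simp
  next
    case r: (root q r)
    then show ?thesis using motzkin_tree_unique root by blast
  next
    case (split p1 s1 t1 p2 s2 t2)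
    have "size t = size v'" using root.prems(3) canon_size by metis
    moreover have "size t = size (Nd t1 t2)" using root.prems(2) canon_size split(3) by metis
    ultimately show ?thesis using marked_canon_size[OF split(5)] by simp
  qed
next
  case (split p1 s1 t1 p2 s2 t2 v)
  have vt: "canon v \<in> subtrees (canon t2)" using marked_subtree_canon[OF split(2)] .
  have "set (leaves (canon t2)) \<inter> set (leaves (canon t1)) = {}"
    using split(3) motzkin_tree_path[OF split(1)] marked_tree_path[OF split(2)] by auto
  then have va: "canon v \<notin> subtrees (canon t1)" using subtrees_disjoint vt by blast
  show ?case using split.prems(1)
  proof (cases rule: marked_tree.cases)
    case base
    then show ?thesis using split.prems(2) by (simp del: canon.simps(2))
  next
    case (flat q r u b)
    have "canon v \<in> subtrees (canon u)" using marked_subtree_canon[OF flat(4)] split.prems(3) by simp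
    then show ?thesis using va split.hyps(1) canon_Nd_eqD[OF split.prems(2)[unfolded flat(3)]] by auto
  next
    case (root q r)
    then have "size t' = size v" using split.prems(3) canon_size by metis
    moreover have "size t' = size (Nd t1 t2)" using split.prems(2) canon_size by metis
    ultimately show ?thesis using marked_canon_size[OF split(2)] by simp
  next
    case s: (split q1 r1 u1 q2 r2 u2)
    have "canon v \<in> subtrees (canon u2)" using marked_subtree_canon[OF s(5)] split.prems(3) by simp
    then have "canon t1 = canon u1" "canon t2 = canon u2"
      using va canon_Nd_eqD[OF split.prems(2)[unfolded s(3)]] by auto
    then show ?thesis using motzkin_tree_unique[OF split(1) s(4)] split.IH[OF s(5)] split.prems(3) s by auto
  qed
qed

section \<open>Evaluation of \<open>Phi'\<close>\<close>

lemma marked_tree_relabel: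
  "marked_tree p s t v \<Longrightarrow> strict_mono_on (set s) g \<Longrightarrow> marked_tree p (map g s) (relabel g t) (relabel g v)"
proof (induction rule: marked_tree.induct)
  case (base a)
  then show ?case using marked_tree.base by simp
next
  case (flat p s t v a)
  have "g a \<notin> set (map g s)"
    using strict_mono_on_imp_inj_on[OF flat.prems] flat.hyps(2) by (auto simp: inj_on_def)
  then show ?case using flat by (auto intro!: marked_tree.flat intro: monotone_on_subset)
next
  case (root p s t)
  then show ?case using marked_tree.root[OF motzkin_tree_relabel] by (simp add: rev_map)
next
  case (split p1 s1 t1 p2 s2 t2 v)
  have inj: "inj_on g (set s1 \<union> set s2)"
    using strict_mono_on_imp_inj_on[OF split.prems] by simp
  have "set (map g s1) \<inter> set (map g s2) = {}"
    using inj split.hyps(3) by (fastforce simp: inj_on_def)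
  moreover have "hd (map g s1) < hd (map g s2) \<longleftrightarrow> hd s1 < hd s2"
    using split.hyps motzkin_tree_path[OF split(1)] marked_tree_path[OF split(2)]
      hd_map_less[OF split.prems, of s1 s2] by auto
  moreover have "motzkin_tree p1 (map g s1) (relabel g t1)" "marked_tree p2 (map g s2) (relabel g t2) (relabel g v)"
    using split.IH split.prems motzkin_tree_relabel[OF split(1)] by (auto intro: monotone_on_subset)
  ultimately show ?case using marked_tree.split[of p1 "map g s1" "relabel g t1" p2 "map g s2"] by (fastforce simp: rev_map)
qed

text \<open>A larger candidate would be at height 1 again. After \<open>e = 1\<close> the height
  stays at least 2, and after \<open>e = -1\<close> the prefix ending with the joining step has
  height 0, which the condition on \<open>j\<close> forbids.\<close>

lemma greatest_split:
  assumes m: "motzkin p1" and n: "Suc (length p1) \<le> n"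
    and p: "p = neg_rev p1 \<and> n = Suc (length p1) \<or>
      p = neg_rev p1 @ e # p2 \<and> positive p2 \<and> (e = -1 \<or> e = 1) \<and> n = Suc (length p)"
  shows "(GREATEST k. k \<le> n \<and> 1 \<le> k \<and> (\<forall>j\<in>{2..k-1}. sum_list (take (j - 1) p) \<ge> 1) \<and>
            sum_list (take (k - 1) p) = 1) = Suc (length p1)"
proof (rule Greatest_equality)
  have low: "sum_list (take j p) = sum_list (take j (neg_rev p1))" if "j \<le> length p1" for j
    using p that by auto
  show "Suc (length p1) \<le> n \<and> 1 \<le> Suc (length p1) \<and>
    (\<forall>j\<in>{2..Suc (length p1)-1}. sum_list (take (j - 1) p) \<ge> 1) \<and> sum_list (take (Suc (length p1) - 1) p) = 1"
  proof (intro conjI ballI)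
    fix j assume "j \<in> {2..Suc (length p1) - 1}"
    then show "1 \<le> sum_list (take (j - 1) p)" using low[of "j - 1"] motzkin_neg_revD(4)[OF m, of "j - 1"] by auto
  qed (use n low[of "length p1"] motzkin_neg_revD(2)[OF m] in auto)
next
  fix k assume k: "k \<le> n \<and> 1 \<le> k \<and> (\<forall>j\<in>{2..k-1}. sum_list (take (j - 1) p) \<ge> 1) \<and> sum_list (take (k - 1) p) = 1"
  show "k \<le> Suc (length p1)"
  proof (rule ccontr)
    assume c: "\<not> k \<le> Suc (length p1)"
    then have p': "p = neg_rev p1 @ e # p2" "positive p2" "e = -1 \<or> e = 1" "n = Suc (length p)" using p k by auto
    let ?i = "k - 1 - Suc (length p1)"
    have "sum_list (take (k - 1) (neg_rev p1 @ e # p2)) = 1" using k p'(1) by simp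
    then have s: "1 + e + sum_list (take ?i p2) = 1"
      using c unfolding sum_take_split[OF m] by (simp split: if_splits)
    have "?i \<le> length p2" using k p' by auto
    then have pos: "sum_list (take ?i p2) \<ge> 0" using p'(2) by (auto simp: positive_def positive_path_def)
    then have e: "e = -1" using s p'(3) by auto
    then have "?i \<noteq> 0" using s by (auto intro!: ccontr[of "_ \<noteq> _"])
    then have "Suc (Suc (length p1)) \<in> {2..k-1}" using c by auto
    then have "sum_list (take (Suc (Suc (length p1)) - 1) p) \<ge> 1" using k by blast
    then show False using sum_take_split[OF m, of "Suc (length p1)" e p2] e unfolding p'(1) by (simp del: take_append)
  qed
qed

lemma phim_aux_eq:
  "marked_tree p s t v \<Longrightarrow> set s = {1..length s} \<Longrightarrow> length s \<le> f \<Longrightarrow> phim_aux f p s = (t, v)"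
proof (induction f arbitrary: p s t v)
  case 0
  then show ?case using marked_tree_path[of p s t v] by simp
next
  case (Suc f)
  have rec: "relabel (lam (set s)) (fst (phim_aux f p (map (lam_inv (set s)) s))) = t"
     "relabel (lam (set s)) (snd (phim_aux f p (map (lam_inv (set s)) s))) = v"
    if "marked_tree p s t v" "length s \<le> f" for p s t v
  proof -
    note path = marked_tree_path[OF that(1)]
    have "marked_tree p (map (lam_inv (set s)) s) (relabel (lam_inv (set s)) t) (relabel (lam_inv (set s)) v)"
      using marked_tree_relabel[OF that(1)] lam_inv_strict_mono[of "set s"] by simp
    then have "phim_aux f p (map (lam_inv (set s)) s) = (relabel (lam_inv (set s)) t, relabel (lam_inv (set s)) v)"
      using Suc.IH normalised[of s] path that(2) by simp
    moreover have "set (leaves v) \<subseteq> set s" using path subtrees_leaves by simp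
    ultimately show "relabel (lam (set s)) (fst (phim_aux f p (map (lam_inv (set s)) s))) = t"
     "relabel (lam (set s)) (snd (phim_aux f p (map (lam_inv (set s)) s))) = v"
      using relabel_lam_lam_inv[of "set s"] path by simp_all
  qed
  have recm: "relabel (lam (set s)) (Phi p (map (lam_inv (set s)) s)) = t"
    if "motzkin_tree p s t" for p s t
  proof -
    note path = motzkin_tree_path[OF that]
    have "motzkin_tree p (map (lam_inv (set s)) s) (relabel (lam_inv (set s)) t)"
      using motzkin_tree_relabel[OF that(1)] lam_inv_strict_mono[of "set s"] by simp
    then have "Phi p (map (lam_inv (set s)) s) = relabel (lam_inv (set s)) t"
      using Phi_eq normalised[of s] path by blast
    then show ?thesis using relabel_lam_lam_inv[of "set s" t] path by simp
  qed
  from Suc.prems(1) show ?case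
  proof (cases rule: marked_tree.cases)
    case (flat q r u a)
    have "{1..length s} - {hd s} = set r" using Suc.prems(2) flat by auto
    then show ?thesis using rec[OF flat(4)] Suc.prems(3) flat marked_tree_path[OF flat(4)] by (simp add: Let_def)
  next
    case (root p1 s1)
    note path = motzkin_tree_path[OF root(4)]
    have len: "length s1 = Suc (length p1)" using path labels_ok_length by auto
    have k: "(GREATEST k. k \<le> length s \<and> 1 \<le> k \<and> (\<forall>j\<in>{2..k-1}. sum_list (take (j - 1) p) \<ge> 1) \<and>
            sum_list (take (k - 1) p) = 1) = length s"
      using greatest_split[of p1 "length s" p] path root len by simp
    have hd: "hd p \<noteq> 0" using hd_neg_rev_append[of p1 "[]"] path root by simp
    have t: "take (length s) s = rev s1" "take (length s - 1) p = neg_rev p1" "\<not> length s \<le> 1"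
      using root(1,2) len path by auto
    have s1: "set s1 = {1..length s1}" using Suc.prems(2) root by simp
    \<comment> \<open>For \<open>k = n\<close> the definition normalises the labels but does not
      relabel the result, so normalisation has to be the identity here; it is, because the labels
      form an initial interval.\<close>
    have idm: "map (lam_inv (set s1)) s1 = s1"
    proof (rule map_idI)
      fix x assume "x \<in> set s1"
      then have "{y\<in>set s1. y < x} = {1..<x}" "1 \<le> x" using s1 by auto
      then show "lam_inv (set s1) x = x" by (simp add: lam_inv_def)
    qed
    have "phim_aux (Suc f) p s = (Phi p1 (map (lam_inv (set s1)) s1), Phi p1 (map (lam_inv (set s1)) s1))"
      using hd t by (simp only: phim_aux.simps Let_def k if_False if_True set_rev neg_rev_neg_rev rev_rev_ident simp_thms)
    then show ?thesis using idm Phi_eq[OF root(4) s1] root by simp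
  next
    case (split p1 s1 t1 p2 s2 t2)
    note path1 = motzkin_tree_path[OF split(4)] and path2 = marked_tree_path[OF split(5)]
    have len: "length s1 = Suc (length p1)" "length s2 = Suc (length p2)"
      using path1 path2 labels_ok_length by auto
    have k: "(GREATEST k. k \<le> length s \<and> 1 \<le> k \<and> (\<forall>j\<in>{2..k-1}. sum_list (take (j - 1) p) \<ge> 1) \<and>
            sum_list (take (k - 1) p) = 1) = length s1"
      unfolding len(1)
      by (rule greatest_split[where e = "if hd s1 < hd s2 then -1 else 1" and ?p2.0 = p2]) (use path1 path2 split(1,2) len in auto)
    have hd: "hd p \<noteq> 0" unfolding split(1) using hd_neg_rev_append path1 by blast
    have t: "take (length s1) s = rev s1" "drop (length s1) s = s2"
      "take (length s1 - 1) p = neg_rev p1" "drop (length s1) p = p2" "length s1 \<noteq> length s" "\<not> length s \<le> 1"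
      using split(1,2) len by auto
    have "phim_aux (Suc f) p s = (Nd (relabel (lam (set s1)) (Phi p1 (map (lam_inv (set s1)) s1)))
      (relabel (lam (set s2)) (fst (phim_aux f p2 (map (lam_inv (set s2)) s2)))),
       relabel (lam (set s2)) (snd (phim_aux f p2 (map (lam_inv (set s2)) s2))))"
      using hd t by (simp only: phim_aux.simps Let_def k if_False set_rev neg_rev_neg_rev rev_rev_ident)
    also have "\<dots> = (t, v)" using recm[OF split(4)] rec[OF split(5)] Suc.prems(3) len split(2,3) by simp
    finally show ?thesis .
  qed simp
qed

lemma Phi'_eq:
  assumes "marked_tree p s t v" "set s = {1..n}"
  shows "Phi' (p, s) = (canon t, canon v)"
proof -
  have "length s = card {1..n}" using marked_tree_path[OF assms(1)] assms(2) distinct_card by metis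
  then have "length s = n" by simp
  then show ?thesis unfolding Phi'_def using phim_aux_eq[OF assms(1)] assms(2) by simp
qed

section \<open>Bijection from positive paths to marked trees\<close>

lemma pos_paths_iff:
  assumes "n \<ge> 1"
  shows "(p, s) \<in> pos_paths n k \<longleftrightarrow> (\<exists>t v. marked_tree p s t v) \<and> set s = {1..n} \<and> hsteps p = k"
proof -
  have "(p, s) \<in> pos_paths n k \<longleftrightarrow>
    positive p \<and> labels_ok p s \<and> distinct s \<and> set s = {1..n} \<and> hsteps p = k"
    unfolding pos_paths_def positive_def using well_labelled_iff[OF assms] by auto
  then show ?thesis using marked_tree_exists marked_tree_path by metis
qed

theorem bij_betw_Phi':
  assumes "1 \<le> n"
  shows "bij_betw Phi' (pos_paths n k) (marked_trees n k)"
proof (rule bij_betw_imageI)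
  show "inj_on Phi' (pos_paths n k)"
  proof (rule inj_onI, clarify)
    fix p s p' s'
    assume a: "(p, s) \<in> pos_paths n k" "(p', s') \<in> pos_paths n k" "Phi' (p, s) = Phi' (p', s')"
    then obtain t v t' v' where m: "marked_tree p s t v" "marked_tree p' s' t' v'" "set s = {1..n}" "set s' = {1..n}"
      unfolding pos_paths_iff[OF assms] by blast
    then show "p = p' \<and> s = s'"
      using a(3) Phi'_eq[OF m(1,3)] Phi'_eq[OF m(2,4)] marked_tree_unique[OF m(1,2)] by simp
  qed
  show "Phi' ` pos_paths n k = marked_trees n k"
  proof (intro equalityI subsetI)
    fix x assume "x \<in> Phi' ` pos_paths n k"
    then obtain p s where ps: "(p, s) \<in> pos_paths n k" "x = Phi' (p, s)" by auto
    then obtain t v where m: "marked_tree p s t v" "set s = {1..n}" "hsteps p = k"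
      unfolding pos_paths_iff[OF assms] by blast
    note path = marked_tree_path[OF m(1)]
    have "x = (canon t, canon v)" using ps Phi'_eq m by simp
    then show "x \<in> marked_trees n k"
      unfolding marked_trees_def
      using path m canonical_canon[of t] qs_leaves_canon[of t v] subtrees_canon[of t] by auto
  next
    fix x assume "x \<in> marked_trees n k"
    then obtain t v where x: "x = (t, v)" "canonical t" "distinct (leaves t)" "set (leaves t) = {1..n}"
      "v \<in> subtrees t" "card (qs_leaves (t, v)) = k" unfolding marked_trees_def by blast
    obtain p s t' v' where m: "marked_tree p s t' v'" "canon t' = canon t" "canon v' = canon v"
      using marked_tree_reach x by blast
    note path = marked_tree_path[OF m(1)]
    have ct: "canon t = t" using canon_canonical x by blast
    \<comment> \<open>\<open>canon v\<close> is a vertex of \<open>canon t = t\<close> with the same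
      leaves as \<open>v\<close>, hence \<open>v\<close> itself.\<close>
    then have cv: "canon v = v" using canon_canonical x canonical_canon[of v] subtrees_distinct[OF x(5,3)]
      subtrees_canon[of t] canon_inj_subtrees[OF x(3) _ x(5)]
      by (metis distinct_leaves_canon imageI set_leaves_canon subtrees_eq_if_leaves_eq)
    have s: "set s = {1..n}" using path m(2) x(4) by (metis set_leaves_canon)
    have "hsteps p = k" using path m qs_leaves_canon[of t' v'] ct cv x by simp
    then have "(p, s) \<in> pos_paths n k" unfolding pos_paths_iff[OF assms] using m(1) s by blast
    moreover have "Phi' (p, s) = x" using Phi'_eq[OF m(1) s] m ct cv x by simp
    ultimately show "x \<in> Phi' ` pos_paths n k" by force
  qed
qed

section \<open>Greedy enumerations of a tree\<close>

fun kids :: "btree \<Rightarrow> btree set" where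
  "kids (Lf i) = {}"
| "kids (Nd a b) = {a, b}"

lemma kids_size: "v \<in> kids x \<Longrightarrow> size v < size x"
  by (cases x) auto

lemma kids_subtrees: "v \<in> kids x \<Longrightarrow> x \<in> subtrees t \<Longrightarrow> v \<in> subtrees t"
  by (cases x) (auto dest: subtrees_children)

lemma finite_subtrees [simp]: "finite (subtrees t)"
  by (induction t) auto

text \<open>The \<open>2*n-1\<close> vertices match the labels once the root has one too; this count
  later shows that an injective enumeration is onto and that an onto one is injective.\<close>

lemma card_subtrees: "distinct (leaves t) \<Longrightarrow> Suc (card (subtrees t)) = 2 * length (leaves t)"
proof (induction t)
  case (Nd a b)
  have "subtrees a \<inter> subtrees b = {}" using subtrees_disjoint[of a b] Nd.prems by auto
  moreover have "Nd a b \<notin> subtrees a" "Nd a b \<notin> subtrees b"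
    using subtrees_size[of "Nd a b" a] subtrees_size[of "Nd a b" b] by auto
  ultimately show ?case using Nd by (simp add: card_Un_disjoint)
qed simp

lemma parent_exists: "v \<in> subtrees t \<Longrightarrow> v \<noteq> t \<Longrightarrow> \<exists>x\<in>subtrees t. v \<in> kids x"
proof (induction t)
  case (Nd a b)
  then show ?case by (cases "v = a \<or> v = b") auto
qed simp

lemma subtrees_size_le: "v \<in> subtrees t \<Longrightarrow> size v \<le> size t"
  using subtrees_size by (metis less_le order_refl)

text \<open>Disjoint leaf sets put \<open>v\<close> and all its parents other than the root into the
  same child of the root, and sizes exclude that the root is a second parent.\<close>

lemma parent_unique:
  "distinct (leaves t) \<Longrightarrow> x \<in> subtrees t \<Longrightarrow> y \<in> subtrees t \<Longrightarrow> v \<in> kids x \<Longrightarrow> v \<in> kids y \<Longrightarrow> x = y"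
proof (induction t)
  case (Nd a b)
  have disj: "set (leaves a) \<inter> set (leaves b) = {}" using Nd.prems(1) by auto
  have nab: "\<not> (w \<in> subtrees a \<and> w \<in> subtrees b)" for w using subtrees_disjoint[OF disj] by blast
  have root: "z \<notin> subtrees a" "z \<notin> subtrees b" if "v \<in> kids (Nd a b)" "v \<in> kids z" for z
    using that kids_size[of v z] subtrees_size_le[of z a] subtrees_size_le[of z b]
      kids_subtrees[of v z a] kids_subtrees[of v z b] nab[of v] by auto
  have sub: "v \<in> subtrees a" if "z \<in> subtrees a" "v \<in> kids z" for z using that kids_subtrees by blast
  have sub': "v \<in> subtrees b" if "z \<in> subtrees b" "v \<in> kids z" for z using that kids_subtrees by blast
  show ?case
    using Nd.IH Nd.prems root[OF _ Nd.prems(4)] root[OF _ Nd.prems(5)] sub sub' nab[of v]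
    by (metis UnE distinct_append insertE leaves.simps(2) subtrees.simps(2))
qed simp

lemma sibling_neq:
  assumes "distinct (leaves t)" "Nd a b \<in> subtrees t" shows "a \<noteq> b"
  using subtrees_distinct[OF assms(2,1)] leaves_nonempty[of a] by auto

text \<open>\<open>T\<close> is the inverse of Chen's labelling, extended by giving the root the label \<open>2n - 1\<close>. The last
  conjunct is the greedy choice: of all nodes whose children are labelled at time \<open>m\<close>, the one labelled
  \<open>m\<close> has the least key.\<close>

definition chen_enum :: "btree \<Rightarrow> nat \<Rightarrow> (nat \<Rightarrow> btree) \<Rightarrow> bool" where
  "chen_enum t n T \<longleftrightarrow>
     (\<forall>i\<in>{1..n}. T i = Lf i) \<and> bij_betw T {1..2*n-1} (subtrees t) \<and> T (2*n-1) = t \<and>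
     (\<forall>m\<in>{n+1..2*n-1}. \<exists>a\<in>{1..<m}. \<exists>b\<in>{1..<m}. T m = Nd (T a) (T b)) \<and>
     (\<forall>m\<in>{n+1..2*n-1}. \<forall>m'\<in>{m..2*n-1}. \<forall>a\<in>{1..<m}. \<forall>b\<in>{1..<m}. \<forall>c\<in>{1..<m}. \<forall>d\<in>{1..<m}.
        T m = Nd (T a) (T b) \<longrightarrow> T m' = Nd (T c) (T d) \<longrightarrow> min a b \<le> min c d)"

lemma chen_enumD:
  assumes "chen_enum t n T"
  shows "\<And>i. i \<in> {1..n} \<Longrightarrow> T i = Lf i" "inj_on T {1..2*n-1}" "T ` {1..2*n-1} = subtrees t" "T (2*n-1) = t"
    "\<And>m. m \<in> {n+1..2*n-1} \<Longrightarrow> \<exists>a\<in>{1..<m}. \<exists>b\<in>{1..<m}. T m = Nd (T a) (T b)"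
    "\<And>m m' a b c d. m \<in> {n+1..2*n-1} \<Longrightarrow> m' \<in> {m..2*n-1} \<Longrightarrow> a \<in> {1..<m} \<Longrightarrow> b \<in> {1..<m} \<Longrightarrow>
      c \<in> {1..<m} \<Longrightarrow> d \<in> {1..<m} \<Longrightarrow> T m = Nd (T a) (T b) \<Longrightarrow> T m' = Nd (T c) (T d) \<Longrightarrow> min a b \<le> min c d"
proof -
  note * = assms[unfolded chen_enum_def bij_betw_def]
  show "\<And>i. i \<in> {1..n} \<Longrightarrow> T i = Lf i" using *[THEN conjunct1] by blast
  show "inj_on T {1..2*n-1}" "T ` {1..2*n-1} = subtrees t" using *[THEN conjunct2, THEN conjunct1] by blast+
  show "T (2*n-1) = t" using *[THEN conjunct2, THEN conjunct2, THEN conjunct1] .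
  show "\<And>m. m \<in> {n+1..2*n-1} \<Longrightarrow> \<exists>a\<in>{1..<m}. \<exists>b\<in>{1..<m}. T m = Nd (T a) (T b)"
    using *[THEN conjunct2, THEN conjunct2, THEN conjunct2, THEN conjunct1] by (rule bspec)
  show "\<And>m m' a b c d. m \<in> {n+1..2*n-1} \<Longrightarrow> m' \<in> {m..2*n-1} \<Longrightarrow> a \<in> {1..<m} \<Longrightarrow> b \<in> {1..<m} \<Longrightarrow>
      c \<in> {1..<m} \<Longrightarrow> d \<in> {1..<m} \<Longrightarrow> T m = Nd (T a) (T b) \<Longrightarrow> T m' = Nd (T c) (T d) \<Longrightarrow> min a b \<le> min c d"
    using *[THEN conjunct2, THEN conjunct2, THEN conjunct2, THEN conjunct2, rule_format] .
qed

text \<open>\<open>G\<close> cannot have enumerated \<open>T m\<close> before \<open>m\<close>, so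
  the key of \<open>G m\<close> is at most that of \<open>T m\<close>; by symmetry the keys agree,
  and a common child has only one parent. This identifies an enumeration built from a matching with
  Chen's.\<close>

lemma chen_enum_unique:
  assumes T: "chen_enum t n T" and G: "chen_enum t n G" and d: "distinct (leaves t)"
  shows "m \<in> {1..2*n-1} \<Longrightarrow> T m = G m"
proof (induction m rule: less_induct)
  case (less m)
  show ?case
  proof (cases "m \<le> n")
    case True
    then show ?thesis using chen_enumD(1)[OF T] chen_enumD(1)[OF G] less.prems by auto
  next
    case False
    then have m: "m \<in> {n+1..2*n-1}" using less.prems by auto
    obtain a b where ab: "a \<in> {1..<m}" "b \<in> {1..<m}" "T m = Nd (T a) (T b)" using chen_enumD(5)[OF T m] by blast
    obtain c e where ce: "c \<in> {1..<m}" "e \<in> {1..<m}" "G m = Nd (G c) (G e)" using chen_enumD(5)[OF G m] by blast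
    have IH: "T i = G i" if "i \<in> {1..<m}" for i using less that by auto
    have mem: "T m \<in> subtrees t" "G m \<in> subtrees t" using less.prems chen_enumD(3)[OF T] chen_enumD(3)[OF G] by blast+
    obtain m' where m': "m' \<in> {1..2*n-1}" "G m' = T m"
      using mem chen_enumD(3)[OF G] by (metis imageE)
    obtain m'' where m'': "m'' \<in> {1..2*n-1}" "T m'' = G m"
      using mem chen_enumD(3)[OF T] by (metis imageE)
    have "\<not> m' < m" using IH[of m'] m' inj_onD[OF chen_enumD(2)[OF T], of m' m] less.prems by auto
    then have 1: "min c e \<le> min a b"
      using chen_enumD(6)[OF G m, of m' c e a b] m' ab ce IH by auto
    have "\<not> m'' < m" using IH[of m''] m'' inj_onD[OF chen_enumD(2)[OF G], of m'' m] less.prems by auto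
    then have 2: "min a b \<le> min c e"
      using chen_enumD(6)[OF T m, of m'' a b c e] m'' ab ce IH by auto
    have "T (min a b) \<in> kids (T m)" using ab by (auto simp: min_def)
    moreover have "T (min a b) \<in> kids (G m)" using 1 2 ce IH by (auto simp: min_def split: if_splits)
    ultimately show ?thesis using parent_unique[OF d mem] by blast
  qed
qed

section \<open>Siblings\<close>

definition siblings :: "btree \<Rightarrow> btree \<Rightarrow> btree \<Rightarrow> bool" where
  "siblings t v w \<longleftrightarrow> Nd v w \<in> subtrees t \<or> Nd w v \<in> subtrees t"

lemma siblings_sym: "siblings t v w \<longleftrightarrow> siblings t w v"
  by (auto simp: siblings_def)

lemma siblings_unique:
  assumes "distinct (leaves t)" "siblings t v w" "siblings t v w'" shows "w = w'"
proof -
  have "Nd a b = Nd c d" if "Nd a b \<in> subtrees t" "Nd c d \<in> subtrees t" "v \<in> {a,b}" "v \<in> {c,d}" for a b c d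
    using parent_unique[OF assms(1) that(1,2), of v] that(3,4) by simp
  then show ?thesis using assms(2,3) unfolding siblings_def
    by (metis btree.inject(2) insertCI)
qed

lemma siblings_neq: "distinct (leaves t) \<Longrightarrow> siblings t v w \<Longrightarrow> v \<noteq> w"
  unfolding siblings_def using sibling_neq by metis

lemma siblings_subtrees:
  assumes "siblings t v w" shows "v \<in> subtrees t" "v \<noteq> t"
proof -
  obtain x where x: "x \<in> subtrees t" "v \<in> kids x" using assms unfolding siblings_def by (metis insertCI kids.simps(2))
  show "v \<in> subtrees t" using kids_subtrees[OF x(2,1)] .
  show "v \<noteq> t" using kids_size[OF x(2)] subtrees_size_le[OF x(1)] by auto
qed

lemma siblings_exist: "v \<in> subtrees t \<Longrightarrow> v \<noteq> t \<Longrightarrow> \<exists>w. siblings t v w"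
proof -
  assume "v \<in> subtrees t" "v \<noteq> t"
  then obtain x where x: "x \<in> subtrees t" "v \<in> kids x" using parent_exists by blast
  then show ?thesis unfolding siblings_def by (cases x) auto
qed

lemma canonical_subtree: "v \<in> subtrees t \<Longrightarrow> canonical t \<Longrightarrow> canonical v"
  by (induction t) auto

text \<open>A parent is enumerated after its children, and injectivity of \<open>T\<close> shows
  that these children are numbered \<open>a\<close> and \<open>b\<close>.\<close>

lemma chen_enum_parent:
  assumes T: "chen_enum t n T" and s: "siblings t (T a) (T b)" and ab: "a \<in> {1..2*n-1}" "b \<in> {1..2*n-1}"
  obtains m where "m \<in> {n+1..2*n-1}" "a < m" "b < m" "T m = Nd (T a) (T b) \<or> T m = Nd (T b) (T a)"
proof -
  obtain x where x: "x \<in> subtrees t" "x = Nd (T a) (T b) \<or> x = Nd (T b) (T a)" using s by (auto simp: siblings_def)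
  then obtain m where m: "m \<in> {1..2*n-1}" "T m = x" using chen_enumD(3)[OF T] by (metis imageE)
  have mn: "m \<in> {n+1..2*n-1}" using m x chen_enumD(1)[OF T, of m] by (cases "m \<le> n") auto
  obtain c d where cd: "c \<in> {1..<m}" "d \<in> {1..<m}" "T m = Nd (T c) (T d)" using chen_enumD(5)[OF T mn] by blast
  have "{T a, T b} = {T c, T d}" using cd m x by auto
  then have "T a \<in> T ` {c,d}" "T b \<in> T ` {c,d}" by auto
  moreover have "{c,d} \<subseteq> {1..2*n-1}" using cd mn by auto
  ultimately have "a \<in> {c,d}" "b \<in> {c,d}" using ab inj_on_image_mem_iff[OF chen_enumD(2)[OF T]] by blast+
  then show thesis using that[OF mn] cd m x by auto
qed

text \<open>The sibling relation on labels determines the tree, because at each step both enumerations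
  take the available pair with the least minimum.\<close>

lemma chen_enum_inj:
  assumes T: "chen_enum t n T" and G: "chen_enum u n G"
    and d: "distinct (leaves t)" "distinct (leaves u)" and c: "canonical t" "canonical u"
    and eq: "\<And>i j. i \<in> {1..2*n-2} \<Longrightarrow> j \<in> {1..2*n-2} \<Longrightarrow> siblings t (T i) (T j) \<longleftrightarrow> siblings u (G i) (G j)"
  shows "m \<in> {1..2*n-1} \<Longrightarrow> T m = G m"
proof (induction m rule: less_induct)
  case (less m)
  \<comment> \<open>One half of the comparison of keys, stated for arbitrary enumerations so that it
    serves in both directions: the pair that \<open>T\<close> takes at \<open>m\<close> is still
    available to \<open>G\<close>.\<close>
  have key: "min c e \<le> min a b"
    if T: "chen_enum t n T" and G: "chen_enum u n G" and d: "distinct (leaves t)"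
      and m: "m \<in> {n+1..2*n-1}"
      and eq: "\<And>i j. i \<in> {1..2*n-2} \<Longrightarrow> j \<in> {1..2*n-2} \<Longrightarrow> siblings t (T i) (T j) \<longleftrightarrow> siblings u (G i) (G j)"
      and IH: "\<And>i. i \<in> {1..<m} \<Longrightarrow> T i = G i"
      and ab: "a \<in> {1..<m}" "b \<in> {1..<m}" "T m = Nd (T a) (T b)"
      and ce: "c \<in> {1..<m}" "e \<in> {1..<m}" "G m = Nd (G c) (G e)" for t u T G a b c e
  proof -
    have Tm: "T m \<in> subtrees t" using chen_enumD(3)[OF T] m by auto
    have "siblings t (T a) (T b)" using Tm ab(3) by (simp add: siblings_def)
    then have "siblings u (G a) (G b)" using eq[of a b] ab m by auto
    then obtain m' where m': "m' \<in> {n+1..2*n-1}" "G m' = Nd (G a) (G b) \<or> G m' = Nd (G b) (G a)"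
      using chen_enum_parent[OF G, of a b] ab m by auto
    have "\<not> m' < m"
    proof
      assume lt: "m' < m"
      then have "T m' = Nd (T a) (T b) \<or> T m' = Nd (T b) (T a)" using IH[of m'] IH[of a] IH[of b] m' ab by auto
      then have "T a \<in> kids (T m')" by auto
      moreover have "T a \<in> kids (T m)" using ab by auto
      moreover have "T m' \<in> subtrees t" using chen_enumD(3)[OF T] m' by auto
      ultimately have "T m = T m'" using parent_unique[OF d Tm] by blast
      then show False using lt inj_onD[OF chen_enumD(2)[OF T], of m m'] m m' by auto
    qed
    then have m'm: "m' \<in> {m..2*n-1}" using m' by auto
    show ?thesis using m'(2)
    proof
      assume "G m' = Nd (G a) (G b)"
      then show ?thesis using chen_enumD(6)[OF G m m'm ce(1,2) ab(1,2) ce(3)] by blast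
    next
      assume "G m' = Nd (G b) (G a)"
      then show ?thesis using chen_enumD(6)[OF G m m'm ce(1,2) ab(2,1) ce(3)] by (metis min.commute)
    qed
  qed
  show ?case
  proof (cases "m \<le> n")
    case True
    then show ?thesis using chen_enumD(1)[OF T] chen_enumD(1)[OF G] less.prems by auto
  next
    case False
    then have m: "m \<in> {n+1..2*n-1}" using less.prems by auto
    obtain a b where ab: "a \<in> {1..<m}" "b \<in> {1..<m}" "T m = Nd (T a) (T b)" using chen_enumD(5)[OF T m] by blast
    obtain c e where ce: "c \<in> {1..<m}" "e \<in> {1..<m}" "G m = Nd (G c) (G e)" using chen_enumD(5)[OF G m] by blast
    have IH: "T i = G i" if "i \<in> {1..<m}" for i using less that by auto
    have mem: "T m \<in> subtrees t" "G m \<in> subtrees u"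
      using less.prems chen_enumD(3)[OF T] chen_enumD(3)[OF G] by blast+
    have min: "min a b = min c e"
      using key[OF G T d(2) m eq[symmetric] IH[symmetric] ce ab] key[OF T G d(1) m eq IH ab ce] by (rule order.antisym)
    have sab: "siblings t (T a) (T b)" using mem(1) ab(3) by (simp add: siblings_def)
    have "siblings u (G c) (G e)" using mem(2) ce(3) by (simp add: siblings_def)
    then have sce: "siblings t (T c) (T e)" using eq[of c e] ce m by auto
    have "a = c \<or> a = e \<or> b = c \<or> b = e" using min by (auto simp: min_def split: if_splits)
    then have "T a = T c \<and> T b = T e \<or> T a = T e \<and> T b = T c"
      using sab sce siblings_unique[OF d(1)] siblings_sym by metis
    then have "G m = T m \<or> G m = Nd (T b) (T a)"
      using ce(3) ab(3) IH[OF ce(1)] IH[OF ce(2)] by auto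
    \<comment> \<open>The labels fix the children only up to order; canonicity picks the
      order.\<close>
    moreover have "canonical (G m)" "canonical (T m)" using canonical_subtree mem c by blast+
    ultimately show ?thesis using ab(3) by auto
  qed
qed

section \<open>Chen's labelling\<close>

text \<open>Chen's process does not get stuck before all non-root vertices are labelled, and its
  choice of a least key is the greedy clause. The root is never a candidate, so its part of the
  clause needs an argument of its own.\<close>

lemma chen_enum_exists:
  assumes d: "distinct (leaves t)" and s: "set (leaves t) = {1..n}" and n: "2 \<le> n"
  obtains T where "chen_enum t n T" "\<And>i. i \<in> {1..2*n-2} \<Longrightarrow> chen_labels t (T i) = Some i"
proof -
  have nl: "nleaves t = n" using distinct_card[OF d] s by (simp add: nleaves_def)
  have node: "is_node t" using nl n by (cases t) (auto simp: nleaves_def)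
  have csub: "card (subtrees t) = 2*n-1" using card_subtrees[OF d] nl by (simp add: nleaves_def)
  define L0 :: "btree \<Rightarrow> nat option" where "L0 = (\<lambda>v. case v of Lf i \<Rightarrow> Some i | Nd _ _ \<Rightarrow> None)"
  define st where "st j = (chen_step t ^^ j) (L0, n + 1)" for j
  define L where "L j = fst (st j)" for j
  define C where "C j = chen_cands t (L j)" for j
  define v where "v j = (SOME v. v \<in> C j \<and> (\<forall>w\<in>C j. chen_key (L j) v \<le> chen_key (L j) w))" for j
  \<comment> \<open>Step \<open>j\<close> gives out the label \<open>n + 1 + j\<close>; the root
    receives \<open>2*n-1\<close> by hand.\<close>
  define T where "T i = (if i \<le> n then Lf i else if i = 2*n-1 then t else v (i - n - 1))" for i
  have vmin: "v j \<in> C j \<and> (\<forall>w\<in>C j. chen_key (L j) (v j) \<le> chen_key (L j) w)" if "C j \<noteq> {}" for j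
  proof -
    have "\<exists>v. v \<in> C j \<and> (\<forall>w. w \<in> C j \<longrightarrow> chen_key (L j) v \<le> chen_key (L j) w)"
      using that ex_has_least_nat[of "\<lambda>v. v \<in> C j" _ "chen_key (L j)"] by blast
    then show ?thesis unfolding v_def using someI_ex[of "\<lambda>v. v \<in> C j \<and> (\<forall>w\<in>C j. chen_key (L j) v \<le> chen_key (L j) w)"] by blast
  qed
  \<comment> \<open>After \<open>j\<close> steps the labelled vertices are exactly
    \<open>T 1, ..., T (n + j)\<close>, none of them the root.\<close>
  define inv where "inv j \<longleftrightarrow> snd (st j) = n + 1 + j \<and> inj_on T {1..n+j} \<and> T ` {1..n+j} \<subseteq> subtrees t - {t} \<and>
     (\<forall>i\<in>{1..n+j}. L j (T i) = Some i) \<and> (\<forall>w\<in>subtrees t. w \<notin> T ` {1..n+j} \<longrightarrow> L j w = None)" for j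
  have inv0: "inv 0"
  proof -
    have "L 0 w = None" if w: "w \<in> subtrees t" "w \<notin> T ` {1..n}" for w
    proof (cases w)
      case (Lf i)
      then have "i \<in> {1..n}" using w(1) s by auto
      then have "T i \<in> T ` {1..n}" "T i = w" using Lf by (auto simp: T_def)
      then show ?thesis using w by simp
    qed (simp add: L_def st_def L0_def)
    moreover have "t \<noteq> Lf i" for i using node by auto
    ultimately show ?thesis unfolding inv_def
      using s by (auto simp: st_def L_def L0_def T_def inj_on_def)
  qed
  have Cne: "C j \<noteq> {}" if "inv j" "j < n - 2" for j
  proof -
    have "card (T ` {1..n+j}) \<le> n + j" using card_image_le[of "{1..n+j}" T] by simp
    moreover have "card (subtrees t - {t}) = 2*n-2" using csub by (simp add: card_Diff_singleton)
    ultimately have "\<not> subtrees t - {t} \<subseteq> T ` {1..n+j}"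
      using card_mono[of "T ` {1..n+j}" "subtrees t - {t}"] that(2) by fastforce
    then have "\<exists>w. w \<in> subtrees t - {t} - T ` {1..n+j}" by blast
    \<comment> \<open>An unlabelled non-root vertex of least size has labelled children, hence is a
      candidate.\<close>
    then obtain w where w: "w \<in> subtrees t - {t} - T ` {1..n+j}"
      and wmin: "\<And>x. x \<in> subtrees t - {t} - T ` {1..n+j} \<Longrightarrow> size w \<le> size x"
      using ex_has_least_nat[of "\<lambda>w. w \<in> subtrees t - {t} - T ` {1..n+j}" _ size] by blast
    obtain a b where ab: "w = Nd a b"
    proof (cases w)
      case (Lf i)
      then have "i \<in> {1..n+j}" "i \<le> n" using w s by auto
      then have "w \<in> T ` {1..n+j}" using Lf by (auto simp: T_def image_iff intro!: bexI[of _ i])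
      then show ?thesis using w by simp
    qed
    have kid: "x \<in> T ` {1..n+j}" if "x \<in> {a, b}" for x
    proof (rule ccontr)
      assume x: "x \<notin> T ` {1..n+j}"
      have "x \<in> subtrees t" using w ab that subtrees_children[of a b t] by auto
      moreover have "size x < size w" using that ab by auto
      moreover have "size w \<le> size t" using w subtrees_size_le by auto
      ultimately show False using wmin[of x] x by (cases "x = t") auto
    qed
    have lab: "L j x \<noteq> None" if "x \<in> T ` {1..n+j}" for x
      using \<open>inv j\<close> that unfolding inv_def by auto
    have "L j a \<noteq> None" "L j b \<noteq> None" using lab kid by blast+
    moreover have "L j w = None" using that(1) w unfolding inv_def by blast
    ultimately have "w \<in> C j" using w ab by (auto simp: C_def chen_cands_def)
    then show ?thesis by blast
  qed
  have step: "st (Suc j) = ((L j)(v j := Some (n + 1 + j)), Suc (n + 1 + j))" if "inv j" "C j \<noteq> {}" for j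
  proof -
    have "st j = (L j, n + 1 + j)" using that(1) by (cases "st j") (simp add: inv_def L_def)
    then have "st (Suc j) = chen_step t (L j, n + 1 + j)" by (simp add: st_def)
    then show ?thesis using that(2) unfolding chen_step_def by (simp add: Let_def C_def[symmetric] v_def)
  qed
  have invS: "inv (Suc j)" if inv: "inv j" and j: "j < n - 2" for j
  proof -
    note st = step[OF inv Cne[OF inv j]]
    have vj: "v j \<in> C j" using vmin[OF Cne[OF inv j]] by blast
    then have v: "v j \<in> subtrees t" "v j \<noteq> t" "L j (v j) = None" by (auto simp: C_def chen_cands_def)
    have Tv: "T (Suc (n + j)) = v j" using j by (auto simp: T_def)
    have LS: "L (Suc j) = (L j)(v j := Some (n + 1 + j))" using st by (simp add: L_def)
    have Lj: "L j (T i) = Some i" if "i \<in> {1..n+j}" for i using inv that unfolding inv_def by blast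
    have vnot: "v j \<notin> T ` {1..n+j}"
    proof
      assume "v j \<in> T ` {1..n+j}"
      then obtain i where "i \<in> {1..n+j}" "v j = T i" by blast
      then show False using v(3) Lj by simp
    qed
    have invj: "inj_on T {1..n+j}" "T ` {1..n+j} \<subseteq> subtrees t - {t}" using inv by (simp_all only: inv_def)
    have ivl: "{1..n + Suc j} = insert (Suc (n + j)) {1..n+j}" by auto
    show ?thesis unfolding inv_def
    proof (intro conjI)
      show "snd (st (Suc j)) = n + 1 + Suc j" using st by simp
      show "inj_on T {1..n + Suc j}" unfolding ivl using invj(1) vnot Tv by simp
      show "T ` {1..n + Suc j} \<subseteq> subtrees t - {t}" unfolding ivl using invj(2) v Tv by simp
      show "\<forall>i\<in>{1..n + Suc j}. L (Suc j) (T i) = Some i"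
      proof
        fix i assume "i \<in> {1..n + Suc j}"
        then have "i = Suc (n + j) \<or> i \<in> {1..n+j}" unfolding ivl by blast
        moreover have "T i \<noteq> v j" if "i \<in> {1..n+j}" using vnot that by (metis image_eqI)
        ultimately show "L (Suc j) (T i) = Some i" using Lj Tv LS by auto
      qed
      show "\<forall>w\<in>subtrees t. w \<notin> T ` {1..n + Suc j} \<longrightarrow> L (Suc j) w = None"
      proof (intro ballI impI)
        fix w assume w: "w \<in> subtrees t" "w \<notin> T ` {1..n + Suc j}"
        then have w': "w \<noteq> v j" "w \<notin> T ` {1..n+j}" using Tv unfolding ivl image_insert by simp_all
        moreover have "L j w = None" using inv w(1) w'(2) unfolding inv_def by blast
        ultimately show "L (Suc j) w = None" using LS by simp
      qed
    qed
  qed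
  have inv: "inv j" if "j \<le> n - 2" for j
    using that
  proof (induction j)
    case 0
    then show ?case using inv0 by blast
  next
    case (Suc j)
    then show ?case using invS[of j] by simp
  qed
  have nn: "n + (n - 2) = 2*n-2" using n by simp
  have "inv (n - 2)" using inv by simp
  then have fin: "inj_on T {1..2*n-2}" "T ` {1..2*n-2} \<subseteq> subtrees t - {t}"
    "\<And>i. i \<in> {1..2*n-2} \<Longrightarrow> L (n - 2) (T i) = Some i"
    unfolding inv_def nn by blast+
  have labels: "chen_labels t (T i) = Some i" if "i \<in> {1..2*n-2}" for i
    using fin(3)[OF that] unfolding chen_labels_def nl L_def st_def L0_def .
  have img: "T ` {1..2*n-2} = subtrees t - {t}"
  proof (rule card_subset_eq)
    have "card (T ` {1..2*n-2}) = 2*n-2" using fin(1) by (simp add: card_image)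
    then show "card (T ` {1..2*n-2}) = card (subtrees t - {t})" using csub by (simp add: card_Diff_singleton)
  qed (use fin(2) in auto)
  have Tt: "T (2*n-1) = t" using n by (auto simp: T_def)
  have ivl: "{1..2*n-1} = insert (2*n-1) {1..2*n-2}" using n by auto
  have "T (2*n-1) \<notin> T ` ({1..2*n-2} - {2*n-1})" using img Tt by blast
  then have bij: "inj_on T {1..2*n-1}" "T ` {1..2*n-1} = subtrees t"
    using fin(1) unfolding ivl image_insert inj_on_insert img Tt by (simp_all add: insert_absorb)
  have Tcand: "T m \<in> C (m - n - 1) \<and> (\<forall>w\<in>C (m - n - 1). chen_key (L (m - n - 1)) (T m) \<le> chen_key (L (m - n - 1)) w)"
    "inv (m - n - 1)"
    if m: "m \<in> {n+1..2*n-2}" for m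
  proof -
    have j: "m - n - 1 < n - 2" using m by auto
    have "T m = v (m - n - 1)" using m by (auto simp: T_def)
    then show "T m \<in> C (m - n - 1) \<and> (\<forall>w\<in>C (m - n - 1). chen_key (L (m - n - 1)) (T m) \<le> chen_key (L (m - n - 1)) w)"
      using vmin[OF Cne[OF inv[OF less_imp_le[OF j]] j]] by simp
    show "inv (m - n - 1)" using inv j by simp
  qed
  have ex: "\<exists>a\<in>{1..<m}. \<exists>b\<in>{1..<m}. T m = Nd (T a) (T b)" if m: "m \<in> {n+1..2*n-1}" for m
  proof (cases "m = 2*n-1")
    case True
    obtain a b where ab: "t = Nd a b" using node by (auto simp: is_node_def)
    then have "a \<in> subtrees t - {t}" "b \<in> subtrees t - {t}"
      using kids_size[of a t] kids_size[of b t] by auto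
    then have "a \<in> T ` {1..2*n-2}" "b \<in> T ` {1..2*n-2}" using img by blast+
    then obtain i k where "i \<in> {1..2*n-2}" "k \<in> {1..2*n-2}" "a = T i" "b = T k" by blast
    then show ?thesis using True Tt ab n by (intro bexI[of _ i] bexI[of _ k]) auto
  next
    case False
    then have m: "m \<in> {n+1..2*n-2}" using m by auto
    define j where "j = m - n - 1"
    have nj: "{1..n+j} = {1..<m}" using m by (auto simp: j_def)
    obtain a b where ab: "T m = Nd a b" "L j a \<noteq> None" "L j b \<noteq> None" "T m \<in> subtrees t"
      using Tcand(1)[OF m] by (auto simp: j_def C_def chen_cands_def split: btree.splits)
    have "inv j" using Tcand(2)[OF m] by (simp add: j_def)
    then have none: "\<forall>w\<in>subtrees t. w \<notin> T ` {1..<m} \<longrightarrow> L j w = None"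
      unfolding inv_def nj by (elim conjE)
    have inT: "x \<in> T ` {1..<m}" if "x \<in> subtrees t" "L j x \<noteq> None" for x
      using none[rule_format, OF that(1)] that(2) by (rule contrapos_np[rotated])
    have "Nd a b \<in> subtrees t" using ab(1,4) by simp
    then have "a \<in> subtrees t" "b \<in> subtrees t" by (rule subtrees_children)+
    then have "a \<in> T ` {1..<m}" "b \<in> T ` {1..<m}" using inT[OF _ ab(2)] inT[OF _ ab(3)] by simp_all
    then obtain i k where "i \<in> {1..<m}" "a = T i" "k \<in> {1..<m}" "b = T k" by (elim imageE)
    then show ?thesis using ab(1) by (intro bexI[of _ i] bexI[of _ k]) simp_all
  qed
  have inj: "i = k" if "T i = T k" "i \<in> {1..2*n-1}" "k \<in> {1..2*n-1}" for i k
    using inj_onD[OF bij(1) that] .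
  have lt: "c < m" if "m \<in> {n+1..2*n-1}" "c \<in> {1..2*n-1}" "T c \<in> kids (T m)" for m c
  proof -
    note mr = that(1)
    obtain a b where ab: "a \<in> {1..<m}" "b \<in> {1..<m}" "T m = Nd (T a) (T b)" using ex[OF mr] by (elim bexE)
    then have "T c = T a \<or> T c = T b" using that(3) by simp
    moreover have "a \<in> {1..2*n-1}" "b \<in> {1..2*n-1}" using ab(1,2) that(1) by auto
    ultimately have "c = a \<or> c = b" using inj[OF _ that(2)] by metis
    then show ?thesis using ab(1,2) by auto
  qed
  \<comment> \<open>The parent of the vertex numbered \<open>2*n-2\<close> has a larger number, and
    only the root has one.\<close>
  have root_kid: "T (2*n-2) \<in> kids t"
  proof -
    have "2*n-2 \<in> {1..2*n-2}" using n by simp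
    then have "T (2*n-2) \<in> subtrees t - {t}" unfolding img[symmetric] by (rule imageI)
    then obtain x where x: "x \<in> subtrees t" "T (2*n-2) \<in> kids x" using parent_exists by (metis DiffE singletonI)
    from x(1) obtain m where m: "m \<in> {1..2*n-1}" "T m = x" unfolding bij(2)[symmetric] by (elim imageE) simp
    have "\<not> m \<le> n"
    proof
      assume "m \<le> n"
      then have "x = Lf m" using m(2) by (simp add: T_def)
      then show False using x(2) by simp
    qed
    then have "m \<in> {n+1..2*n-1}" "2*n-2 \<in> {1..2*n-1}" using m(1) n by auto
    then have "2*n-2 < m" using lt[of m "2*n-2"] x(2) m(2) by simp
    then have "m = 2*n-1" using m(1) by auto
    then show ?thesis using x m Tt by simp
  qed
  have greedy: "min a b \<le> min c d"
    if m: "m \<in> {n+1..2*n-1}" "m' \<in> {m..2*n-1}" "a \<in> {1..<m}" "b \<in> {1..<m}" "c \<in> {1..<m}" "d \<in> {1..<m}"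
      "T m = Nd (T a) (T b)" "T m' = Nd (T c) (T d)" for m m' a b c d
  proof (cases "m' = 2*n-1")
    \<comment> \<open>One child of the root is numbered \<open>2*n-2\<close>; if both are numbered
      below \<open>m\<close>, then \<open>m = 2*n-1\<close> and the two vertices compared are the
      same.\<close>
    case True
    have r: "a \<in> {1..2*n-1}" "b \<in> {1..2*n-1}" "c \<in> {1..2*n-1}" "d \<in> {1..2*n-1}" "2*n-2 \<in> {1..2*n-1}"
      using m(1-6) n by auto
    have "T (2*n-2) = T c \<or> T (2*n-2) = T d" using root_kid Tt True m(8) by simp
    then have "2*n-2 = c \<or> 2*n-2 = d" using inj r by metis
    then have "m = 2*n-1" using m(1,5,6) by auto
    then have "T a = T c \<and> T b = T d" using True m(7,8) by simp
    then have "a = c \<and> b = d" using inj r by metis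
    then show ?thesis by simp
  next
    case False
    then have m2: "m \<in> {n+1..2*n-2}" "m' \<in> {m..2*n-2}" using m by auto
    define j where "j = m - n - 1"
    have nj: "{1..n+j} = {1..<m}" using m by (auto simp: j_def)
    have i: "inv j" using Tcand(2)[OF m2(1)] by (simp add: j_def)
    have L: "L j (T i) = Some i" if "i \<in> {1..<m}" for i using i that unfolding inv_def nj by blast
    have "m' \<in> {1..2*n-2}" using m2 by auto
    then have m'T: "T m' \<in> subtrees t - {t}" unfolding img[symmetric] by (rule imageI)
    have sub: "m' \<in> {1..2*n-1}" "{1..<m} \<subseteq> {1..2*n-1}" "m' \<notin> {1..<m}" using m2 by auto
    have "T m' \<notin> T ` {1..<m}"
      using inj_on_image_mem_iff[OF bij(1) sub(1,2)] sub(3) by simp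
    moreover have "\<forall>w\<in>subtrees t. w \<notin> T ` {1..<m} \<longrightarrow> L j w = None"
      using i unfolding inv_def nj by (elim conjE)
    ultimately have "L j (T m') = None" using m'T by simp
    \<comment> \<open>\<open>T m'\<close> is still unlabelled while its children are labelled, so it
      competed with \<open>T m\<close> at this step.\<close>
    then have "T m' \<in> C j" using m'T m(8) L[OF m(5)] L[OF m(6)] by (simp add: C_def chen_cands_def)
    then have "chen_key (L j) (T m) \<le> chen_key (L j) (T m')" using Tcand(1)[OF m2(1)] by (simp add: j_def)
    then show ?thesis
      using L[OF m(3)] L[OF m(4)] L[OF m(5)] L[OF m(6)] unfolding m(7,8) by (simp add: chen_key_def)
  qed
  have "chen_enum t n T" unfolding chen_enum_def bij_betw_def
  proof (intro conjI)
    show "\<forall>i\<in>{1..n}. T i = Lf i" by (simp add: T_def)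
    show "\<forall>m\<in>{n+1..2*n-1}. \<exists>a\<in>{1..<m}. \<exists>b\<in>{1..<m}. T m = Nd (T a) (T b)" by (intro ballI ex)
    show "\<forall>m\<in>{n+1..2*n-1}. \<forall>m'\<in>{m..2*n-1}. \<forall>a\<in>{1..<m}. \<forall>b\<in>{1..<m}. \<forall>c\<in>{1..<m}. \<forall>d\<in>{1..<m}.
        T m = Nd (T a) (T b) \<longrightarrow> T m' = Nd (T c) (T d) \<longrightarrow> min a b \<le> min c d"
      by (intro ballI impI) (rule greedy)
  qed (use bij Tt in \<open>simp_all only:\<close>)
  then show thesis using that labels by blast
qed

section \<open>The tree of a matching\<close>

text \<open>Fixing the points outside \<open>{1..m}\<close> makes equality of matchings equality of
  functions.\<close>

definition matching_on :: "nat \<Rightarrow> (nat \<Rightarrow> nat) \<Rightarrow> bool" where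
  "matching_on m \<pi> \<longleftrightarrow> (\<forall>i. i \<notin> {1..m} \<longrightarrow> \<pi> i = i) \<and> (\<forall>i\<in>{1..m}. \<pi> i \<noteq> i \<and> \<pi> (\<pi> i) = i)"

lemma matching_onD:
  assumes "matching_on m \<pi>"
  shows "\<And>i. i \<notin> {1..m} \<Longrightarrow> \<pi> i = i" "\<And>i. i \<in> {1..m} \<Longrightarrow> \<pi> i \<noteq> i" "\<And>i. \<pi> (\<pi> i) = i"
    "\<And>i. i \<in> {1..m} \<Longrightarrow> \<pi> i \<in> {1..m}" "inj \<pi>"
proof -
  show 1: "\<And>i. i \<notin> {1..m} \<Longrightarrow> \<pi> i = i" and "\<And>i. i \<in> {1..m} \<Longrightarrow> \<pi> i \<noteq> i"
    using assms by (simp_all add: matching_on_def)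
  show 2: "\<pi> (\<pi> i) = i" for i using assms by (cases "i \<in> {1..m}") (simp_all add: matching_on_def)
  show "\<pi> i \<in> {1..m}" if "i \<in> {1..m}" for i
    using 1[of "\<pi> i"] 2[of i] assms that by (metis matching_on_def)
  show "inj \<pi>" using 2 by (metis injI)
qed

definition used :: "(nat \<Rightarrow> nat) \<Rightarrow> (nat \<Rightarrow> nat) \<Rightarrow> nat \<Rightarrow> nat \<Rightarrow> nat set" where
  "used K \<pi> n m = (\<Union>k\<in>{n+1..<m}. {K k, \<pi> (K k)})"

text \<open>\<open>K m\<close> is the smaller label of the pair taken by vertex \<open>m\<close>:
  minimality ranges over both labels of every available pair. The bound \<open>M\<close> allows the
  keys to be found one vertex at a time.\<close>

definition greedy_keys :: "(nat \<Rightarrow> nat) \<Rightarrow> nat \<Rightarrow> (nat \<Rightarrow> nat) \<Rightarrow> nat \<Rightarrow> bool" where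
  "greedy_keys \<pi> n K M \<longleftrightarrow> (\<forall>m\<in>{n+1..M}. K m \<in> {1..<m} \<and> \<pi> (K m) \<in> {1..<m} \<and> K m \<notin> used K \<pi> n m \<and>
     (\<forall>x\<in>{1..<m}. \<pi> x \<in> {1..<m} \<longrightarrow> x \<notin> used K \<pi> n m \<longrightarrow> K m \<le> x))"

lemma greedy_keysD:
  assumes "greedy_keys \<pi> n K M" "m \<in> {n+1..M}"
  shows "K m \<in> {1..<m}" "\<pi> (K m) \<in> {1..<m}" "K m \<notin> used K \<pi> n m"
    "\<And>x. x \<in> {1..<m} \<Longrightarrow> \<pi> x \<in> {1..<m} \<Longrightarrow> x \<notin> used K \<pi> n m \<Longrightarrow> K m \<le> x"
proof -
  note * = bspec[OF assms(1)[unfolded greedy_keys_def] assms(2)]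
  show "K m \<in> {1..<m}" "\<pi> (K m) \<in> {1..<m}" "K m \<notin> used K \<pi> n m" using * by simp_all
  fix x assume "x \<in> {1..<m}" "\<pi> x \<in> {1..<m}" "x \<notin> used K \<pi> n m"
  then show "K m \<le> x" using *[THEN conjunct2, THEN conjunct2, THEN conjunct2] by simp
qed

lemma used_Suc: "n + 1 \<le> m \<Longrightarrow> used K \<pi> n (Suc m) = used K \<pi> n m \<union> {K m, \<pi> (K m)}"
  by (auto simp: used_def less_Suc_eq)

lemma used_base [simp]: "m \<le> n + 1 \<Longrightarrow> used K \<pi> n m = {}"
  by (auto simp: used_def)

lemma used_closed:
  assumes "matching_on N \<pi>" shows "\<pi> x \<in> used K \<pi> n m \<longleftrightarrow> x \<in> used K \<pi> n m"
proof -
  have "\<pi> y \<in> used K \<pi> n m" if "y \<in> used K \<pi> n m" for y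
    using that matching_onD(3)[OF assms] by (auto simp: used_def)
  then show ?thesis using matching_onD(3)[OF assms] by metis
qed

lemma used_mono: "m \<le> m' \<Longrightarrow> used K \<pi> n m \<subseteq> used K \<pi> n m'"
  unfolding used_def by (rule UN_mono) auto

lemma finite_used [simp]: "finite (used K \<pi> n m)"
  by (simp add: used_def)

text \<open>Each vertex uses up two new labels, because \<open>used\<close> is closed under
  \<open>\<pi>\<close> and \<open>\<pi>\<close> moves every label.\<close>

lemma used_card:
  assumes \<pi>: "matching_on (2*n-2) \<pi>" and K: "greedy_keys \<pi> n K M" and M: "M \<le> 2*n-1"
  shows "m \<le> Suc M \<Longrightarrow> used K \<pi> n m \<subseteq> {1..<m} \<and> card (used K \<pi> n m) = 2 * (m - n - 1)"
proof (induction m)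
  case (Suc m)
  show ?case
  proof (cases "n + 1 \<le> m")
    case True
    then have m: "m \<in> {n+1..M}" using Suc.prems by auto
    note k = greedy_keysD[OF K m]
    have "K m \<in> {1..2*n-2}" using k(1) m M by auto
    then have "\<pi> (K m) \<noteq> K m" using matching_onD(2)[OF \<pi>] by blast
    moreover have "\<pi> (K m) \<notin> used K \<pi> n m" using k(3) used_closed[OF \<pi>] by blast
    ultimately have "card (used K \<pi> n (Suc m)) = card (used K \<pi> n m) + 2"
      using k(3) unfolding used_Suc[OF True] by simp
    then show ?thesis using Suc True k unfolding used_Suc[OF True] by auto
  qed simp
qed simp

text \<open>Pigeonhole: before step \<open>m\<close> there are \<open>2n + 1 - m\<close> unused labels below \<open>m\<close>, but only
  \<open>2n - 1 - m\<close> labels from \<open>m\<close> on that could be their partners.\<close>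

lemma greedy_keys_exist:
  assumes \<pi>: "matching_on (2*n-2) \<pi>" and n: "2 \<le> n"
  shows "M \<le> 2*n-1 \<Longrightarrow> \<exists>K. greedy_keys \<pi> n K M"
proof (induction M)
  case 0
  then show ?case by (simp add: greedy_keys_def)
next
  case (Suc M)
  then obtain K where K: "greedy_keys \<pi> n K M" by auto
  show ?case
  proof (cases "n \<le> M")
    case False
    then show ?thesis by (simp add: greedy_keys_def)
  next
    case True
    define m where "m = Suc M"
    have m: "n + 1 \<le> m" "m \<le> 2*n-1" using True Suc.prems by (auto simp: m_def)
    define A where "A = {1..<m} - used K \<pi> n m"
    have u: "used K \<pi> n m \<subseteq> {1..<m}" "card (used K \<pi> n m) = 2 * (m - n - 1)"
      using used_card[OF \<pi> K, of m] Suc.prems by (auto simp: m_def)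
    have "card A = (m - 1) - 2 * (m - n - 1)" unfolding A_def using u by (simp add: card_Diff_subset)
    then have cA: "card A = 2*n + 1 - m" using m by linarith
    have "\<exists>x\<in>A. \<pi> x \<in> {1..<m}"
    proof (rule ccontr)
      assume "\<not> ?thesis"
      then have no: "\<pi> x \<notin> {1..<m}" if "x \<in> A" for x using that by blast
      have "\<pi> x \<in> {m..2*n-2}" if "x \<in> A" for x
      proof -
        have "x \<in> {1..2*n-2}" using that m by (auto simp: A_def)
        then show ?thesis using matching_onD(4)[OF \<pi>] no[OF that] by fastforce
      qed
      then have "\<pi> ` A \<subseteq> {m..2*n-2}" by blast
      then have "card (\<pi> ` A) \<le> card {m..2*n-2}" by (rule card_mono[rotated]) simp
      moreover have "card (\<pi> ` A) = card A"
        using matching_onD(5)[OF \<pi>] by (simp add: card_image inj_on_subset)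
      ultimately show False using cA m by simp
    qed
    then have ex: "\<exists>x. x \<in> A \<and> \<pi> x \<in> {1..<m}" by blast
    define y where "y = (LEAST x. x \<in> A \<and> \<pi> x \<in> {1..<m})"
    have y: "y \<in> A" "\<pi> y \<in> {1..<m}" using LeastI_ex[OF ex] by (auto simp: y_def)
    have yle: "y \<le> x" if "x \<in> A" "\<pi> x \<in> {1..<m}" for x
      unfolding y_def using Least_le[of "\<lambda>x. x \<in> A \<and> \<pi> x \<in> {1..<m}" x] that by blast
    \<comment> \<open>The labels used before \<open>m\<close> do not see the new value of
      \<open>K\<close> at \<open>m\<close>.\<close>
    have us: "used (K(m := y)) \<pi> n k = used K \<pi> n k" if "k \<le> m" for k
      using that by (auto simp: used_def)
    have "greedy_keys \<pi> n (K(m := y)) (Suc M)" unfolding greedy_keys_def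
    proof
      fix k assume k: "k \<in> {n+1..Suc M}"
      then have km: "k \<le> m" by (simp add: m_def)
      show "(K(m := y)) k \<in> {1..<k} \<and> \<pi> ((K(m := y)) k) \<in> {1..<k} \<and> (K(m := y)) k \<notin> used (K(m := y)) \<pi> n k \<and>
        (\<forall>x\<in>{1..<k}. \<pi> x \<in> {1..<k} \<longrightarrow> x \<notin> used (K(m := y)) \<pi> n k \<longrightarrow> (K(m := y)) k \<le> x)"
        unfolding us[OF km]
      proof (cases "k = m")
        case True
        then show "(K(m := y)) k \<in> {1..<k} \<and> \<pi> ((K(m := y)) k) \<in> {1..<k} \<and> (K(m := y)) k \<notin> used K \<pi> n k \<and>
        (\<forall>x\<in>{1..<k}. \<pi> x \<in> {1..<k} \<longrightarrow> x \<notin> used K \<pi> n k \<longrightarrow> (K(m := y)) k \<le> x)"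
          using y yle by (simp add: A_def)
      next
        case False
        then have "k \<in> {n+1..M}" using k by (auto simp: m_def)
        then show "(K(m := y)) k \<in> {1..<k} \<and> \<pi> ((K(m := y)) k) \<in> {1..<k} \<and> (K(m := y)) k \<notin> used K \<pi> n k \<and>
        (\<forall>x\<in>{1..<k}. \<pi> x \<in> {1..<k} \<longrightarrow> x \<notin> used K \<pi> n k \<longrightarrow> (K(m := y)) k \<le> x)"
          using K False by (simp add: greedy_keys_def)
      qed
    qed
    then show ?thesis by blast
  qed
qed

section \<open>The forest grown from a matching\<close>

definition join :: "btree \<Rightarrow> btree \<Rightarrow> btree" where
  "join a b = (if minleaf a < minleaf b then Nd a b else Nd b a)"

lemma join_simps:
  "kids (join a b) = {a, b}" "subtrees (join a b) = insert (join a b) (subtrees a \<union> subtrees b)"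
  "set (leaves (join a b)) = set (leaves a) \<union> set (leaves b)"
  by (auto simp: join_def)

lemma join_cases: "join a b = Nd a b \<or> join a b = Nd b a"
  by (simp add: join_def)

lemma join_valid:
  assumes "set (leaves a) \<inter> set (leaves b) = {}"
    "distinct (leaves a)" "distinct (leaves b)" "canonical a" "canonical b"
  shows "distinct (leaves (join a b))" "canonical (join a b)"
proof -
  show "distinct (leaves (join a b))" using assms(1-3) by (auto simp: join_def)
  show "canonical (join a b)" using assms(4,5) minleaf_neq[OF assms(1)] by (simp add: join_def)
qed

text \<open>Vertex \<open>m\<close> becomes the parent of the pair it takes. The tests
  \<open>m \<le> K m\<close> and \<open>m \<le> \<pi> (K m)\<close> make the recursion terminate for
  arbitrary \<open>K\<close>; greedy pairs lie below \<open>m\<close>.\<close>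

function key_tree :: "(nat \<Rightarrow> nat) \<Rightarrow> (nat \<Rightarrow> nat) \<Rightarrow> nat \<Rightarrow> nat \<Rightarrow> btree" where
  "key_tree K \<pi> n m = (if m \<le> n \<or> m \<le> K m \<or> m \<le> \<pi> (K m) then Lf m
     else join (key_tree K \<pi> n (K m)) (key_tree K \<pi> n (\<pi> (K m))))"
  by auto
termination by (relation "measure (\<lambda>(_, _, _, m). m)") auto

declare key_tree.simps [simp del]

lemma chen_enum_surj:
  assumes \<pi>: "matching_on (2*n-2) \<pi>" and n: "2 \<le> n"
  obtains t T where "canonical t" "distinct (leaves t)" "set (leaves t) = {1..n}" "chen_enum t n T"
    "\<And>i. i \<in> {1..2*n-2} \<Longrightarrow> siblings t (T i) (T (\<pi> i))"
proof -
  obtain K where K: "greedy_keys \<pi> n K (2*n-1)" using greedy_keys_exist[OF \<pi> n] by blast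
  define F where "F = key_tree K \<pi> n"
  define U where "U = used K \<pi> n"
  note k = greedy_keysD[OF K, folded U_def]
  have FL: "F i = Lf i" if "i \<le> n" for i unfolding F_def using that by (simp add: key_tree.simps)
  have FN: "F m = join (F (K m)) (F (\<pi> (K m)))" if "m \<in> {n+1..2*n-1}" for m
  proof -
    have "\<not> (m \<le> n \<or> m \<le> K m \<or> m \<le> \<pi> (K m))" using k(1,2)[OF that] that by auto
    then show ?thesis unfolding F_def by (subst key_tree.simps) simp
  qed
  have usub: "U m \<subseteq> {1..<m}" "card (U m) = 2 * (m - n - 1)" if "m \<le> 2*n" for m
    using used_card[OF \<pi> K, of m] that by (auto simp: U_def)
  have Uclosed: "\<pi> x \<in> U m \<longleftrightarrow> x \<in> U m" for x m using used_closed[OF \<pi>] by (simp add: U_def)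
  have Kne: "\<pi> (K m) \<noteq> K m" if "m \<in> {n+1..2*n-1}" for m
  proof -
    have "K m \<in> {1..2*n-2}" using k(1)[OF that] that by auto
    then show ?thesis using matching_onD(2)[OF \<pi>] by blast
  qed
  define R where "R m = {1..<m} - U m" for m
  define forest where "forest m \<longleftrightarrow> (\<forall>r\<in>R m. distinct (leaves (F r)) \<and> canonical (F r)) \<and>
    (\<forall>r\<in>R m. \<forall>r'\<in>R m. r \<noteq> r' \<longrightarrow> set (leaves (F r)) \<inter> set (leaves (F r')) = {}) \<and>
    (\<Union>r\<in>R m. set (leaves (F r))) = {1..n} \<and> (\<Union>r\<in>R m. subtrees (F r)) = F ` {1..<m}" for m
  have forest0: "forest (Suc n)"
  proof -
    have "R (Suc n) = {1..n}" by (auto simp: R_def U_def)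
    moreover have "{1..<Suc n} = {1..n}" by auto
    moreover have "F i = Lf i" if "i \<in> {1..n}" for i using FL that by simp
    ultimately show ?thesis unfolding forest_def by auto
  qed
  have forestS: "forest (Suc m)" if f: "forest m" and m: "m \<in> {n+1..2*n-1}" for m
  proof -
    define a b where "a = K m" and "b = \<pi> (K m)"
    have Fm: "F m = join (F a) (F b)" using FN[OF m] by (simp add: a_def b_def)
    have ab: "a \<in> R m" "b \<in> R m" "a \<noteq> b"
      using k(1-3)[OF m] Uclosed Kne[OF m] by (auto simp: R_def a_def b_def)
    have Um: "U (Suc m) = U m \<union> {a, b}" using used_Suc[of n m K \<pi>] m by (simp add: U_def a_def b_def)
    have "m \<le> 2*n" using m by auto
    then have mU: "m \<notin> U m" using usub(1)[of m] by auto
    have abm: "a \<noteq> m" "b \<noteq> m" using ab by (auto simp: R_def)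
    have RS: "R (Suc m) = insert m (R m - {a, b})"
      unfolding R_def Um using mU abm m by auto
    have Rm: "R m = insert a (insert b (R m - {a, b}))" using ab by auto
    have f1: "distinct (leaves (F r))" "canonical (F r)" if "r \<in> R m" for r using f that by (simp_all add: forest_def)
    have f2: "set (leaves (F r)) \<inter> set (leaves (F r')) = {}" if "r \<in> R m" "r' \<in> R m" "r \<noteq> r'" for r r'
      using f that by (simp add: forest_def)
    have f3: "(\<Union>r\<in>R m. set (leaves (F r))) = {1..n}" and f4: "(\<Union>r\<in>R m. subtrees (F r)) = F ` {1..<m}"
      using f by (simp_all add: forest_def)
    note jv = join_valid[OF f2[OF ab] f1(1)[OF ab(1)] f1(1)[OF ab(2)] f1(2)[OF ab(1)] f1(2)[OF ab(2)]]
    have disjm: "set (leaves (F m)) \<inter> set (leaves (F r)) = {}" if "r \<in> R m - {a, b}" for r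
      unfolding Fm join_simps using f2[of a r] f2[of b r] ab that by auto
    show ?thesis unfolding forest_def
    proof (intro conjI)
      show "\<forall>r\<in>R (Suc m). distinct (leaves (F r)) \<and> canonical (F r)"
        unfolding RS using f1 jv Fm by auto
      show "\<forall>r\<in>R (Suc m). \<forall>r'\<in>R (Suc m). r \<noteq> r' \<longrightarrow> set (leaves (F r)) \<inter> set (leaves (F r')) = {}"
      proof (intro ballI impI)
        fix r r' assume r: "r \<in> R (Suc m)" "r' \<in> R (Suc m)" "r \<noteq> r'"
        then consider "r = m" "r' \<in> R m - {a, b}" | "r' = m" "r \<in> R m - {a, b}" | "r \<in> R m" "r' \<in> R m"
          unfolding RS by blast
        then show "set (leaves (F r)) \<inter> set (leaves (F r')) = {}"
        proof cases
          case 1 then show ?thesis using disjm by simp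
        next
          case 2 then show ?thesis using disjm[of r] by (simp add: Int_commute)
        next
          case 3 then show ?thesis using f2 r(3) by simp
        qed
      qed
      have "(\<Union>r\<in>R (Suc m). set (leaves (F r))) =
        set (leaves (F a)) \<union> set (leaves (F b)) \<union> (\<Union>r\<in>R m - {a, b}. set (leaves (F r)))"
        unfolding RS by (simp add: Fm join_simps)
      also have "\<dots> = (\<Union>r\<in>R m. set (leaves (F r)))" by (subst (2) Rm) auto
      finally show "(\<Union>r\<in>R (Suc m). set (leaves (F r))) = {1..n}" using f3 by simp
      have "(\<Union>r\<in>R (Suc m). subtrees (F r)) =
        insert (F m) (subtrees (F a) \<union> subtrees (F b) \<union> (\<Union>r\<in>R m - {a, b}. subtrees (F r)))"
        unfolding RS using join_simps(2)[of "F a" "F b"] Fm by simp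
      also have "subtrees (F a) \<union> subtrees (F b) \<union> (\<Union>r\<in>R m - {a, b}. subtrees (F r)) = (\<Union>r\<in>R m. subtrees (F r))"
        by (subst (2) Rm) auto
      also have "insert (F m) \<dots> = F ` {1..<Suc m}"
        unfolding f4 using m by (simp add: atLeastLessThanSuc)
      finally show "(\<Union>r\<in>R (Suc m). subtrees (F r)) = F ` {1..<Suc m}" .
    qed
  qed
  have forest: "forest (Suc (n + j))" if "j \<le> n - 1" for j
    using that
  proof (induction j)
    case 0
    then show ?case using forest0 by simp
  next
    case (Suc j)
    then show ?case using forestS[of "Suc (n + j)"] by simp
  qed
  have e: "Suc (n + (n - 1)) = 2*n" using n by simp
  have f: "forest (2*n)" using forest[of "n - 1"] unfolding e by simp
  \<comment> \<open>The \<open>n - 1\<close> internal vertices use up two labels each, hence all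
    \<open>2*n-2\<close>.\<close>
  have U: "U (2*n) = {1..2*n-2}"
  proof (rule card_subset_eq)
    show "U (2*n) \<subseteq> {1..2*n-2}"
    proof
      fix x assume "x \<in> U (2*n)"
      then obtain m where m: "m \<in> {n+1..<2*n}" "x = K m \<or> x = \<pi> (K m)" by (auto simp: U_def used_def)
      then have "m \<in> {n+1..2*n-1}" by auto
      then show "x \<in> {1..2*n-2}" using k(1,2)[of m] m by auto
    qed
    show "card (U (2*n)) = card {1..2*n-2}" using usub(2)[of "2*n"] by simp
  qed simp
  define t where "t = F (2*n-1)"
  have R: "R (2*n) = {2*n-1}" unfolding R_def U using n by auto
  have ivl: "{1..<2*n} = {1..2*n-1}" using n by auto
  have t: "distinct (leaves t)" "canonical t" "set (leaves t) = {1..n}" and img: "subtrees t = F ` {1..2*n-1}"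
    using f unfolding forest_def R ivl t_def by simp_all
  have "length (leaves t) = n" using distinct_card[OF t(1)] t(3) by simp
  \<comment> \<open>As many numbers as vertices: an enumeration that reaches them all is
    injective.\<close>
  then have "card (F ` {1..2*n-1}) = card {1..2*n-1}" using card_subtrees[OF t(1)] img by simp
  then have injF: "inj_on F {1..2*n-1}" by (rule eq_card_imp_inj_on[rotated]) simp
  have inj: "i = j" if "F i = F j" "i \<in> {1..2*n-1}" "j \<in> {1..2*n-1}" for i j using inj_onD[OF injF that] .
  have kids: "{a, b} = {K m, \<pi> (K m)}"
    if m: "m \<in> {n+1..2*n-1}" and ab: "F m = Nd (F a) (F b)" "a \<in> {1..2*n-1}" "b \<in> {1..2*n-1}" for m a b
  proof -
    have "kids (F m) = {F (K m), F (\<pi> (K m))}" unfolding FN[OF m] join_simps ..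
    then have "F ` {a, b} = F ` {K m, \<pi> (K m)}" using ab(1) by simp
    moreover have "K m \<in> {1..2*n-1}" "\<pi> (K m) \<in> {1..2*n-1}" using k(1,2)[OF m] m by auto
    ultimately show ?thesis using ab(2,3) inj_on_image_eq_iff[OF injF, of "{a, b}" "{K m, \<pi> (K m)}"] by simp
  qed
  have enum: "chen_enum t n F" unfolding chen_enum_def bij_betw_def
  proof (intro conjI)
    show "\<forall>i\<in>{1..n}. F i = Lf i" using FL by simp
    show "inj_on F {1..2*n-1}" by (rule injF)
    show "F ` {1..2*n-1} = subtrees t" using img by simp
    show "F (2*n-1) = t" by (simp add: t_def)
    show "\<forall>m\<in>{n+1..2*n-1}. \<exists>a\<in>{1..<m}. \<exists>b\<in>{1..<m}. F m = Nd (F a) (F b)"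
    proof
      fix m assume m: "m \<in> {n+1..2*n-1}"
      show "\<exists>a\<in>{1..<m}. \<exists>b\<in>{1..<m}. F m = Nd (F a) (F b)"
        using FN[OF m] join_cases[of "F (K m)" "F (\<pi> (K m))"] k(1,2)[OF m] by metis
    qed
    show "\<forall>m\<in>{n+1..2*n-1}. \<forall>m'\<in>{m..2*n-1}. \<forall>a\<in>{1..<m}. \<forall>b\<in>{1..<m}. \<forall>c\<in>{1..<m}. \<forall>d\<in>{1..<m}.
        F m = Nd (F a) (F b) \<longrightarrow> F m' = Nd (F c) (F d) \<longrightarrow> min a b \<le> min c d"
    proof (intro ballI impI)
      fix m m' a b c d
      assume m: "m \<in> {n+1..2*n-1}" "m' \<in> {m..2*n-1}"
        and abcd: "a \<in> {1..<m}" "b \<in> {1..<m}" "c \<in> {1..<m}" "d \<in> {1..<m}"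
        and F: "F m = Nd (F a) (F b)" "F m' = Nd (F c) (F d)"
      have m': "m' \<in> {n+1..2*n-1}" using m by auto
      have big: "i \<in> {1..2*n-1}" if "i \<in> {1..<m}" for i using that m by auto
      have ab: "{a, b} = {K m, \<pi> (K m)}" using kids[OF m(1) F(1)] big abcd by simp
      have cd: "{c, d} = {K m', \<pi> (K m')}" using kids[OF m' F(2)] big abcd by simp
      define x where "x = min c d"
      have x: "x \<in> {c, d}" by (simp add: x_def min_def)
      then have "\<pi> x \<in> {c, d}" using cd matching_onD(3)[OF \<pi>, of "K m'"] by auto
      then have xm: "x \<in> {1..<m}" "\<pi> x \<in> {1..<m}" using x abcd(3,4) by (metis insertE singletonD)+
      have "x \<notin> U m'" using x k(3)[OF m'] Uclosed cd by auto
      then have "x \<notin> U m" using used_mono[of m m' K \<pi> n] m(2) by (auto simp: U_def)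
      then have "K m \<le> x" using k(4)[OF m(1) xm] by simp
      moreover have "min a b \<le> K m" using ab by (metis insertCI insertE min.cobounded1 min.cobounded2 singletonD)
      ultimately show "min a b \<le> min c d" by (simp add: x_def)
    qed
  qed
  have sib: "siblings t (F i) (F (\<pi> i))" if i: "i \<in> {1..2*n-2}" for i
  proof -
    have "i \<in> U (2*n)" using i U by simp
    then obtain m where m: "m \<in> {n+1..<2*n}" "i = K m \<or> i = \<pi> (K m)" by (auto simp: U_def used_def)
    then have m': "m \<in> {n+1..2*n-1}" by auto
    have "F m \<in> subtrees t" unfolding img using m' by (intro imageI) auto
    then have "siblings t (F (K m)) (F (\<pi> (K m)))"
      using FN[OF m'] join_cases[of "F (K m)" "F (\<pi> (K m))"] by (auto simp: siblings_def)
    then show ?thesis using m(2) siblings_sym matching_onD(3)[OF \<pi>, of "K m"] by auto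
  qed
  show thesis using that[OF t(2,1,3) enum sib] by blast
qed

section \<open>Chen's bijection\<close>

text \<open>\<open>T\<close> inverts Chen's labels. The assumption \<open>lab\<close> ends at
  \<open>2*n-2\<close> because the root has no Chen label, while \<open>T\<close> numbers it
  \<open>2*n-1\<close>.\<close>

locale labelled_tree =
  fixes t :: btree and n :: nat and T :: "nat \<Rightarrow> btree"
  assumes d: "distinct (leaves t)" and s: "set (leaves t) = {1..n}" and n: "2 \<le> n"
    and enum: "chen_enum t n T"
    and lab: "\<And>i. i \<in> {1..2*n-2} \<Longrightarrow> chen_labels t (T i) = Some i"
begin

lemma T_inj: "T i = T j \<Longrightarrow> i \<in> {1..2*n-1} \<Longrightarrow> j \<in> {1..2*n-1} \<Longrightarrow> i = j"
  using inj_onD[OF chen_enumD(2)[OF enum]] .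

lemma T_leaf: "i \<in> {1..n} \<Longrightarrow> T i = Lf i"
  using chen_enumD(1)[OF enum] .

lemma T_root: "T (2*n-1) = t"
  using chen_enumD(4)[OF enum] .

lemma T_image: "T ` {1..2*n-2} = subtrees t - {t}"
proof -
  have ivl: "{1..2*n-1} = insert (2*n-1) {1..2*n-2}" using n by auto
  have "t \<notin> T ` {1..2*n-2}"
  proof
    assume "t \<in> T ` {1..2*n-2}"
    then obtain i where i: "i \<in> {1..2*n-2}" "T i = T (2*n-1)" using T_root by auto
    have "i \<in> {1..2*n-1}" "2*n-1 \<in> {1..2*n-1}" "i \<noteq> 2*n-1" using i(1) n by auto
    then show False using T_inj[OF i(2)] by blast
  qed
  moreover have "subtrees t = insert t (T ` {1..2*n-2})"
    using chen_enumD(3)[OF enum] unfolding ivl image_insert T_root by (rule sym)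
  ultimately show ?thesis by (metis Diff_insert_absorb)
qed

lemma T_proper: "i \<in> {1..2*n-2} \<Longrightarrow> T i \<in> subtrees t \<and> T i \<noteq> t"
  using T_image by blast

lemma T_node: "i \<in> {1..2*n-1} \<Longrightarrow> is_node (T i) \<longleftrightarrow> n < i"
  using T_leaf[of i] chen_enumD(5)[OF enum, of i] by (cases "n < i") (auto simp: is_node_def)

lemma sib_lab_iff:
  "sib_lab t i j \<longleftrightarrow> i \<in> {1..2*n-2} \<and> j \<in> {1..2*n-2} \<and> siblings t (T i) (T j)"
proof
  have lbl: "v = T i \<and> i \<in> {1..2*n-2}" if v: "v \<in> subtrees t" "v \<noteq> t" and l: "chen_labels t v = Some i" for v i
  proof -
    have "v \<in> T ` {1..2*n-2}" using v unfolding T_image by simp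
    then obtain i' where "i' \<in> {1..2*n-2}" "v = T i'" by (elim imageE)
    then show ?thesis using lab l by simp
  qed
  assume "sib_lab t i j"
  then obtain a b where ab: "siblings t a b" "chen_labels t a = Some i" "chen_labels t b = Some j"
    unfolding sib_lab_def siblings_def by blast
  then have "siblings t b a" using siblings_sym by blast
  then show "i \<in> {1..2*n-2} \<and> j \<in> {1..2*n-2} \<and> siblings t (T i) (T j)"
    using lbl[OF siblings_subtrees[OF ab(1)] ab(2)] lbl[OF siblings_subtrees[OF \<open>siblings t b a\<close>] ab(3)] ab(1) by simp
next
  assume "i \<in> {1..2*n-2} \<and> j \<in> {1..2*n-2} \<and> siblings t (T i) (T j)"
  then show "sib_lab t i j" unfolding sib_lab_def siblings_def using lab by blast
qed

lemma sib_lab_unique: "sib_lab t i j \<Longrightarrow> sib_lab t i j' \<Longrightarrow> j = j'"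
proof -
  assume a: "sib_lab t i j" "sib_lab t i j'"
  then have "T j = T j'" using siblings_unique[OF d] unfolding sib_lab_iff by metis
  then show ?thesis using T_inj a unfolding sib_lab_iff by fastforce
qed

lemma sib_lab_exists: "i \<in> {1..2*n-2} \<Longrightarrow> \<exists>j. sib_lab t i j"
proof -
  assume i: "i \<in> {1..2*n-2}"
  then obtain w where w: "siblings t (T i) w" using siblings_exist T_proper by blast
  then have "w \<in> T ` {1..2*n-2}"
    unfolding T_image using siblings_subtrees[of t w "T i"] siblings_sym by blast
  then show ?thesis using w i unfolding sib_lab_iff by (elim imageE) blast
qed

lemma Psi_eqI: "sib_lab t i j \<Longrightarrow> Psi t i = j"
proof -
  assume a: "sib_lab t i j"
  have "(THE j. sib_lab t i j) = j" using a by (rule the_equality) (rule sib_lab_unique[OF _ a])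
  then show ?thesis unfolding Psi_def using a by auto
qed

lemma Psi_sib: "i \<in> {1..2*n-2} \<Longrightarrow> sib_lab t i (Psi t i)"
  using sib_lab_exists Psi_eqI by blast

lemma Psi_siblings:
  assumes "i \<in> {1..2*n-2}"
  shows "Psi t i \<in> {1..2*n-2}" "siblings t (T i) (T (Psi t i))"
  using Psi_sib[OF assms] by (simp_all add: sib_lab_iff)

lemma Psi_outside: "i \<notin> {1..2*n-2} \<Longrightarrow> Psi t i = i"
  unfolding Psi_def sib_lab_iff by auto

lemma Psi_matching: "matching_on (2*n-2) (Psi t)"
  unfolding matching_on_def
proof (intro conjI allI impI ballI)
  fix i assume i: "i \<in> {1..2*n-2}"
  show "Psi t i \<noteq> i" using siblings_neq[OF d Psi_siblings(2)[OF i]] by metis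
  have "sib_lab t (Psi t i) i" using Psi_sib[OF i] siblings_sym unfolding sib_lab_iff by blast
  then show "Psi t (Psi t i) = i" by (rule Psi_eqI)
qed (rule Psi_outside)

lemma nleaves: "nleaves t = n"
  using distinct_card[OF d] s by (simp add: nleaves_def)

lemma sibling_T:
  assumes k: "k \<in> {1..2*n-2}"
  shows "sibling t (T k) = T (Psi t k)"
  unfolding sibling_def siblings_def[symmetric]
  by (rule the_equality, rule Psi_siblings(2)[OF k]) (rule siblings_unique[OF d _ Psi_siblings(2)[OF k]])

end

section \<open>Marks expressed on matchings\<close>

definition extend_root :: "nat \<Rightarrow> (nat \<Rightarrow> nat) \<Rightarrow> nat \<Rightarrow> nat" where
  "extend_root n \<pi> = \<pi>(2*n-1 := 2*n, 2*n := 2*n-1)"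

text \<open>\<open>Psi'\<close> in terms of matchings alone, \<open>k\<close> being the label of the
  mark. Later updates win, so they stand in the reverse order of the tests in
  \<open>Psi'\<close>.\<close>

definition extend_at :: "nat \<Rightarrow> (nat \<Rightarrow> nat) \<Rightarrow> nat \<Rightarrow> nat \<Rightarrow> nat" where
  "extend_at n \<pi> k = \<pi>(2*n-1 := \<pi> k, 2*n := k, \<pi> k := 2*n-1, k := 2*n)"

lemma Psi'_root: "Psi' (t, t) = extend_root (nleaves t) (Psi t)"
proof -
  have "0 < nleaves t" by (simp add: nleaves_def)
  then show ?thesis by (auto simp: Psi'_def extend_root_def Let_def fun_eq_iff)
qed

lemma (in labelled_tree) Psi'_T:
  assumes k: "k \<in> {1..2*n-2}"
  shows "Psi' (t, T k) = extend_at n (Psi t) k"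
  unfolding Psi'_def extend_at_def
proof -
  have 1: "the (chen_labels t (T k)) = k" "the (chen_labels t (sibling t (T k))) = Psi t k" "T k \<noteq> t"
    using T_proper[OF k] lab[OF k] sibling_T[OF k] lab[OF Psi_siblings(1)[OF k]] by simp_all
  show "(\<lambda>(t, v) i. let n = nleaves t; \<pi> = Psi t in
     if v = t then (if i = 2*n - 1 then 2*n else if i = 2*n then 2*n - 1 else \<pi> i)
     else (let k = the (chen_labels t v); l = the (chen_labels t (sibling t v)) in
           if i = k then 2*n else if i = l then 2*n - 1
           else if i = 2*n then k else if i = 2*n - 1 then l else \<pi> i)) (t, T k) =
    (Psi t)(2*n-1 := Psi t k, 2*n := k, Psi t k := 2*n-1, k := 2*n)"
    by (rule ext) (simp only: prod.case Let_def nleaves 1 if_False fun_upd_apply)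
qed

text \<open>Labels above \<open>n\<close> are those of internal vertices, so a leaf has an internal
  sibling when its partner exceeds \<open>n\<close>; the extra pair of \<open>2*n-1\<close> and
  \<open>2*n\<close> contains no leaf label.\<close>

lemma (in labelled_tree) qs_leaves_root_eq:
  "qs_leaves (t, t) = {i\<in>{1..n}. Psi' (t, t) i \<in> {n+1..2*n-1}}"
proof -
  have "i \<in> single_leaves t \<longleftrightarrow> i \<in> {1..n} \<and> Psi' (t, t) i \<in> {n+1..2*n-1}" for i
  proof (cases "i \<in> {1..n}")
    case True
    then have i: "i \<in> {1..2*n-2}" using n by auto
    note P = Psi_siblings[OF i]
    have "i \<in> single_leaves t \<longleftrightarrow> (\<exists>w. siblings t (Lf i) w \<and> is_node w)"
      unfolding single_leaves_def siblings_def by blast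
    also have "\<dots> \<longleftrightarrow> is_node (T (Psi t i))"
      using P(2) siblings_unique[OF d P(2)] unfolding T_leaf[OF True] by blast
    also have "\<dots> \<longleftrightarrow> n < Psi t i" using T_node[of "Psi t i"] P(1) by auto
    finally show ?thesis using True P(1) i n unfolding Psi'_root nleaves extend_root_def by auto
  next
    case False
    then show ?thesis using single_leaves_subset[of t] s by blast
  qed
  then show ?thesis unfolding qs_leaves_root by blast
qed

text \<open>If the sibling of the mark is a leaf, it is sent to \<open>2*n-1\<close> and so enters
  the range whatever the mark is; a marked leaf is sent to \<open>2*n\<close>, just outside.\<close>

lemma (in labelled_tree) qs_leaves_T_eq:
  assumes k: "k \<in> {1..2*n-2}"
  shows "qs_leaves (t, T k) = {i\<in>{1..n}. Psi' (t, T k) i \<in> {n+1..2*n-1}}"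
proof -
  have "i \<in> qs_leaves (t, T k) \<longleftrightarrow> i \<in> {1..n} \<and> Psi' (t, T k) i \<in> {n+1..2*n-1}" for i
  proof (cases "i \<in> {1..n}")
    case True
    then have i: "i \<in> {1..2*n-2}" using n by auto
    note P = Psi_siblings[OF i]
    have r: "i \<in> {1..2*n-1}" "k \<in> {1..2*n-1}" "Psi t i \<in> {1..2*n-1}" using i k P(1) by auto
    have "i \<in> qs_leaves (t, T k) \<longleftrightarrow> Lf i \<noteq> T k \<and> (\<exists>w. siblings t (Lf i) w \<and> (w = T k \<or> is_node w))"
      unfolding qs_leaves_def siblings_def by auto
    also have "\<dots> \<longleftrightarrow> T i \<noteq> T k \<and> (T (Psi t i) = T k \<or> is_node (T (Psi t i)))"
      using P(2) siblings_unique[OF d P(2)] unfolding T_leaf[OF True] by blast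
    also have "\<dots> \<longleftrightarrow> i \<noteq> k \<and> (Psi t i = k \<or> n < Psi t i)"
      using T_node[OF r(3)] T_inj[OF _ r(1,2)] T_inj[OF _ r(3,2)] by blast
    also have "Psi t i = k \<longleftrightarrow> i = Psi t k" using matching_onD(3)[OF Psi_matching] by metis
    finally show ?thesis
      using True P(1) i n unfolding Psi'_T[OF k] extend_at_def by auto
  next
    case False
    then show ?thesis using qs_leaves_subset[of t "T k"] s by blast
  qed
  then show ?thesis by blast
qed

lemma labelled_tree_exists:
  assumes "distinct (leaves t)" "set (leaves t) = {1..n}" "2 \<le> n"
  obtains T where "labelled_tree t n T"
proof -
  obtain T where T: "chen_enum t n T" "\<And>i. i \<in> {1..2*n-2} \<Longrightarrow> chen_labels t (T i) = Some i"
    using chen_enum_exists[OF assms] by metis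
  have "labelled_tree t n T" by (rule labelled_tree.intro[OF assms T])
  then show thesis by (rule that)
qed

section \<open>Chen's map as a bijection, size 1 included\<close>

definition trees :: "nat \<Rightarrow> btree set" where
  "trees n = {t. canonical t \<and> distinct (leaves t) \<and> set (leaves t) = {1..n}}"

lemma trees_1: "t \<in> trees 1 \<longleftrightarrow> t = Lf 1"
proof
  assume t: "t \<in> trees 1"
  then have l: "length (leaves t) = 1" using distinct_card[of "leaves t"] by (simp add: trees_def)
  show "t = Lf 1"
  proof (cases t)
    case (Lf i)
    then show ?thesis using t by (simp add: trees_def)
  next
    case (Nd a b)
    have "0 < length (leaves a)" "0 < length (leaves b)" by simp_all
    then show ?thesis using l Nd by (metis One_nat_def add_is_1 leaves.simps(2) length_append less_numeral_extra(3))
  qed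
qed (simp add: trees_def)

lemma Psi_Lf: "Psi (Lf i) = id"
  by (auto simp: Psi_def sib_lab_def fun_eq_iff)

text \<open>For \<open>n = 1\<close> there is no vertex below the root, so any \<open>T\<close> will
  do; for larger \<open>n\<close> the labelling results apply.\<close>

lemma Psi'_trees:
  assumes t: "t \<in> trees n" and n: "1 \<le> n"
  obtains T where "bij_betw T {1..2*n-2} (subtrees t - {t})" "matching_on (2*n-2) (Psi t)"
    "Psi' (t, t) = extend_root n (Psi t)" "\<And>k. k \<in> {1..2*n-2} \<Longrightarrow> Psi' (t, T k) = extend_at n (Psi t) k"
    "\<And>v. v \<in> subtrees t \<Longrightarrow> qs_leaves (t, v) = {i\<in>{1..n}. Psi' (t, v) i \<in> {n+1..2*n-1}}"
proof (cases "n = 1")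
  case True
  then have t1: "t = Lf 1" using t trees_1 by simp
  have "qs_leaves (Lf 1, Lf 1) = {}" by (simp add: qs_leaves_root)
  then show ?thesis using that[of "\<lambda>_. t"] True t1 Psi'_root[of t]
    by (simp add: Psi_Lf matching_on_def nleaves_def bij_betw_def)
next
  case False
  then have n2: "2 \<le> n" using n by simp
  obtain T where T: "labelled_tree t n T" using labelled_tree_exists[OF _ _ n2] t by (auto simp: trees_def)
  interpret labelled_tree t n T by (rule T)
  have "inj_on T {1..2*n-2}" by (rule inj_on_subset[OF chen_enumD(2)[OF enum]]) auto
  then have bij: "bij_betw T {1..2*n-2} (subtrees t - {t})" using T_image by (simp add: bij_betw_def)
  have qs: "qs_leaves (t, v) = {i\<in>{1..n}. Psi' (t, v) i \<in> {n+1..2*n-1}}" if "v \<in> subtrees t" for v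
  proof (cases "v = t")
    case True
    then show ?thesis using qs_leaves_root_eq by simp
  next
    case False
    then have "v \<in> T ` {1..2*n-2}" using that unfolding T_image by simp
    then obtain k where "k \<in> {1..2*n-2}" "v = T k" by (elim imageE)
    then show ?thesis using qs_leaves_T_eq by simp
  qed
  show ?thesis using that[OF bij Psi_matching] Psi'_root[of t] nleaves Psi'_T qs by simp
qed

text \<open>On \<open>{1..2*n-2}\<close> the matching is the sibling relation of labels, which
  determines the enumeration; the trees are its values at \<open>2*n-1\<close>.\<close>

lemma Psi_inj:
  assumes t: "t \<in> trees n" and u: "u \<in> trees n" and n: "1 \<le> n" and eq: "Psi t = Psi u"
  shows "t = u"
proof (cases "n = 1")
  case True
  then show ?thesis using t u trees_1 by simp
next
  case False
  then have n2: "2 \<le> n" using n by simp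
  obtain T where T: "labelled_tree t n T" using labelled_tree_exists[OF _ _ n2] t by (auto simp: trees_def)
  obtain G where G: "labelled_tree u n G" using labelled_tree_exists[OF _ _ n2] u by (auto simp: trees_def)
  interpret T: labelled_tree t n T by (rule T)
  interpret G: labelled_tree u n G by (rule G)
  have "siblings t (T i) (T j) \<longleftrightarrow> siblings u (G i) (G j)" if "i \<in> {1..2*n-2}" "j \<in> {1..2*n-2}" for i j
  proof -
    have "sib_lab t i j \<longleftrightarrow> Psi t i = j" using T.Psi_eqI T.Psi_sib that by blast
    moreover have "sib_lab u i j \<longleftrightarrow> Psi u i = j" using G.Psi_eqI G.Psi_sib that by blast
    ultimately show ?thesis using eq that unfolding T.sib_lab_iff G.sib_lab_iff by simp
  qed
  then have "T (2*n-1) = G (2*n-1)"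
    using chen_enum_inj[OF T.enum G.enum T.d G.d, of "2*n-1"] t u n2 by (simp add: trees_def)
  then show ?thesis using T.T_root G.T_root by simp
qed

text \<open>The tree built from \<open>\<pi>\<close> comes with a greedy enumeration
  \<open>G\<close>; uniqueness makes \<open>G\<close> agree with Chen's labelling, so the sibling
  pairs of \<open>Psi t\<close> are the pairs of \<open>\<pi>\<close>.\<close>

lemma Psi_surj:
  assumes \<pi>: "matching_on (2*n-2) \<pi>" and n: "1 \<le> n"
  obtains t where "t \<in> trees n" "Psi t = \<pi>"
proof (cases "n = 1")
  case True
  then have "\<pi> = id" using \<pi> by (auto simp: matching_on_def)
  then show ?thesis using that[of "Lf 1"] True trees_1 Psi_Lf by simp
next
  case False
  then have n2: "2 \<le> n" using n by simp
  obtain t G where t: "canonical t" "distinct (leaves t)" "set (leaves t) = {1..n}" and G: "chen_enum t n G"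
    and sib: "\<And>i. i \<in> {1..2*n-2} \<Longrightarrow> siblings t (G i) (G (\<pi> i))"
    using chen_enum_surj[OF \<pi> n2] by blast
  obtain T where T: "labelled_tree t n T" using labelled_tree_exists[OF t(2,3) n2] by blast
  interpret labelled_tree t n T by (rule T)
  have TG: "T i = G i" if "i \<in> {1..2*n-2}" for i using chen_enum_unique[OF enum G d, of i] that by auto
  have "Psi t i = \<pi> i" for i
  proof (cases "i \<in> {1..2*n-2}")
    case True
    have "\<pi> i \<in> {1..2*n-2}" using matching_onD(4)[OF \<pi> True] .
    then show ?thesis using True sib[OF True] TG by (intro Psi_eqI) (simp add: sib_lab_iff)
  next
    case False
    then show ?thesis using Psi_outside matching_onD(1)[OF \<pi>] by simp
  qed
  then have "Psi t = \<pi>" by (rule ext)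
  then show ?thesis using that t by (simp add: trees_def)
qed

section \<open>Extending a matching by two points\<close>

lemma extend_root_matching:
  assumes \<pi>: "matching_on (2*n-2) \<pi>" and n: "1 \<le> n"
  shows "matching_on (2*n) (extend_root n \<pi>)"
proof -
  note D = matching_onD[OF \<pi>]
  have ne: "2*n \<noteq> 2*n-1" using n by simp
  have E: "extend_root n \<pi> (2*n) = 2*n-1" "extend_root n \<pi> (2*n-1) = 2*n"
    "\<And>i. i \<noteq> 2*n \<Longrightarrow> i \<noteq> 2*n-1 \<Longrightarrow> extend_root n \<pi> i = \<pi> i"
    using ne by (simp_all add: extend_root_def)
  show ?thesis unfolding matching_on_def
  proof (intro conjI allI impI)
    fix i assume i: "i \<notin> {1..2*n}"
    then have "i \<noteq> 2*n" "i \<noteq> 2*n-1" "i \<notin> {1..2*n-2}" using n by auto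
    then show "extend_root n \<pi> i = i" using E(3) D(1) by simp
  next
    show "\<forall>i\<in>{1..2*n}. extend_root n \<pi> i \<noteq> i \<and> extend_root n \<pi> (extend_root n \<pi> i) = i"
    proof
      fix i assume i: "i \<in> {1..2*n}"
      consider "i = 2*n" | "i = 2*n-1" | "i \<noteq> 2*n" "i \<noteq> 2*n-1" by blast
      then show "extend_root n \<pi> i \<noteq> i \<and> extend_root n \<pi> (extend_root n \<pi> i) = i"
      proof cases
        case 3
        then have i2: "i \<in> {1..2*n-2}" using i by auto
        have "\<pi> i \<noteq> 2*n" "\<pi> i \<noteq> 2*n-1" using D(4)[OF i2] by auto
        then show ?thesis using E(3)[OF 3] E(3)[of "\<pi> i"] D(2)[OF i2] D(3) by simp
      qed (use E(1,2) ne in metis)+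
    qed
  qed
qed

lemma extend_at_simps:
  assumes \<pi>: "matching_on (2*n-2) \<pi>" and k: "k \<in> {1..2*n-2}"
  shows "extend_at n \<pi> k k = 2*n" "extend_at n \<pi> k (\<pi> k) = 2*n-1"
    "extend_at n \<pi> k (2*n) = k" "extend_at n \<pi> k (2*n-1) = \<pi> k"
    "\<And>i. i \<notin> {k, \<pi> k, 2*n, 2*n-1} \<Longrightarrow> extend_at n \<pi> k i = \<pi> i"
proof -
  have "\<pi> k \<in> {1..2*n-2}" "\<pi> k \<noteq> k" using matching_onD(2,4)[OF \<pi> k] by blast+
  then have "k \<noteq> 2*n" "k \<noteq> 2*n-1" "\<pi> k \<noteq> 2*n" "\<pi> k \<noteq> 2*n-1" "\<pi> k \<noteq> k" "2*n \<noteq> 2*n-1" using k by auto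
  then show "extend_at n \<pi> k k = 2*n" "extend_at n \<pi> k (\<pi> k) = 2*n-1"
    "extend_at n \<pi> k (2*n) = k" "extend_at n \<pi> k (2*n-1) = \<pi> k"
    "\<And>i. i \<notin> {k, \<pi> k, 2*n, 2*n-1} \<Longrightarrow> extend_at n \<pi> k i = \<pi> i"
    by (simp_all add: extend_at_def)
qed

lemma extend_at_matching:
  assumes \<pi>: "matching_on (2*n-2) \<pi>" and k: "k \<in> {1..2*n-2}"
  shows "matching_on (2*n) (extend_at n \<pi> k)"
proof -
  note D = matching_onD[OF \<pi>] and E = extend_at_simps[OF \<pi> k]
  have ne: "k \<noteq> 2*n" "\<pi> k \<noteq> 2*n-1" "\<pi> k \<in> {1..2*n-2}" "k \<noteq> 2*n-1" "\<pi> k \<noteq> 2*n"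
    using k D(4)[OF k] by auto
  show ?thesis unfolding matching_on_def
  proof (intro conjI allI impI)
    fix i assume i: "i \<notin> {1..2*n}"
    then have "i \<notin> {k, \<pi> k, 2*n, 2*n-1}" "i \<notin> {1..2*n-2}" using k ne(3) by auto
    then show "extend_at n \<pi> k i = i" using E(5) D(1) by simp
  next
    show "\<forall>i\<in>{1..2*n}. extend_at n \<pi> k i \<noteq> i \<and> extend_at n \<pi> k (extend_at n \<pi> k i) = i"
    proof
      fix i assume i: "i \<in> {1..2*n}"
      show "extend_at n \<pi> k i \<noteq> i \<and> extend_at n \<pi> k (extend_at n \<pi> k i) = i"
      proof (cases "i \<in> {k, \<pi> k, 2*n, 2*n-1}")
        case True
        then show ?thesis using E(1-4) ne by (elim insertE emptyE) (simp_all only:, metis+)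
      next
        case False
        then have i2: "i \<in> {1..2*n-2}" using i by auto
        have "\<pi> i \<noteq> k" "\<pi> i \<noteq> \<pi> k" using False D(3) by (metis insertCI)+
        moreover have "\<pi> i \<noteq> 2*n" "\<pi> i \<noteq> 2*n-1" using D(4)[OF i2] by auto
        ultimately have "\<pi> i \<notin> {k, \<pi> k, 2*n, 2*n-1}" by simp
        then show ?thesis using E(5)[of i] E(5)[of "\<pi> i"] False D(2)[OF i2] D(3) by simp
      qed
    qed
  qed
qed

lemma extend_root_inj:
  assumes "matching_on (2*n-2) \<pi>" "matching_on (2*n-2) \<rho>" "extend_root n \<pi> = extend_root n \<rho>" "1 \<le> n"
  shows "\<pi> = \<rho>"
proof
  fix i
  show "\<pi> i = \<rho> i"
  proof (cases "i = 2*n \<or> i = 2*n-1")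
    case True
    then have "i \<notin> {1..2*n-2}" using assms(4) by auto
    then show ?thesis using matching_onD(1) assms(1,2) by metis
  next
    case False
    then show ?thesis using fun_cong[OF assms(3), of i] by (simp add: extend_root_def)
  qed
qed

text \<open>The values at \<open>2*n\<close> and \<open>2*n-1\<close> give back \<open>k\<close> and
  its former partner; at all other labels the matching is unchanged.\<close>

lemma extend_at_inj:
  assumes "matching_on (2*n-2) \<pi>" "matching_on (2*n-2) \<rho>" "extend_at n \<pi> k = extend_at n \<rho> l"
    "k \<in> {1..2*n-2}" "l \<in> {1..2*n-2}"
  shows "\<pi> = \<rho>" "k = l"
proof -
  show kl: "k = l" using extend_at_simps(3)[OF assms(1,4)] extend_at_simps(3)[OF assms(2,5)] assms(3) by simp
  have eq: "\<pi> k = \<rho> k" using extend_at_simps(4)[OF assms(1,4)] extend_at_simps(4)[OF assms(2,5)] assms(3) kl by simp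
  have inv: "\<pi> (\<pi> k) = k" "\<rho> (\<rho> k) = k" using matching_onD(3) assms(1,2) by blast+
  show "\<pi> = \<rho>"
  proof
    fix i
    show "\<pi> i = \<rho> i"
    proof (cases "i \<in> {k, \<pi> k, 2*n, 2*n-1}")
      case True
      moreover have "\<pi> i = i \<and> \<rho> i = i" if "i \<in> {2*n, 2*n-1}"
      proof -
        have "i \<notin> {1..2*n-2}" using that assms(4) by auto
        then show ?thesis using matching_onD(1) assms(1,2) by metis
      qed
      ultimately show ?thesis using eq inv by auto
    next
      case False
      then show ?thesis using fun_cong[OF assms(3), of i] kl eq by (simp add: extend_at_def)
    qed
  qed
qed

lemma extend_root_neq_extend_at:
  assumes "matching_on (2*n-2) \<rho>" "k \<in> {1..2*n-2}"
  shows "extend_root n \<pi> \<noteq> extend_at n \<rho> k"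
proof
  assume "extend_root n \<pi> = extend_at n \<rho> k"
  then have "2*n-1 = k" using extend_at_simps(3)[OF assms] by (metis extend_root_def fun_upd_same)
  then show False using assms(2) by auto
qed

text \<open>The partner of \<open>2*n\<close> tells the cases apart: it is \<open>2*n-1\<close> for
  a marked root and the label of the mark otherwise.\<close>

lemma extend_cases:
  assumes \<rho>: "matching_on (2*n) \<rho>" and n: "1 \<le> n"
  obtains \<pi> where "matching_on (2*n-2) \<pi>" "\<rho> = extend_root n \<pi>"
  | \<pi> k where "matching_on (2*n-2) \<pi>" "k \<in> {1..2*n-2}" "\<rho> = extend_at n \<pi> k"
proof -
  define k l where "k = \<rho> (2*n)" and "l = \<rho> (2*n-1)"
  have mem: "2*n \<in> {1..2*n}" "2*n-1 \<in> {1..2*n}" using n by auto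
  note D = matching_onD[OF \<rho>]
  have kl: "\<rho> k = 2*n" "\<rho> l = 2*n-1" "k \<noteq> 2*n" "l \<noteq> 2*n-1" "k \<in> {1..2*n}" "l \<in> {1..2*n}"
    using D(2)[OF mem(1)] D(2)[OF mem(2)] D(3) D(4)[OF mem(1)] D(4)[OF mem(2)] by (simp_all add: k_def l_def)
  have in2: "i \<in> {1..2*n-2}" if "i \<in> {1..2*n}" "i \<noteq> 2*n" "i \<noteq> 2*n-1" for i using that by auto
  have in3: "i \<in> {1..2*n}" "i \<noteq> 2*n" "i \<noteq> 2*n-1" if "i \<in> {1..2*n-2}" for i using that n by auto
  show thesis
  proof (cases "k = 2*n-1")
    case True
    then have l: "l = 2*n" using kl(1) by (simp add: l_def)
    define \<pi> where "\<pi> = \<rho>(2*n := 2*n, 2*n-1 := 2*n-1)"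
    have "\<rho> i \<noteq> 2*n \<and> \<rho> i \<noteq> 2*n-1" if "i \<in> {1..2*n-2}" for i
      using in3[OF that] D(3)[of i] True l by (metis k_def l_def)
    moreover have "\<rho> i = i" if "i \<notin> {1..2*n-2}" "i \<noteq> 2*n" "i \<noteq> 2*n-1" for i
      using D(1)[of i] in2[of i] that by blast
    ultimately have "matching_on (2*n-2) \<pi>"
      unfolding matching_on_def \<pi>_def using D(2,3) in3 by auto
    moreover have "\<rho> = extend_root n \<pi>"
      using True l n by (auto simp: extend_root_def \<pi>_def fun_eq_iff k_def l_def)
    ultimately show ?thesis using that(1) by blast
  next
    case False
    then have k2: "k \<in> {1..2*n-2}" using in2 kl by blast
    have "l \<noteq> 2*n" using False kl(2) by (auto simp: k_def)
    then have l2: "l \<in> {1..2*n-2}" using in2 kl by blast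
    have neq: "k \<noteq> l" using kl(1,2) n by auto
    \<comment> \<open>Undoes the insertion: the partners of \<open>2*n\<close> and
      \<open>2*n-1\<close> are paired with each other again.\<close>
    define \<pi> where "\<pi> = \<rho>(k := l, l := k, 2*n := 2*n, 2*n-1 := 2*n-1)"
    have \<pi>k: "\<pi> k = l" "\<pi> l = k" using in3[OF k2] in3[OF l2] neq by (auto simp: \<pi>_def)
    have other: "\<pi> i = \<rho> i \<and> \<rho> i \<notin> {k, l, 2*n, 2*n-1}" if "i \<notin> {k, l, 2*n, 2*n-1}" for i
    proof -
      have "\<rho> i \<noteq> k" "\<rho> i \<noteq> l" "\<rho> i \<noteq> 2*n" "\<rho> i \<noteq> 2*n-1" using D(3)[of i] that kl(1,2) k_def l_def by auto
      then show ?thesis using that by (simp add: \<pi>_def)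
    qed
    have "matching_on (2*n-2) \<pi>"
      unfolding matching_on_def
    proof (intro conjI allI impI ballI)
      fix i assume i: "i \<notin> {1..2*n-2}"
      show "\<pi> i = i"
      proof (cases "i = 2*n \<or> i = 2*n-1")
        case False
        then have "i \<notin> {k, l, 2*n, 2*n-1}" using i k2 l2 by auto
        then show ?thesis using other[of i] D(1)[of i] in2[of i] i by auto
      qed (auto simp: \<pi>_def)
    next
      fix i assume i: "i \<in> {1..2*n-2}"
      have "\<pi> i \<noteq> i \<and> \<pi> (\<pi> i) = i"
      proof (cases "i = k \<or> i = l")
        case True
        then show ?thesis using \<pi>k neq by auto
      next
        case False
        then have "i \<notin> {k, l, 2*n, 2*n-1}" using in3[OF i] by auto
        then show ?thesis using other[of i] other[of "\<rho> i"] D(2)[OF in3(1)[OF i]] D(3)[of i] by auto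
      qed
      then show "\<pi> i \<noteq> i" "\<pi> (\<pi> i) = i" by simp_all
    qed
    moreover have "\<rho> = extend_at n \<pi> k"
    proof
      fix i
      show "\<rho> i = extend_at n \<pi> k i"
      proof (cases "i \<in> {k, l, 2*n, 2*n-1}")
        case True
        then show ?thesis
          using kl(1,2) neq in3[OF k2] in3[OF l2] n unfolding extend_at_def \<pi>k by (auto simp: k_def l_def)
      next
        case False
        then show ?thesis using other[OF False] unfolding extend_at_def \<pi>k by simp
      qed
    qed
    ultimately show ?thesis using that(2) k2 by blast
  qed
qed

text \<open>The unmarked tree is a matching on \<open>{1..2*n-2}\<close> by Chen's bijection, and a
  mark is either the root or one of the labels in that set; these are the two ways to extend the
  matching by two points.\<close>

lemma bij_betw_Psi'_all:
  assumes n: "1 \<le> n"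
  shows "bij_betw Psi' (SIGMA t:trees n. subtrees t) {\<rho>. matching_on (2*n) \<rho>}"
proof (rule bij_betw_imageI)
  have mark: "v = t \<and> Psi' (t, v) = extend_root n (Psi t) \<or>
      (\<exists>k\<in>{1..2*n-2}. v = T k \<and> Psi' (t, v) = extend_at n (Psi t) k)"
    if "v \<in> subtrees t" "bij_betw T {1..2*n-2} (subtrees t - {t})" "Psi' (t, t) = extend_root n (Psi t)"
      "\<And>k. k \<in> {1..2*n-2} \<Longrightarrow> Psi' (t, T k) = extend_at n (Psi t) k" for t v T
  proof (cases "v = t")
    case True
    then show ?thesis using that(3) by simp
  next
    case False
    then have "v \<in> T ` {1..2*n-2}" using that(1,2) by (simp add: bij_betw_def)
    then obtain k where "k \<in> {1..2*n-2}" "v = T k" by (elim imageE)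
    then show ?thesis using that(4) by blast
  qed
  show "inj_on Psi' (SIGMA t:trees n. subtrees t)"
  proof (rule inj_onI, clarify)
    fix t v u w
    assume t: "t \<in> trees n" "v \<in> subtrees t" and u: "u \<in> trees n" "w \<in> subtrees u" and eq: "Psi' (t, v) = Psi' (u, w)"
    obtain T where T: "bij_betw T {1..2*n-2} (subtrees t - {t})" "matching_on (2*n-2) (Psi t)"
      "Psi' (t, t) = extend_root n (Psi t)" "\<And>k. k \<in> {1..2*n-2} \<Longrightarrow> Psi' (t, T k) = extend_at n (Psi t) k"
      using Psi'_trees[OF t(1) n] by metis
    obtain G where "bij_betw G {1..2*n-2} (subtrees u - {u})" and Gm: "matching_on (2*n-2) (Psi u)"
      and "Psi' (u, u) = extend_root n (Psi u)" "\<And>k. k \<in> {1..2*n-2} \<Longrightarrow> Psi' (u, G k) = extend_at n (Psi u) k"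
      using Psi'_trees[OF u(1) n] by metis
    note G = this(1,3,4)
    from mark[OF t(2) T(1,3,4)] mark[OF u(2) G] have "Psi t = Psi u"
      using eq extend_root_inj[OF T(2) Gm _ n] extend_at_inj(1)[OF T(2) Gm]
        extend_root_neq_extend_at[OF T(2)] extend_root_neq_extend_at[OF Gm] by metis
    then have tu: "t = u" using Psi_inj[OF t(1) u(1) n] by blast
    \<comment> \<open>With the trees equal, both marks are read through the same \<open>T\<close>,
      so equal labels mean equal marks.\<close>
    from mark[OF t(2) T(1,3,4)] mark[OF u(2)[folded tu] T(1,3,4)] have "v = w"
      using eq extend_at_inj(2)[OF T(2) T(2)] extend_root_neq_extend_at[OF T(2)] unfolding tu[symmetric] by metis
    then show "t = u \<and> v = w" using tu by blast
  qed
  show "Psi' ` (SIGMA t:trees n. subtrees t) = {\<rho>. matching_on (2*n) \<rho>}"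
  proof (intro equalityI subsetI)
    fix \<rho> assume "\<rho> \<in> Psi' ` (SIGMA t:trees n. subtrees t)"
    then obtain t v where t: "t \<in> trees n" "v \<in> subtrees t" "\<rho> = Psi' (t, v)" by auto
    obtain T where T: "bij_betw T {1..2*n-2} (subtrees t - {t})" "matching_on (2*n-2) (Psi t)"
      "Psi' (t, t) = extend_root n (Psi t)" "\<And>k. k \<in> {1..2*n-2} \<Longrightarrow> Psi' (t, T k) = extend_at n (Psi t) k"
      using Psi'_trees[OF t(1) n] by metis
    then show "\<rho> \<in> {\<rho>. matching_on (2*n) \<rho>}"
      using mark[OF t(2) T(1,3,4)] t(3) extend_root_matching[OF T(2) n] extend_at_matching[OF T(2)] by auto
  next
    fix \<rho> assume "\<rho> \<in> {\<rho>. matching_on (2*n) \<rho>}"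
    then have \<rho>: "matching_on (2*n) \<rho>" by simp
    have ex: "\<exists>t T. t \<in> trees n \<and> Psi t = \<pi> \<and> bij_betw T {1..2*n-2} (subtrees t - {t}) \<and>
      Psi' (t, t) = extend_root n \<pi> \<and> (\<forall>k\<in>{1..2*n-2}. Psi' (t, T k) = extend_at n \<pi> k)"
      if "matching_on (2*n-2) \<pi>" for \<pi>
    proof -
      note \<pi> = that
      obtain t where t: "t \<in> trees n" "Psi t = \<pi>" using Psi_surj[OF \<pi> n] by blast
      obtain T where "bij_betw T {1..2*n-2} (subtrees t - {t})"
        "Psi' (t, t) = extend_root n (Psi t)" "\<And>k. k \<in> {1..2*n-2} \<Longrightarrow> Psi' (t, T k) = extend_at n (Psi t) k"
        using Psi'_trees[OF t(1) n] by metis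
      then show ?thesis using t by blast
    qed
    show "\<rho> \<in> Psi' ` (SIGMA t:trees n. subtrees t)"
      using \<rho> n
    proof (cases rule: extend_cases)
      case (1 \<pi>)
      then obtain t where "t \<in> trees n" "Psi' (t, t) = \<rho>" using ex by metis
      then show ?thesis by (intro image_eqI[of _ _ "(t, t)"]) auto
    next
      case (2 \<pi> k)
      then obtain t T where t: "t \<in> trees n" "bij_betw T {1..2*n-2} (subtrees t - {t})" "Psi' (t, T k) = \<rho>" using ex by metis
      then have "T k \<in> subtrees t" using 2(2) bij_betwE by blast
      then show ?thesis using t by (intro image_eqI[of _ _ "(t, T k)"]) auto
    qed
  qed
qed

lemma bij_betw_fibre:
  assumes "bij_betw f A B" "\<And>x. x \<in> A \<Longrightarrow> p x = q (f x)"
  shows "bij_betw f {x\<in>A. p x = k} {y\<in>B. q y = k}"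
proof (rule bij_betw_subset[OF assms(1)])
  have B: "f ` A = B" using assms(1) by (rule bij_betw_imp_surj_on)
  show "f ` {x\<in>A. p x = k} = {y\<in>B. q y = k}" unfolding B[symmetric] using assms(2) by auto
qed auto

theorem bij_betw_Psi':
  assumes "1 \<le> n"
  shows "bij_betw Psi' (marked_trees n k) (matchings n k)"
proof -
  \<comment> \<open>The parameter \<open>k\<close> enters only here: the bijection of all marked
    trees respects the statistic and so restricts to each of its values.\<close>
  have stat: "card (qs_leaves x) = card {i\<in>{1..n}. Psi' x i \<in> {n+1..2*n-1}}" if "x \<in> (SIGMA t:trees n. subtrees t)" for x
  proof -
    have "x \<in> (SIGMA t:trees n. subtrees t)" by (rule that)
    then obtain t v where x: "x = (t, v)" "t \<in> trees n" "v \<in> subtrees t" by auto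
    then show ?thesis using Psi'_trees[OF x(2) assms] by metis
  qed
  have "bij_betw Psi' {x \<in> (SIGMA t:trees n. subtrees t). card (qs_leaves x) = k}
    {\<rho> \<in> {\<rho>. matching_on (2*n) \<rho>}. card {i\<in>{1..n}. \<rho> i \<in> {n+1..2*n-1}} = k}"
    by (rule bij_betw_fibre[OF bij_betw_Psi'_all[OF assms]]) (rule stat)
  moreover have "{x \<in> (SIGMA t:trees n. subtrees t). card (qs_leaves x) = k} = marked_trees n k"
    by (auto simp: marked_trees_def trees_def)
  moreover have "{\<rho> \<in> {\<rho>. matching_on (2*n) \<rho>}. card {i\<in>{1..n}. \<rho> i \<in> {n+1..2*n-1}} = k} = matchings n k"
    by (auto simp: matchings_def matching_on_def)
  ultimately show ?thesis by simp
qed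

theorem theorem5:
  fixes n k :: nat
  assumes "1 \<le> n"
  shows "bij_betw Phi' (pos_paths n k) (marked_trees n k) \<and>
         bij_betw Psi' (marked_trees n k) (matchings n k)"
  using bij_betw_Phi'[OF assms] bij_betw_Psi'[OF assms] by blast

end
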